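(* Let $G$ be a finite simple graph with $n\ge 1$ vertices, let $-\infty<\alpha<\infty$ and $-\infty\le\beta<\infty$, and let $\zeta(t)$, $t=0,1,2,\dots$, be the discrete-time Markov chain (DTMC) with parameters $\alpha,\beta,G$ described in the context. Let $\lambda_1(G)$ be the largest eigenvalue of the adjacency matrix of $G$, $\kappa(G)$ the independence number of $G$ and $e(G)$ the number of edges of $G$. (i) If $\alpha<0$ and $\alpha+\beta\lambda_1(G)<0$, then $\zeta(t)$ is positive recurrent. (ii) $\zeta(t)$ is null recurrent in the following cases: (a) $\alpha=0$, $\beta<0$ and $\kappa(G)\le 2$; (b) $\alpha=\beta=0$ and $n\le 2$; (c) $\alpha=0$, $\beta>0$, $e(G)=0$ and $n\le 2$. (iii) In all other cases $\zeta(t)$ is transient. This means the cases: (a) $\alpha>0$; (b) $\alpha=0$, $\beta>0$ and $e(G)>0$; (c) $\alpha=0$, $\beta>0$, $e(G)=0$ and $n\ge 3$; (d) $\alpha=\beta=0$ and $n\ge 3$; (e) $\alpha=0$, $\beta<0$ and $\kappa(G)\ge 3$; (f) $\alpha<0$ and $\alpha+\beta\lambda_1(G)\ge 0$.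
   Context: $G$ is a finite undirected graph, not necessarily connected, with vertices $1,\dots,n$ and without self-loops or multiple edges; $A$ is its adjacency matrix, and $i\sim j$ means that $i$ and $j$ are adjacent. $\mathbb{Z}_+=\{0,1,2,\dots\}$ and $\mathbf e_i$ is the $i$-th unit vector. The independence number $\kappa(G)$ is the largest cardinality of a set of vertices no two of which are adjacent. Define rates on $\mathbb{Z}_+^n$ by $$q_{\xi,\xi+\mathbf e_i}=e^{\alpha\xi_i+\beta(A\xi)_i}=e^{\alpha\xi_i+\beta\sum_{j:\,j\sim i}\xi_j},\qquad q_{\xi,\xi-\mathbf e_i}=1 \ \text{ if } \xi_i>0,$$ with all other rates $0$, and $q_\xi=\sum_\eta q_{\xi,\eta}$. The DTMC $\zeta(t)$ has transition probabilities $p_{\xi,\eta}=q_{\xi,\eta}/q_\xi$; that is, it is the embedded jump chain of the continuous-time Markov chain with rates $q_{\xi,\eta}$. Case $\beta=-\infty$ (hard-core interaction): the conventions $0\cdot\infty=0$ and $e^{-\infty}=0$ are used, so $\zeta_i$ can increase only when $\zeta_j=0$ for all $j\sim i$. In this case the chain is considered on the state space $\Gamma_0=\{\xi\in\mathbb{Z}_+^n:\ \xi_i\xi_j=0 \text{ whenever } i\sim j\}$, which is absorbing and on which the chain is irreducible. The convention $0\cdot\infty=0$ also applies to $\beta\lambda_1(G)$. *)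

theory Defs
  imports "HOL-Probability.Probability"
begin

section \<open>Discrete-time Markov chains\<close>

text \<open>
  A transition kernel is a function \<open>K :: 'a \<Rightarrow> 'a pmf\<close>. The law of the chain started at \<open>x\<close> is
  the Ionescu-Tulcea measure on the space of trajectories; \<open>path_step K x i \<omega>\<close> is the conditional
  law of the state at time \<open>i\<close> given the earlier states \<open>\<omega> 0, \<dots>, \<omega> (i - 1)\<close>.
\<close>

definition path_step :: "('a \<Rightarrow> 'a pmf) \<Rightarrow> 'a \<Rightarrow> nat \<Rightarrow> (nat \<Rightarrow> 'a) \<Rightarrow> 'a measure" where
  "path_step K x i \<omega> =
     (case i of 0 \<Rightarrow> measure_pmf (return_pmf x) | Suc k \<Rightarrow> measure_pmf (K (\<omega> k)))"

lemma path_step_0: "path_step K x 0 \<omega> = measure_pmf (return_pmf x)"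
  and path_step_Suc: "path_step K x (Suc k) \<omega> = measure_pmf (K (\<omega> k))"
  by (simp_all add: path_step_def)

interpretation mc: Ionescu_Tulcea "path_step K x" "\<lambda>_. count_space UNIV"
  for K :: "'b \<Rightarrow> 'b pmf" and x
proof (rule Ionescu_Tulcea.intro)
  fix i
  show "path_step K x i \<in> measurable (PiM {0..<i} (\<lambda>_. count_space UNIV))
          (subprob_algebra (count_space UNIV))"
  proof (cases i)
    case 0
    then show ?thesis
      by (auto simp: path_step_def[abs_def] space_subprob_algebra
          intro!: measurable_const measure_pmf.subprob_space_axioms)
  next
    case (Suc k)
    have c: "(\<lambda>\<omega>. \<omega> k) \<in> measurable (PiM {0..<i} (\<lambda>_. count_space UNIV)) (count_space UNIV)"
      using Suc by (intro measurable_component_singleton) simp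
    have "(\<lambda>y. measure_pmf (K y))
            \<in> measurable (count_space UNIV) (subprob_algebra (count_space UNIV))"
      by (auto simp: space_subprob_algebra intro: measure_pmf.subprob_space_axioms)
    from measurable_compose[OF c this] show ?thesis
      using Suc by (simp add: path_step_def[abs_def])
  qed
next
  fix i and \<omega> :: "nat \<Rightarrow> 'b"
  show "prob_space (path_step K x i \<omega>)"
    by (cases i) (auto simp: path_step_def intro: measure_pmf.prob_space_axioms)
qed

definition chain_law :: "('a \<Rightarrow> 'a pmf) \<Rightarrow> 'a \<Rightarrow> (nat \<Rightarrow> 'a) measure" where
  "chain_law K x = projective_family.lim UNIV
     (Ionescu_Tulcea.CI (path_step K x) (\<lambda>_. count_space UNIV)) (\<lambda>_. count_space UNIV)"

lemma sets_chain_law: "sets (chain_law K x) = sets (PiM UNIV (\<lambda>_. count_space UNIV))"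
  by (simp add: chain_law_def)

lemma space_chain_law [simp]: "space (chain_law K x) = UNIV"
  by (simp add: chain_law_def space_PiM)

lemma prob_space_chain_law: "prob_space (chain_law K x)"
proof
  have X: "{\<lambda>_. undefined} \<in> sets (PiM {} (\<lambda>_. count_space UNIV))"
    by (simp add: sets_PiM_empty)
  have "emeasure (chain_law K x) (space (chain_law K x)) =
      emeasure (mc.CI K x {}) {\<lambda>_. undefined}"
    using mc.lim[OF _ X, of K x]
    by (simp add: chain_law_def space_PiM prod_emb_def vimage_def restrict_def)
  also have "{\<lambda>_. undefined} = space (mc.CI K x {})"
    by (simp add: mc.CI_def space_PiM)
  also have "emeasure (mc.CI K x {}) \<dots> = 1"
    using prob_space.emeasure_space_1[OF mc.PF.prob_space_P[of "{}" K x]] by simp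
  finally show "emeasure (chain_law K x) (space (chain_law K x)) = 1" .
qed

lemma emeasure_chain_law_cylinder:
  "emeasure (chain_law K x) {\<omega>. \<forall>k\<le>t. \<omega> k = s k} =
     (if s 0 = x then \<Prod>k<t. ennreal (pmf (K (s k)) (s (Suc k))) else 0)"
proof -
  let ?M = "\<lambda>_::nat. count_space (UNIV :: 'a set)"
  let ?X = "\<lambda>n. Pi\<^sub>E {0..<n} (\<lambda>i. {s i})"
  have X [measurable]: "?X n \<in> sets (PiM {0..<n} ?M)" for n
    by (intro sets_PiM_I_finite) auto
  have u: "(\<lambda>_. undefined) \<in> space (PiM {0..<0} ?M)" by (simp add: space_PiM)
  have step: "emeasure (mc.C K x 0 (Suc n) (\<lambda>_. undefined)) (?X (Suc n)) =
      emeasure (mc.C K x 0 n (\<lambda>_. undefined)) (?X n) *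
      emeasure (path_step K x n (restrict s {0..<n})) {s n}" for n
  proof -
    have "emeasure (mc.C K x 0 (Suc n) (\<lambda>_. undefined)) (?X (Suc n)) =
      (\<integral>\<^sup>+ \<omega>. emeasure (mc.eP K x n \<omega>) (?X (Suc n)) \<partial>mc.C K x 0 n (\<lambda>_. undefined))"
      using mc.measurable_eP[of K x n] X[of "Suc n"]
      by (simp, subst emeasure_bind[where N="PiM {0..<Suc n} ?M"])
         (auto simp: mc.space_C[OF u] measurable_cong_sets[OF mc.sets_C[OF u] refl])
    also have "\<dots> = (\<integral>\<^sup>+ \<omega>. emeasure (path_step K x n (restrict s {0..<n})) {s n} * indicator (?X n) \<omega>
        \<partial>mc.C K x 0 n (\<lambda>_. undefined))"
    proof (rule nn_integral_cong)
      fix \<omega> assume "\<omega> \<in> space (mc.C K x 0 n (\<lambda>_. undefined))"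
      then have w: "\<omega> \<in> space (PiM {0..<n} ?M)" using mc.space_C[OF u, of K x n] by simp
      then have we: "\<omega> \<in> extensional {0..<n}" by (simp add: space_PiM PiE_iff)
      have eq: "emeasure (mc.eP K x n \<omega>) (?X (Suc n)) =
          emeasure (path_step K x n \<omega>) (fun_upd \<omega> n -` ?X (Suc n))"
        using mc.emeasure_eP[OF w X[of "Suc n"]] by simp
      show "emeasure (mc.eP K x n \<omega>) (?X (Suc n)) =
          emeasure (path_step K x n (restrict s {0..<n})) {s n} * indicator (?X n) \<omega>"
      proof (cases "\<omega> \<in> ?X n")
        case True
        then have "\<omega> = restrict s {0..<n}"
          by (auto simp: fun_eq_iff PiE_iff extensional_def restrict_def)
        moreover have "fun_upd \<omega> n -` ?X (Suc n) = {s n}"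
          using True by (auto simp: PiE_iff extensional_def split: if_splits)
        ultimately show ?thesis using eq True by simp
      next
        case False
        then have "fun_upd \<omega> n -` ?X (Suc n) = {}"
          using we by (auto simp: PiE_iff extensional_def split: if_splits)
        then show ?thesis using eq False by simp
      qed
    qed
    also have "\<dots> = emeasure (path_step K x n (restrict s {0..<n})) {s n} *
        emeasure (mc.C K x 0 n (\<lambda>_. undefined)) (?X n)"
      using X[of n] mc.sets_C[OF u, of K x n] by (subst nn_integral_cmult_indicator) auto
    finally show ?thesis by (simp add: mult.commute)
  qed
  have C: "emeasure (mc.C K x 0 (Suc n) (\<lambda>_. undefined)) (?X (Suc n)) =
     (if s 0 = x then \<Prod>k<n. ennreal (pmf (K (s k)) (s (Suc k))) else 0)" for n
  proof (induction n)
    case 0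
    have "emeasure (mc.C K x 0 0 (\<lambda>_. undefined)) (?X 0) = 1"
      using X[of 0] by (simp add: space_PiM)
    with step[of 0] show ?case
      by (simp add: path_step_0 emeasure_pmf_single pmf_return del: mc.C.simps)
  next
    case (Suc n)
    show ?case
      by (subst step, subst Suc) (simp add: path_step_Suc emeasure_pmf_single)
  qed
  have "{\<omega>. \<forall>k\<le>t. \<omega> k = s k} = prod_emb UNIV ?M {0..<Suc t} (?X (Suc t))"
    by (auto simp: prod_emb_def space_PiM PiE_iff less_Suc_eq_le)
  then have "emeasure (chain_law K x) {\<omega>. \<forall>k\<le>t. \<omega> k = s k} = emeasure (mc.CI K x {0..<Suc t}) (?X (Suc t))"
    unfolding chain_law_def using mc.lim[of "{0..<Suc t}" "?X (Suc t)" K x] X[of "Suc t"] by simp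
  also have "\<dots> = emeasure (mc.C K x 0 (Suc t) (\<lambda>_. undefined)) (?X (Suc t))"
    using mc.emeasure_CI[of "{0..<Suc t}" "Suc t" "?X (Suc t)" K x] X[of "Suc t"]
    by (simp add: prod_emb_PiE_same_index del: mc.C.simps)
  finally show ?thesis using C[of t] by simp
qed

text \<open>The first return time is \<open>\<infinity>\<close> on trajectories that never come back.\<close>

definition return_time :: "'a \<Rightarrow> (nat \<Rightarrow> 'a) \<Rightarrow> ennreal" where
  "return_time x \<omega> = (INF t\<in>{t. 1 \<le> t \<and> \<omega> t = x}. of_nat t)"

definition recurrent_state :: "('a \<Rightarrow> 'a pmf) \<Rightarrow> 'a \<Rightarrow> bool" where
  "recurrent_state K x \<longleftrightarrow> \<P>(\<omega> in chain_law K x. return_time x \<omega> < \<infinity>) = 1"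

definition transient_state :: "('a \<Rightarrow> 'a pmf) \<Rightarrow> 'a \<Rightarrow> bool" where
  "transient_state K x \<longleftrightarrow> \<P>(\<omega> in chain_law K x. return_time x \<omega> < \<infinity>) < 1"

definition positive_recurrent_state :: "('a \<Rightarrow> 'a pmf) \<Rightarrow> 'a \<Rightarrow> bool" where
  "positive_recurrent_state K x \<longleftrightarrow>
     recurrent_state K x \<and> (\<integral>\<^sup>+\<omega>. return_time x \<omega> \<partial>chain_law K x) < \<infinity>"

definition null_recurrent_state :: "('a \<Rightarrow> 'a pmf) \<Rightarrow> 'a \<Rightarrow> bool" where
  "null_recurrent_state K x \<longleftrightarrow>
     recurrent_state K x \<and> (\<integral>\<^sup>+\<omega>. return_time x \<omega> \<partial>chain_law K x) = \<infinity>"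

section \<open>Graphs\<close>

text \<open>
  A finite simple graph is a symmetric irreflexive relation \<open>E\<close> on a finite type of vertices.
\<close>

definition adj_matrix :: "('v \<Rightarrow> 'v \<Rightarrow> bool) \<Rightarrow> 'a::zero_neq_one ^ 'v ^ 'v" where
  "adj_matrix E = (\<chi> i j. if E i j then 1 else 0)"

definition eigenvalues :: "real ^ 'v::finite ^ 'v \<Rightarrow> real set" where
  "eigenvalues A = {\<mu>. \<exists>v. v \<noteq> 0 \<and> A *v v = \<mu> *\<^sub>R v}"

definition largest_eigenvalue :: "('v::finite \<Rightarrow> 'v \<Rightarrow> bool) \<Rightarrow> real" where
  "largest_eigenvalue E = Max (eigenvalues (adj_matrix E))"

definition independence_number :: "('v::finite \<Rightarrow> 'v \<Rightarrow> bool) \<Rightarrow> nat" where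
  "independence_number E = Max {card S |S. \<forall>i\<in>S. \<forall>j\<in>S. \<not> E i j}"

definition num_edges :: "('v \<Rightarrow> 'v \<Rightarrow> bool) \<Rightarrow> nat" where
  "num_edges E = card {{i, j} |i j. E i j}"

section \<open>The chain\<close>

text \<open>The value at \<open>\<infinity>\<close> is immaterial, since \<open>\<beta> < \<infinity>\<close> throughout.\<close>

definition exp_ereal :: "ereal \<Rightarrow> real" where
  "exp_ereal x = (case x of ereal r \<Rightarrow> exp r | PInfty \<Rightarrow> 0 | MInfty \<Rightarrow> 0)"

text \<open>
  States are vectors in \<open>nat ^ 'v\<close>, and \<open>axis i 1\<close> is the unit vector \<open>e\<^sub>i\<close>. At most one summand
  below is nonzero. In \<open>ereal\<close>, \<open>0 * - \<infinity> = 0\<close>, as required for \<open>\<beta> = - \<infinity>\<close>.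
\<close>

definition rate :: "real \<Rightarrow> ereal \<Rightarrow> ('v::finite \<Rightarrow> 'v \<Rightarrow> bool) \<Rightarrow> nat ^ 'v \<Rightarrow> nat ^ 'v \<Rightarrow> real" where
  "rate \<alpha> \<beta> E \<xi> \<eta> = (\<Sum>i\<in>UNIV.
     if \<eta> = \<xi> + axis i 1
     then exp_ereal (ereal (\<alpha> * real (\<xi> $ i)) + \<beta> * ereal (real ((adj_matrix E *v \<xi>) $ i)))
     else if \<xi> $ i > 0 \<and> \<eta> = \<xi> - axis i 1 then 1
     else 0)"

definition total_rate :: "real \<Rightarrow> ereal \<Rightarrow> ('v::finite \<Rightarrow> 'v \<Rightarrow> bool) \<Rightarrow> nat ^ 'v \<Rightarrow> real" where
  "total_rate \<alpha> \<beta> E \<xi> = infsum (rate \<alpha> \<beta> E \<xi>) UNIV"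

definition jump_chain ::
  "real \<Rightarrow> ereal \<Rightarrow> ('v::finite \<Rightarrow> 'v \<Rightarrow> bool) \<Rightarrow> nat ^ 'v \<Rightarrow> (nat ^ 'v) pmf" where
  "jump_chain \<alpha> \<beta> E \<xi> = embed_pmf (\<lambda>\<eta>. rate \<alpha> \<beta> E \<xi> \<eta> / total_rate \<alpha> \<beta> E \<xi>)"

lemma exp_ereal_nonneg: "exp_ereal x \<ge> 0"
  by (cases x) (simp_all add: exp_ereal_def)

lemma exp_ereal_0: "exp_ereal 0 = 1"
  by (simp add: exp_ereal_def zero_ereal_def)

lemma rate_nonneg: "rate \<alpha> \<beta> E \<xi> \<eta> \<ge> 0"
  unfolding rate_def by (intro sum_nonneg) (simp add: exp_ereal_nonneg)

lemma axis_1_neq_0: "axis i (1::nat) \<noteq> 0"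
  by (metis axis_nth one_neq_zero zero_index)

lemma unit_steps:
  fixes \<xi> :: "nat ^ 'v::finite"
  shows "\<xi> + axis i 1 = \<xi> + axis j 1 \<longleftrightarrow> i = j"
    and "\<xi> $ i > 0 \<Longrightarrow> \<xi> - axis i 1 \<noteq> \<xi> + axis j 1"
    and "\<xi> $ i > 0 \<Longrightarrow> \<xi> $ j > 0 \<Longrightarrow> \<xi> - axis i 1 = \<xi> - axis j 1 \<longleftrightarrow> i = j"
proof -
  show "\<xi> + axis i 1 = \<xi> + axis j 1 \<longleftrightarrow> i = j"
    by (auto simp: axis_eq_axis)
  show "\<xi> - axis i 1 \<noteq> \<xi> + axis j 1" if "\<xi> $ i > 0"
  proof
    assume "\<xi> - axis i 1 = \<xi> + axis j 1"
    then have "(\<xi> - axis i 1) $ i = (\<xi> + axis j 1) $ i" by simp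
    with that show False by (simp add: axis_def split: if_splits)
  qed
  show "\<xi> - axis i 1 = \<xi> - axis j 1 \<longleftrightarrow> i = j" if "\<xi> $ i > 0" "\<xi> $ j > 0"
  proof
    assume "\<xi> - axis i 1 = \<xi> - axis j 1"
    then have "(\<xi> - axis i 1) $ i = (\<xi> - axis j 1) $ i" by simp
    with that show "i = j" by (auto simp: axis_def split: if_splits)
  qed simp
qed

lemma rate_up:
  "rate \<alpha> \<beta> E \<xi> (\<xi> + axis i 1) =
     exp_ereal (ereal (\<alpha> * real (\<xi> $ i)) + \<beta> * ereal (real ((adj_matrix E *v \<xi>) $ i)))"
proof -
  have "rate \<alpha> \<beta> E \<xi> (\<xi> + axis i 1) = (\<Sum>k\<in>UNIV. if k = i then
     exp_ereal (ereal (\<alpha> * real (\<xi> $ k)) + \<beta> * ereal (real ((adj_matrix E *v \<xi>) $ k))) else 0)"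
    unfolding rate_def using unit_steps(1)[of \<xi> i] unit_steps(2)[of \<xi> _ i, symmetric]
    by (intro sum.cong refl) auto
  then show ?thesis by simp
qed

lemma rate_down:
  assumes "\<xi> $ i > 0"
  shows "rate \<alpha> \<beta> E \<xi> (\<xi> - axis i 1) = 1"
proof -
  have "rate \<alpha> \<beta> E \<xi> (\<xi> - axis i 1) = (\<Sum>k\<in>UNIV. if k = i then 1 else 0)"
    unfolding rate_def using unit_steps(2)[of \<xi> i] unit_steps(3)[of \<xi> i] assms
    by (intro sum.cong refl) auto
  then show ?thesis by simp
qed

lemma rate_other:
  assumes "\<And>i. \<eta> \<noteq> \<xi> + axis i 1" "\<And>i. \<xi> $ i > 0 \<Longrightarrow> \<eta> \<noteq> \<xi> - axis i 1"
  shows "rate \<alpha> \<beta> E \<xi> \<eta> = 0"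
  unfolding rate_def using assms by (intro sum.neutral) auto

lemma finite_rate_support: "finite {\<eta>. rate \<alpha> \<beta> E \<xi> \<eta> \<noteq> 0}"
proof (rule finite_subset)
  show "{\<eta>. rate \<alpha> \<beta> E \<xi> \<eta> \<noteq> 0} \<subseteq> range (\<lambda>i. \<xi> + axis i 1) \<union> range (\<lambda>i. \<xi> - axis i 1)"
    using rate_other[of _ \<xi> \<alpha> \<beta> E] by blast
qed simp

lemma total_rate_eq_sum: "total_rate \<alpha> \<beta> E \<xi> = sum (rate \<alpha> \<beta> E \<xi>) {\<eta>. rate \<alpha> \<beta> E \<xi> \<eta> \<noteq> 0}"
proof -
  have "total_rate \<alpha> \<beta> E \<xi> = infsum (rate \<alpha> \<beta> E \<xi>) {\<eta>. rate \<alpha> \<beta> E \<xi> \<eta> \<noteq> 0}"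
    unfolding total_rate_def by (rule infsum_cong_neutral) auto
  then show ?thesis by (simp add: infsum_finite[OF finite_rate_support])
qed

lemma total_rate_pos: "total_rate \<alpha> \<beta> E \<xi> > 0"
proof -
  have "\<exists>\<eta>. rate \<alpha> \<beta> E \<xi> \<eta> > 0"
  proof (cases "\<xi> = 0")
    case True
    then have "rate \<alpha> \<beta> E \<xi> (\<xi> + axis undefined 1) = 1"
      by (subst rate_up) (simp add: exp_ereal_0 flip: zero_ereal_def)
    then show ?thesis by (metis zero_less_one)
  next
    case False
    then obtain i where "\<xi> $ i > 0" by (auto simp: vec_eq_iff)
    from rate_down[OF this] show ?thesis by (metis zero_less_one)
  qed
  then obtain \<eta> where "rate \<alpha> \<beta> E \<xi> \<eta> > 0" ..
  then show ?thesis
    unfolding total_rate_eq_sum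
    by (intro sum_pos2[OF finite_rate_support, of \<eta>]) (auto simp: rate_nonneg)
qed

lemma pmf_jump_chain:
  "pmf (jump_chain \<alpha> \<beta> E \<xi>) \<eta> = rate \<alpha> \<beta> E \<xi> \<eta> / total_rate \<alpha> \<beta> E \<xi>"
  unfolding jump_chain_def
proof (rule pmf_embed_pmf)
  show "0 \<le> rate \<alpha> \<beta> E \<xi> y / total_rate \<alpha> \<beta> E \<xi>" for y
    using total_rate_pos[of \<alpha> \<beta> E \<xi>] by (simp add: rate_nonneg)
  let ?S = "{\<eta>. rate \<alpha> \<beta> E \<xi> \<eta> \<noteq> 0}"
  have "(\<integral>\<^sup>+y. ennreal (rate \<alpha> \<beta> E \<xi> y / total_rate \<alpha> \<beta> E \<xi>) \<partial>count_space UNIV) =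
      (\<Sum>y\<in>?S. ennreal (rate \<alpha> \<beta> E \<xi> y / total_rate \<alpha> \<beta> E \<xi>))"
    by (rule nn_integral_count_space'[OF finite_rate_support]) auto
  also have "\<dots> = ennreal (\<Sum>y\<in>?S. rate \<alpha> \<beta> E \<xi> y / total_rate \<alpha> \<beta> E \<xi>)"
    using total_rate_pos[of \<alpha> \<beta> E \<xi>] by (intro sum_ennreal) (simp add: rate_nonneg)
  also have "(\<Sum>y\<in>?S. rate \<alpha> \<beta> E \<xi> y / total_rate \<alpha> \<beta> E \<xi>) = 1"
    using total_rate_pos[of \<alpha> \<beta> E \<xi>]
    by (simp add: total_rate_eq_sum flip: sum_divide_distrib)
  finally show "(\<integral>\<^sup>+y. ennreal (rate \<alpha> \<beta> E \<xi> y / total_rate \<alpha> \<beta> E \<xi>) \<partial>count_space UNIV) = 1"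
    by simp
qed

definition state_space :: "ereal \<Rightarrow> ('v \<Rightarrow> 'v \<Rightarrow> bool) \<Rightarrow> (nat ^ 'v) set" where
  "state_space \<beta> E =
     (if \<beta> = - \<infinity> then {\<xi>. \<forall>i j. E i j \<longrightarrow> \<xi> $ i * \<xi> $ j = 0} else UNIV)"

text \<open>
  On \<open>state_space \<beta> E\<close> the chain is irreducible, so the type of the chain is the common type of
  its states.
\<close>

definition zeta_positive_recurrent :: "real \<Rightarrow> ereal \<Rightarrow> ('v::finite \<Rightarrow> 'v \<Rightarrow> bool) \<Rightarrow> bool" where
  "zeta_positive_recurrent \<alpha> \<beta> E \<longleftrightarrow>
     (\<forall>\<xi>\<in>state_space \<beta> E. positive_recurrent_state (jump_chain \<alpha> \<beta> E) \<xi>)"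

definition zeta_null_recurrent :: "real \<Rightarrow> ereal \<Rightarrow> ('v::finite \<Rightarrow> 'v \<Rightarrow> bool) \<Rightarrow> bool" where
  "zeta_null_recurrent \<alpha> \<beta> E \<longleftrightarrow>
     (\<forall>\<xi>\<in>state_space \<beta> E. null_recurrent_state (jump_chain \<alpha> \<beta> E) \<xi>)"

definition zeta_transient :: "real \<Rightarrow> ereal \<Rightarrow> ('v::finite \<Rightarrow> 'v \<Rightarrow> bool) \<Rightarrow> bool" where
  "zeta_transient \<alpha> \<beta> E \<longleftrightarrow>
     (\<forall>\<xi>\<in>state_space \<beta> E. transient_state (jump_chain \<alpha> \<beta> E) \<xi>)"

end

theory Submission
  imports Defs
begin

text \<open>
  The rates are reversible. With
  \<open>\<pi>(\<xi>) = exp (\<alpha> / 2 * \<Sum>\<^sub>i \<xi>\<^sub>i (\<xi>\<^sub>i - 1) + \<beta> * \<Sum>\<^sub>i\<^sub>\<sim>\<^sub>j \<xi>\<^sub>i \<xi>\<^sub>j)\<close>, where each edge is counted once, the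
  jump chain is the random walk on the network in which the edge between \<open>\<xi>\<close> and \<open>\<xi> + e\<^sub>i\<close> has
  conductance \<open>\<pi>(\<xi> + e\<^sub>i)\<close> (lemma \<open>cond_up\<close>). Its type is read off from the weight \<open>\<pi>\<close>.

  The walk is positive recurrent if the total conductance is finite, by Kac's formula
  (\<open>mean_return_time\<close>). If \<open>\<alpha> < 0\<close> and \<open>\<alpha> + \<beta> \<lambda>\<^sub>1 < 0\<close>, the quadratic form in the exponent of \<open>\<pi>\<close>
  is negative definite on the orthant: the interaction is nonpositive there for \<open>\<beta> \<le> 0\<close>, and
  otherwise \<open>\<lambda>\<^sub>1\<close> bounds it, being the maximum of the Rayleigh quotient of the adjacency matrix. So
  \<open>\<pi>\<close> is summable (\<open>positive_recurrent_case\<close>).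

  For \<open>\<alpha> = 0\<close> the weight is 1 on the axes, so the total conductance is infinite and a recurrent walk
  is null recurrent. If \<open>\<beta> < 0\<close>, the weight is concentrated near the faces of the orthant spanned by
  independent sets of vertices. When these have at most two elements, the network is essentially
  planar: its spheres have mass of linear order, and logarithmic cutoffs have vanishing energy,
  which forces recurrence (\<open>escape_eq_0_if_linear_spheres\<close>, \<open>null_recurrent_if_repulsive\<close>). Without
  interaction and with at most two vertices it is a quadrant or a half-line.

  The walk is transient if a unit flow from some state to infinity has finite energy
  (\<open>transient_if_nonzero_capacity\<close>). If \<open>\<alpha> > 0\<close>, if \<open>\<alpha> = 0 < \<beta>\<close> and there is an edge, or if \<open>\<alpha> < 0\<close>
  and \<open>\<alpha> + \<beta> \<lambda>\<^sub>1 \<ge> 0\<close>, a flow along one path suffices, since \<open>\<pi>\<close> grows exponentially along an axis,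
  next to an axis, or along the Perron vector of the adjacency matrix (\<open>supercritical_case\<close>). In the
  remaining cases \<open>\<alpha> = 0\<close> and three vertices do not interact with each other, so the network contains
  an octant of the three-dimensional lattice with unit conductances (\<open>nonzero_capacity_octant\<close>).

  These criteria are proved for general reversible chains. The link to the law of the trajectories
  is the probability of avoiding a state up to a given time, which satisfies a recursion in time.
\<close>

section \<open>Return times through survival probabilities\<close>

text \<open>
  The law of the states at times \<open>1, \<dots>, t\<close>. The starting state is left out, so that a chain started
  at \<open>x\<close> is not counted as having visited \<open>x\<close>.
\<close>

primrec path_pmf :: "('a \<Rightarrow> 'a pmf) \<Rightarrow> nat \<Rightarrow> 'a \<Rightarrow> 'a list pmf" where
  "path_pmf K 0 y = return_pmf []"
| "path_pmf K (Suc t) y = K y \<bind> (\<lambda>z. map_pmf ((#) z) (path_pmf K t z))"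

text \<open>
  The probability that the chain started at \<open>y\<close> avoids \<open>x\<close> at the times \<open>1, \<dots>, t\<close>. For \<open>y = x\<close> this
  is the tail of the return time; the other \<open>y\<close> are carried along to have a recursion in \<open>t\<close>.
\<close>

definition survival :: "('a \<Rightarrow> 'a pmf) \<Rightarrow> 'a \<Rightarrow> nat \<Rightarrow> 'a \<Rightarrow> real" where
  "survival K x t y = measure_pmf.prob (path_pmf K t y) {l. x \<notin> set l}"

lemma survival_0 [simp]: "survival K x 0 y = 1"
  by (simp add: survival_def)

lemma survival_nonneg: "survival K x t y \<ge> 0"
  and survival_le_1: "survival K x t y \<le> 1"
  by (simp_all add: survival_def)

lemma survival_Suc:
  "ennreal (survival K x (Suc t) y) = (\<integral>\<^sup>+z. (if z = x then 0 else ennreal (survival K x t z)) \<partial>K y)"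
proof -
  have "emeasure (map_pmf ((#) z) (path_pmf K t z)) {l. x \<notin> set l} =
      (if z = x then 0 else ennreal (survival K x t z))" for z
  proof -
    have "(#) z -` {l. x \<notin> set l} = (if z = x then {} else {l. x \<notin> set l})"
      by auto
    then show ?thesis
      by (simp add: survival_def measure_pmf.emeasure_eq_measure)
  qed
  then show ?thesis
    by (simp add: survival_def emeasure_bind_pmf flip: measure_pmf.emeasure_eq_measure)
qed

lemma survival_Suc_sum:
  assumes "finite A" and "\<And>z. pmf (K y) z \<noteq> 0 \<Longrightarrow> z \<in> A"
  shows "survival K x (Suc t) y = (\<Sum>z\<in>A. (if z = x then 0 else survival K x t z) * pmf (K y) z)"
proof -
  let ?f = "\<lambda>z. if z = x then 0 else survival K x t z"
  have "ennreal (survival K x (Suc t) y) = (\<integral>\<^sup>+z. ennreal (?f z) \<partial>K y)"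
    unfolding survival_Suc by (intro nn_integral_cong) auto
  also have "\<dots> = ennreal (\<integral>z. ?f z \<partial>K y)"
    by (intro nn_integral_eq_integral measure_pmf.integrable_const_bound[where B = 1])
       (auto simp: survival_nonneg survival_le_1)
  also have "(\<integral>z. ?f z \<partial>K y) = (\<Sum>z\<in>A. ?f z * pmf (K y) z)"
    using assms by (intro integral_measure_pmf_real) (auto simp: set_pmf_iff)
  finally show ?thesis
    by (subst (asm) ennreal_inj) (auto simp: survival_nonneg intro!: sum_nonneg)
qed

lemma pmf_path_pmf:
  "pmf (path_pmf K t (s 0)) (map (\<lambda>k. s (Suc k)) [0..<t]) = (\<Prod>k<t. pmf (K (s k)) (s (Suc k)))"
proof (induction t arbitrary: s)
  case (Suc t)
  let ?l = "map (\<lambda>k. s (Suc (Suc k))) [0..<t]"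
  have l: "map (\<lambda>k. s (Suc k)) [0..<Suc t] = s (Suc 0) # ?l"
    by (subst upt_conv_Cons) (auto simp: map_Suc_upt[symmetric] o_def simp del: upt_Suc)
  have "pmf (map_pmf ((#) z) (path_pmf K t z)) (s (Suc 0) # ?l) =
      indicator {s (Suc 0)} z * pmf (path_pmf K t (s (Suc 0))) ?l" for z
  proof -
    have "(#) z -` {s (Suc 0) # ?l} = (if z = s (Suc 0) then {?l} else {})"
      by auto
    then show ?thesis
      by (auto simp: pmf_map measure_pmf_single)
  qed
  then have "pmf (path_pmf K (Suc t) (s 0)) (s (Suc 0) # ?l) =
      pmf (K (s 0)) (s (Suc 0)) * pmf (path_pmf K t (s (Suc 0))) ?l"
    by (simp add: pmf_bind measure_pmf_single)
  also have "pmf (path_pmf K t (s (Suc 0))) ?l = (\<Prod>k<t. pmf (K (s (Suc k))) (s (Suc (Suc k))))"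
    using Suc[of "\<lambda>k. s (Suc k)"] by simp
  finally show ?case
    by (simp only: l prod.lessThan_Suc_shift)
qed simp

lemma length_path_pmf: "l \<in> set_pmf (path_pmf K t y) \<Longrightarrow> length l = t"
  by (induction t arbitrary: y l) auto

lemma measurable_coordinate:
  "(\<lambda>\<omega>. \<omega> k) \<in> measurable (chain_law K y) (count_space UNIV)"
  unfolding measurable_cong_sets[OF sets_chain_law refl]
  by (rule measurable_component_singleton) simp

lemma coordinate_event:
  assumes "finite I"
  shows "{\<omega>. \<forall>k\<in>I. \<omega> (f k) \<in> A k} \<in> sets (chain_law K y)"
proof -
  have "{\<omega> \<in> space (chain_law K y). \<forall>k\<in>I. \<omega> (f k) \<in> A k} \<in> sets (chain_law K y)"
  proof (rule sets.sets_Collect_finite_All[OF _ assms])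
    fix k
    show "{\<omega> \<in> space (chain_law K y). \<omega> (f k) \<in> A k} \<in> sets (chain_law K y)"
      using measurable_sets[OF measurable_coordinate[of "f k" K y], of "A k"]
      by (simp add: vimage_def)
  qed
  then show ?thesis by simp
qed

lemma AE_chain_law_start: "AE \<omega> in chain_law K y. \<omega> 0 = y"
proof -
  interpret prob_space "chain_law K y" by (rule prob_space_chain_law)
  have e: "{\<omega>. \<omega> 0 = y} \<in> events"
    using measurable_sets[OF measurable_coordinate[of 0 K y], of "{y}"] by (simp add: vimage_def)
  have "prob {\<omega>. \<omega> 0 = y} = 1"
    using emeasure_chain_law_cylinder[of K y 0 "\<lambda>_. y"] by (simp add: emeasure_eq_measure)
  then have "AE \<omega> in chain_law K y. \<omega> \<in> {\<omega>. \<omega> 0 = y}"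
    using AE_in_set_eq_1[OF e] by simp
  then show ?thesis by simp
qed

lemma map_upt_eq_iff:
  "map f [0..<t] = l \<longleftrightarrow> length l = t \<and> (\<forall>k<t. f k = l ! k)"
  by (metis add_0 diff_zero length_map length_upt nth_equalityI nth_map nth_upt)

lemma path_vimage:
  "(\<lambda>\<omega>. map (\<lambda>k. \<omega> (Suc k)) [0..<t]) -` {l} =
     (if length l = t then {\<omega>. \<forall>k<t. \<omega> (Suc k) = l ! k} else {})"
  unfolding vimage_def singleton_iff map_upt_eq_iff by simp

lemma measurable_path:
  fixes K :: "'a::countable \<Rightarrow> 'a pmf"
  shows "(\<lambda>\<omega>. map (\<lambda>k. \<omega> (Suc k)) [0..<t]) \<in> measurable (chain_law K y) (count_space UNIV)"
proof (subst measurable_count_space_eq2_countable, intro conjI ballI)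
  fix l :: "'a list"
  have "{\<omega>. \<forall>k\<in>{..<t}. \<omega> (Suc k) \<in> {l ! k}} \<in> sets (chain_law K y)"
    by (rule coordinate_event) simp
  then show "(\<lambda>\<omega>. map (\<lambda>k. \<omega> (Suc k)) [0..<t]) -` {l} \<inter> space (chain_law K y) \<in> sets (chain_law K y)"
    unfolding path_vimage by (simp add: Ball_def)
qed simp_all

text \<open>
  The recursion of \<open>path_pmf\<close> conditions on the first step, which is not directly visible in the
  law of trajectories. Both measures live on the countable set of lists, so they agree once they
  agree on single lists, and there both are a product of transition probabilities.
\<close>

lemma distr_chain_law_path:
  fixes K :: "'a::countable \<Rightarrow> 'a pmf"
  shows "distr (chain_law K y) (count_space UNIV) (\<lambda>\<omega>. map (\<lambda>k. \<omega> (Suc k)) [0..<t]) = path_pmf K t y"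
    (is "distr _ _ ?X = _")
proof (rule measure_eqI_countable[where A = UNIV])
  fix l :: "'a list"
  have "emeasure (distr (chain_law K y) (count_space UNIV) ?X) {l} =
      emeasure (chain_law K y) (?X -` {l})"
    using emeasure_distr[OF measurable_path, of "{l}"] by (simp only: space_chain_law Int_UNIV_right sets_count_space Pow_UNIV UNIV_I)
  also have "\<dots> = ennreal (pmf (path_pmf K t y) l)"
  proof (cases "length l = t")
    case True
    define s where "s k = (y # l) ! k" for k
    have "emeasure (chain_law K y) (?X -` {l}) = emeasure (chain_law K y) {\<omega>. \<forall>k\<le>t. \<omega> k = s k}"
    proof (rule emeasure_eq_AE)
      have "(\<forall>k<t. \<omega> (Suc k) = l ! k) \<longleftrightarrow> (\<forall>k\<le>t. \<omega> k = s k)" if "\<omega> 0 = y" for \<omega>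
      proof -
        have "(\<forall>k\<le>t. \<omega> k = s k) \<longleftrightarrow> (\<forall>k<Suc t. \<omega> k = s k)" by (simp add: less_Suc_eq_le)
        also have "\<dots> \<longleftrightarrow> \<omega> 0 = s 0 \<and> (\<forall>k<t. \<omega> (Suc k) = s (Suc k))" by (rule All_less_Suc2)
        finally show ?thesis using that by (simp add: s_def)
      qed
      with AE_chain_law_start[where K = K and y = y]
      show "AE \<omega> in chain_law K y. (\<omega> \<in> ?X -` {l}) = (\<omega> \<in> {\<omega>. \<forall>k\<le>t. \<omega> k = s k})"
        unfolding path_vimage using True by (auto elim!: eventually_mono)
      have "{\<omega>. \<forall>k\<in>{..t}. \<omega> k \<in> {s k}} \<in> sets (chain_law K y)"
        by (rule coordinate_event) simp
      then show "{\<omega>. \<forall>k\<le>t. \<omega> k = s k} \<in> sets (chain_law K y)" by (simp add: Ball_def)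
      show "?X -` {l} \<in> sets (chain_law K y)"
        using measurable_sets[OF measurable_path[where t = t and K = K and y = y], of "{l}"]
        by (simp only: space_chain_law Int_UNIV_right sets_count_space Pow_UNIV UNIV_I)
    qed
    also have "\<dots> = ennreal (\<Prod>k<t. pmf (K (s k)) (s (Suc k)))"
      unfolding emeasure_chain_law_cylinder by (simp add: s_def prod_ennreal)
    also have "\<dots> = ennreal (pmf (path_pmf K t y) l)"
    proof -
      have "map (\<lambda>k. s (Suc k)) [0..<t] = l"
        using True by (auto simp: s_def intro: nth_equalityI)
      then show ?thesis
        using pmf_path_pmf[of K t s] by (simp add: s_def)
    qed
    finally show ?thesis .
  next
    case False
    then have "l \<notin> set_pmf (path_pmf K t y)" using length_path_pmf[of l K t y] by auto
    then show ?thesis using False by (simp add: path_vimage set_pmf_iff)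
  qed
  finally show "emeasure (distr (chain_law K y) (count_space UNIV) ?X) {l} =
      emeasure (measure_pmf (path_pmf K t y)) {l}"
    unfolding emeasure_pmf_single .
qed (simp_all only: sets_distr sets_count_space sets_measure_pmf_count_space sets_measure_pmf Pow_UNIV countableI_type)

lemma no_return_in_sets:
  "{\<omega>. \<forall>k\<in>{1..t}. \<omega> k \<noteq> x} \<in> sets (chain_law K y)"
  using coordinate_event[of "{1..t}" "\<lambda>k. k" "\<lambda>_. - {x}" K y] by simp

lemma emeasure_no_return:
  fixes K :: "'a::countable \<Rightarrow> 'a pmf"
  shows "emeasure (chain_law K y) {\<omega>. \<forall>k\<in>{1..t}. \<omega> k \<noteq> x} = ennreal (survival K x t y)"
proof -
  let ?X = "\<lambda>\<omega>. map (\<lambda>k. \<omega> (Suc k)) [0..<t]"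
  have "emeasure (path_pmf K t y) {l. x \<notin> set l} = emeasure (chain_law K y) (?X -` {l. x \<notin> set l})"
    unfolding distr_chain_law_path[symmetric]
    using emeasure_distr[OF measurable_path, of "{l. x \<notin> set l}"]
    by (simp only: space_chain_law Int_UNIV_right sets_count_space Pow_UNIV UNIV_I)
  also have "?X -` {l. x \<notin> set l} = {\<omega>. \<forall>k\<in>{1..t}. \<omega> k \<noteq> x}"
  proof -
    have "set (?X \<omega>) = \<omega> ` {1..t}" for \<omega> :: "nat \<Rightarrow> 'a"
      using image_Suc_atLeastLessThan[of 0 t]
      by (simp add: atLeastLessThanSuc_atLeastAtMost flip: image_image[of \<omega> Suc])
    then show ?thesis by auto
  qed
  finally show ?thesis by (simp add: survival_def measure_pmf.emeasure_eq_measure)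
qed

text \<open>
  The summand with index \<open>t\<close> is 1 exactly as long as the return time exceeds \<open>t\<close>. Integration turns
  this into the tail formula for the mean return time.
\<close>

lemma return_time_eq_suminf:
  "return_time x \<omega> = (\<Sum>t. indicator {\<omega>. \<forall>k\<in>{1..t}. \<omega> k \<noteq> x} \<omega>)"
proof (cases "\<exists>t. 1 \<le> t \<and> \<omega> t = x")
  case True
  define T where "T = (LEAST t. 1 \<le> t \<and> \<omega> t = x)"
  have T: "1 \<le> T \<and> \<omega> T = x" unfolding T_def by (rule LeastI_ex[OF True])
  have least: "T \<le> t" if "1 \<le> t" "\<omega> t = x" for t
    unfolding T_def by (rule Least_le) (use that in blast)
  have "return_time x \<omega> = of_nat T"
    unfolding return_time_def
  proof (rule antisym)
    show "(INF t\<in>{t. 1 \<le> t \<and> \<omega> t = x}. of_nat t) \<le> (of_nat T :: ennreal)"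
      by (rule INF_lower) (use T in blast)
    show "of_nat T \<le> (INF t\<in>{t. 1 \<le> t \<and> \<omega> t = x}. of_nat t :: ennreal)"
      by (rule INF_greatest) (use least in simp)
  qed
  moreover have iff: "(\<forall>k\<in>{1..t}. \<omega> k \<noteq> x) \<longleftrightarrow> t < T" for t
  proof
    assume "\<forall>k\<in>{1..t}. \<omega> k \<noteq> x"
    then have "\<not> T \<le> t" using T by auto
    then show "t < T" by simp
  qed (use least in fastforce)
  have "(\<Sum>t. indicator {\<omega>. \<forall>k\<in>{1..t}. \<omega> k \<noteq> x} \<omega>) = (\<Sum>t<T. 1 :: ennreal)"
    using iff by (subst suminf_finite[of "{..<T}"]) (simp_all add: indicator_def)
  ultimately show ?thesis by simp
next
  case False
  then have "return_time x \<omega> = \<infinity>" by (simp add: return_time_def)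
  moreover have "(\<Sum>t. indicator {\<omega>. \<forall>k\<in>{1..t}. \<omega> k \<noteq> x} \<omega>) = (\<Sum>t. 1 :: ennreal)"
    using False by (intro suminf_cong) (auto simp: indicator_def)
  moreover have "(\<Sum>t. 1 :: ennreal) = \<infinity>"
    by (simp add: suminf_eq_SUP ennreal_SUP_of_nat_eq_top)
  ultimately show ?thesis by simp
qed

lemma nn_integral_return_time:
  fixes K :: "'a::countable \<Rightarrow> 'a pmf"
  shows "(\<integral>\<^sup>+\<omega>. return_time x \<omega> \<partial>chain_law K y) = (\<Sum>t. ennreal (survival K x t y))"
proof -
  have "(\<integral>\<^sup>+\<omega>. return_time x \<omega> \<partial>chain_law K y) =
      (\<Sum>t. \<integral>\<^sup>+\<omega>. indicator {\<omega>. \<forall>k\<in>{1..t}. \<omega> k \<noteq> x} \<omega> \<partial>chain_law K y)"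
    unfolding return_time_eq_suminf
    by (intro nn_integral_suminf borel_measurable_indicator no_return_in_sets)
  then show ?thesis
    unfolding nn_integral_indicator[OF no_return_in_sets] emeasure_no_return .
qed

lemma survival_Suc_le:
  fixes K :: "'a::countable \<Rightarrow> 'a pmf"
  shows "survival K x (Suc t) y \<le> survival K x t y"
proof -
  have "ennreal (survival K x (Suc t) y) \<le> ennreal (survival K x t y)"
    unfolding emeasure_no_return[symmetric] by (intro emeasure_mono no_return_in_sets) auto
  then show ?thesis by (simp add: survival_nonneg)
qed

text \<open>
  The probability that \<open>x\<close> is never visited after time 0.
\<close>

definition escape :: "('a \<Rightarrow> 'a pmf) \<Rightarrow> 'a \<Rightarrow> 'a \<Rightarrow> real" where
  "escape K x y = lim (\<lambda>t. survival K x t y)"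

lemma survival_tendsto_escape:
  fixes K :: "'a::countable \<Rightarrow> 'a pmf"
  shows "(\<lambda>t. survival K x t y) \<longlonglongrightarrow> escape K x y"
proof -
  have "decseq (\<lambda>t. survival K x t y)" by (intro decseq_SucI survival_Suc_le)
  from decseq_convergent[OF this, of 0] show ?thesis
    unfolding escape_def by (metis survival_nonneg limI)
qed

lemma prob_return:
  fixes K :: "'a::countable \<Rightarrow> 'a pmf"
  shows "\<P>(\<omega> in chain_law K y. return_time x \<omega> < \<infinity>) = 1 - escape K x y"
proof -
  interpret prob_space "chain_law K y" by (rule prob_space_chain_law)
  let ?N = "\<lambda>t. {\<omega>. \<forall>k\<in>{1..t}. \<omega> k \<noteq> x}"
  have fin: "return_time x \<omega> < \<infinity> \<longleftrightarrow> (\<exists>t\<ge>1. \<omega> t = x)" for \<omega> :: "nat \<Rightarrow> 'a"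
    by (auto simp: return_time_def INF_less_iff ennreal_of_nat_eq_real_of_nat)
  have "(\<lambda>t. prob (?N t)) \<longlonglongrightarrow> prob (\<Inter>t. ?N t)"
    using no_return_in_sets[of _ x K y] by (intro finite_Lim_measure_decseq) (auto simp: decseq_def)
  moreover have "prob (?N t) = survival K x t y" for t
    using emeasure_no_return[of K y t x] by (simp add: emeasure_eq_measure survival_nonneg)
  ultimately have "prob (\<Inter>t. ?N t) = escape K x y"
    using LIMSEQ_unique survival_tendsto_escape[of K x y] by simp
  moreover have "{\<omega> \<in> space (chain_law K y). return_time x \<omega> < \<infinity>} = space (chain_law K y) - (\<Inter>t. ?N t)"
    unfolding fin by fastforce
  moreover have "(\<Inter>t. ?N t) \<in> events" using no_return_in_sets[of _ x K y] by auto
  ultimately show ?thesis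
    using prob_compl by simp
qed

section \<open>Networks and their Dirichlet energy\<close>

text \<open>
  The value \<open>c y z\<close> is the conductance of the edge between \<open>y\<close> and \<open>z\<close>, and 0 if there is no edge.
  Points without edges are allowed: they are the configurations outside the state space.
\<close>

locale network =
  fixes c :: "'a \<Rightarrow> 'a \<Rightarrow> real"
  assumes c_nonneg: "c y z \<ge> 0"
    and c_sym: "c y z = c z y"
    and locally_finite: "finite {z. c y z \<noteq> 0}"
begin

text \<open>
  The total conductance at a point, which is the reversing measure of the random walk.
\<close>

definition m :: "'a \<Rightarrow> real" where
  "m y = (\<Sum>z | c y z \<noteq> 0. c y z)"

text \<open>
  The Dirichlet energy is the supremum over finite \<open>F\<close>. Keeping \<open>F\<close> explicit leaves only finite sums;
  the factor \<open>1 / 2\<close> compensates for the two orientations of an edge.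
\<close>

definition energy :: "'a set \<Rightarrow> ('a \<Rightarrow> real) \<Rightarrow> real" where
  "energy F \<phi> = (\<Sum>y\<in>F. \<Sum>z\<in>F. c y z * (\<phi> y - \<phi> z)\<^sup>2) / 2"

definition nbhd :: "'a set \<Rightarrow> 'a set" where
  "nbhd F = F \<union> (\<Union>y\<in>F. {z. c y z \<noteq> 0})"

lemma m_nonneg: "m y \<ge> 0"
  unfolding m_def by (intro sum_nonneg c_nonneg)

lemma m_pos: "c y z \<noteq> 0 \<Longrightarrow> m y > 0"
  unfolding m_def using c_nonneg by (intro sum_pos2[OF locally_finite, of z]) (auto simp: less_le)

lemma m_pos2: "c y z \<noteq> 0 \<Longrightarrow> m z > 0"
  using m_pos[of z y] by (simp add: c_sym)

lemma finite_nbhd: "finite F \<Longrightarrow> finite (nbhd F)"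
  unfolding nbhd_def using locally_finite by auto

lemma subset_nbhd: "F \<subseteq> nbhd F"
  by (auto simp: nbhd_def)

lemma sum_nbhd:
  assumes "finite F" "y \<in> F" "nbhd F \<subseteq> F'" "finite F'"
  shows "(\<Sum>z\<in>F'. c y z * g z) = (\<Sum>z | c y z \<noteq> 0. c y z * g z)"
  using assms by (intro sum.mono_neutral_right) (auto simp: nbhd_def)

lemma energy_nonneg: "energy F \<phi> \<ge> 0"
  unfolding energy_def by (intro divide_nonneg_nonneg sum_nonneg mult_nonneg_nonneg c_nonneg) auto

lemma energy_mono: "finite F' \<Longrightarrow> F \<subseteq> F' \<Longrightarrow> energy F \<phi> \<le> energy F' \<phi>"
proof -
  assume F: "finite F'" "F \<subseteq> F'"
  have "(\<Sum>y\<in>F. \<Sum>z\<in>F. c y z * (\<phi> y - \<phi> z)\<^sup>2) \<le> (\<Sum>y\<in>F. \<Sum>z\<in>F'. c y z * (\<phi> y - \<phi> z)\<^sup>2)"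
    using F by (intro sum_mono sum_mono2) (auto simp: c_nonneg)
  also have "\<dots> \<le> (\<Sum>y\<in>F'. \<Sum>z\<in>F'. c y z * (\<phi> y - \<phi> z)\<^sup>2)"
    using F by (intro sum_mono2 sum_nonneg) (auto simp: c_nonneg)
  finally show ?thesis by (simp add: energy_def)
qed

lemma sum_edges_le_energy:
  assumes "finite F" "inj_on e I" "e ` I \<subseteq> F \<times> F"
  shows "(\<Sum>i\<in>I. c (fst (e i)) (snd (e i)) * (\<phi> (fst (e i)) - \<phi> (snd (e i)))\<^sup>2) \<le> 2 * energy F \<phi>"
proof -
  let ?g = "\<lambda>(y, z). c y z * (\<phi> y - \<phi> z)\<^sup>2"
  have "(\<Sum>i\<in>I. ?g (e i)) = sum ?g (e ` I)"
    using assms(2) by (simp add: sum.reindex)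
  also have "\<dots> \<le> sum ?g (F \<times> F)"
    using assms by (intro sum_mono2) (auto simp: c_nonneg)
  also have "\<dots> = 2 * energy F \<phi>"
    by (simp add: energy_def sum.cartesian_product)
  finally show ?thesis by (simp add: case_prod_unfold)
qed

lemma edge_le_energy:
  assumes "finite F" "y \<in> F" "z \<in> F"
  shows "c y z * (\<phi> y - \<phi> z)\<^sup>2 \<le> 2 * energy F \<phi>"
  using sum_edges_le_energy[OF assms(1), of "\<lambda>_. (y, z)" "{()}" \<phi>] assms by simp

text \<open>
  One half of Thomson's principle. A flow \<open>\<theta>\<close> on the oriented edges \<open>e i\<close> pairs with the differences
  of a potential \<open>\<phi>\<close>, and the Cauchy-Schwarz inequality bounds the pairing by the two energies. If
  the flow carries one unit from a point to infinity, the left-hand side is the squared value of \<open>\<phi>\<close>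
  at that point.
\<close>

lemma flow_estimate:
  assumes "finite F" "inj_on e I" "e ` I \<subseteq> F \<times> F" "\<And>i. i \<in> I \<Longrightarrow> c (fst (e i)) (snd (e i)) > 0"
  shows "(\<Sum>i\<in>I. \<theta> i * (\<phi> (fst (e i)) - \<phi> (snd (e i))))\<^sup>2
    \<le> (\<Sum>i\<in>I. (\<theta> i)\<^sup>2 / c (fst (e i)) (snd (e i))) * (2 * energy F \<phi>)"
proof -
  let ?c = "\<lambda>i. c (fst (e i)) (snd (e i))" and ?d = "\<lambda>i. \<phi> (fst (e i)) - \<phi> (snd (e i))"
  have "(\<Sum>i\<in>I. \<theta> i * ?d i) = (\<Sum>i\<in>I. (\<theta> i / sqrt (?c i)) * (sqrt (?c i) * ?d i))"
    using assms(4) by (intro sum.cong refl) force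
  then have "(\<Sum>i\<in>I. \<theta> i * ?d i)\<^sup>2 \<le> (\<Sum>i\<in>I. (\<theta> i / sqrt (?c i))\<^sup>2) * (\<Sum>i\<in>I. (sqrt (?c i) * ?d i)\<^sup>2)"
    by (simp only: Cauchy_Schwarz_ineq_sum)
  also have "\<dots> = (\<Sum>i\<in>I. (\<theta> i)\<^sup>2 / ?c i) * (\<Sum>i\<in>I. ?c i * (?d i)\<^sup>2)"
    by (simp add: power_divide power_mult_distrib c_nonneg)
  also have "\<dots> \<le> (\<Sum>i\<in>I. (\<theta> i)\<^sup>2 / ?c i) * (2 * energy F \<phi>)"
    by (intro mult_left_mono sum_edges_le_energy assms sum_nonneg divide_nonneg_nonneg c_nonneg) auto
  finally show ?thesis .
qed

text \<open>
  Summation by parts. It holds on any finite set because \<open>c\<close> is symmetric; the inner sum on the right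
  is the Laplacian of \<open>u\<close> at those \<open>y\<close> all of whose neighbours belong to \<open>F\<close>.
\<close>

lemma green:
  "(\<Sum>y\<in>F. \<Sum>z\<in>F. c y z * ((u y - u z) * (w y - w z))) / 2 =
     (\<Sum>y\<in>F. w y * (\<Sum>z\<in>F. c y z * (u y - u z)))"
proof -
  let ?T = "\<Sum>y\<in>F. \<Sum>z\<in>F. w y * (c y z * (u y - u z))"
  have "(\<Sum>y\<in>F. \<Sum>z\<in>F. c y z * ((u y - u z) * (w y - w z))) =
      ?T + (\<Sum>y\<in>F. \<Sum>z\<in>F. w z * (c z y * (u z - u y)))"
    unfolding sum.distrib[symmetric]
    by (intro sum.cong refl) (simp add: algebra_simps c_sym)
  also have "(\<Sum>y\<in>F. \<Sum>z\<in>F. w z * (c z y * (u z - u y))) = ?T"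
    by (rule sum.swap)
  finally have "(\<Sum>y\<in>F. \<Sum>z\<in>F. c y z * ((u y - u z) * (w y - w z))) = 2 * ?T" by simp
  moreover have "?T = (\<Sum>y\<in>F. w y * (\<Sum>z\<in>F. c y z * (u y - u z)))"
    by (simp only: sum_distrib_left)
  ultimately show ?thesis by simp
qed

text \<open>
  The effective conductance from \<open>x\<close> to infinity is the infimum of the energy over finitely supported
  potentials with value 1 at \<open>x\<close>. It is positive iff the squared value at \<open>x\<close> is bounded by a multiple
  of the energy. As the energy grows with \<open>F\<close>, the quantifier over \<open>F\<close> stands for the supremum.
\<close>

definition nonzero_capacity :: "'a \<Rightarrow> bool" where
  "nonzero_capacity x \<longleftrightarrow>
     (\<exists>C. \<forall>\<phi>. finite {y. \<phi> y \<noteq> 0} \<longrightarrow> (\<exists>F. finite F \<and> (\<phi> x)\<^sup>2 \<le> C * energy F \<phi>))"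

lemma nonzero_capacity_neighbour:
  assumes "nonzero_capacity y" "c y z \<noteq> 0"
  shows "nonzero_capacity z"
proof -
  from assms(1) obtain C where C: "\<And>\<phi>. finite {y. \<phi> y \<noteq> 0} \<Longrightarrow> \<exists>F. finite F \<and> (\<phi> y)\<^sup>2 \<le> C * energy F \<phi>"
    unfolding nonzero_capacity_def by blast
  have c: "c y z > 0" using assms(2) c_nonneg[of y z] by simp
  have "\<exists>F. finite F \<and> (\<phi> z)\<^sup>2 \<le> (2 * \<bar>C\<bar> + 4 / c y z) * energy F \<phi>"
    if fin: "finite {y. \<phi> y \<noteq> 0}" for \<phi>
  proof -
    obtain F where F: "finite F" "(\<phi> y)\<^sup>2 \<le> C * energy F \<phi>" using C[OF fin] by blast
    let ?F = "{y, z} \<union> F"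
    have "(\<phi> y)\<^sup>2 \<le> \<bar>C\<bar> * energy F \<phi>"
      using F(2) energy_nonneg[of F \<phi>] by (meson abs_ge_self mult_right_mono order_trans)
    also have "\<dots> \<le> \<bar>C\<bar> * energy ?F \<phi>"
      using F(1) by (intro mult_left_mono energy_mono) auto
    finally have 1: "(\<phi> y)\<^sup>2 \<le> \<bar>C\<bar> * energy ?F \<phi>" .
    have "c y z * (\<phi> y - \<phi> z)\<^sup>2 \<le> 2 * energy ?F \<phi>"
      using F(1) by (intro edge_le_energy) auto
    then have 2: "(\<phi> y - \<phi> z)\<^sup>2 \<le> 2 / c y z * energy ?F \<phi>"
      using c by (simp add: field_simps)
    have "(\<phi> z)\<^sup>2 \<le> 2 * (\<phi> y)\<^sup>2 + 2 * (\<phi> y - \<phi> z)\<^sup>2"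
      using zero_le_power2[of "2 * \<phi> y - \<phi> z"] by (simp add: power2_eq_square algebra_simps)
    also have "\<dots> \<le> (2 * \<bar>C\<bar> + 4 / c y z) * energy ?F \<phi>"
      using 1 2 by (simp add: algebra_simps)
    finally show ?thesis using F(1) by (intro exI[of _ ?F]) auto
  qed
  then show ?thesis unfolding nonzero_capacity_def by blast
qed

lemma nonzero_capacity_connected:
  assumes "(y, z) \<in> {(y, z). c y z \<noteq> 0}\<^sup>*" "nonzero_capacity y"
  shows "nonzero_capacity z"
  using assms by (induction rule: rtrancl_induct) (auto intro: nonzero_capacity_neighbour)

text \<open>
  The unit flow along the path has energy \<open>\<Sum> 1 / c\<close>: a single line of finite total resistance
  already connects its starting point to infinity.
\<close>

lemma nonzero_capacity_path:
  assumes "inj p" "\<And>k. c (p k) (p (Suc k)) > 0" "summable (\<lambda>k. 1 / c (p k) (p (Suc k)))"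
  shows "nonzero_capacity (p 0)"
proof -
  let ?r = "\<lambda>k. 1 / c (p k) (p (Suc k))"
  have "\<exists>F. finite F \<and> (\<phi> (p 0))\<^sup>2 \<le> (2 * suminf ?r) * energy F \<phi>"
    if fin: "finite {y. \<phi> y \<noteq> 0}" for \<phi>
  proof -
    have "finite (p -` {y. \<phi> y \<noteq> 0})" by (rule finite_vimageI[OF fin assms(1)])
    then obtain N where N: "\<phi> (p N) = 0"
      using ex_new_if_finite[OF infinite_UNIV_nat] by blast
    let ?F = "p ` {..N}"
    have "(\<Sum>k<N. \<phi> (p k) - \<phi> (p (Suc k))) = \<phi> (p 0)"
      using N by (subst sum_lessThan_telescope') simp
    then have "(\<phi> (p 0))\<^sup>2 = (\<Sum>k<N. 1 * (\<phi> (p k) - \<phi> (p (Suc k))))\<^sup>2" by simp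
    also have "\<dots> \<le> (\<Sum>k<N. 1\<^sup>2 / c (p k) (p (Suc k))) * (2 * energy ?F \<phi>)"
      using flow_estimate[of ?F "\<lambda>k. (p k, p (Suc k))" "{..<N}" "\<lambda>_. 1" \<phi>] assms(1,2)
      by (force simp: inj_on_def)
    also have "\<dots> \<le> suminf ?r * (2 * energy ?F \<phi>)"
      using assms by (intro mult_right_mono) (auto simp: energy_nonneg c_nonneg intro!: sum_le_suminf)
    finally show ?thesis by (intro exI[of _ ?F]) (auto simp: mult_ac)
  qed
  then show ?thesis unfolding nonzero_capacity_def by blast
qed

end

section \<open>Reversible chains\<close>

lemma nn_integral_split_point:
  fixes f :: "'a \<Rightarrow> ennreal"
  shows "(\<integral>\<^sup>+y. f y \<partial>count_space UNIV) = (\<integral>\<^sup>+y. (if y = x then 0 else f y) \<partial>count_space UNIV) + f x"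
proof -
  have "(\<integral>\<^sup>+y. f y \<partial>count_space UNIV) =
      (\<integral>\<^sup>+y. (if y = x then 0 else f y) + f x * indicator {x} y \<partial>count_space UNIV)"
    by (intro nn_integral_cong) auto
  then show ?thesis
    by (simp add: nn_integral_add nn_integral_cmult_indicator)
qed

text \<open>
  The walk crosses an edge with probability proportional to its conductance. Its states are the points
  with positive total conductance.
\<close>

locale reversible_chain = network c for c :: "'a::countable \<Rightarrow> 'a \<Rightarrow> real" +
  fixes K :: "'a \<Rightarrow> 'a pmf"
  assumes pmf_K: "m y > 0 \<Longrightarrow> pmf (K y) z = c y z / m y"
begin

text \<open>
  Multiplication by \<open>m y\<close> removes the quotient, so that the formula also holds when \<open>m y = 0\<close>.
\<close>

lemma survival_recursion:
  "m y * survival K x (Suc t) y = (\<Sum>z | c y z \<noteq> 0. c y z * (if z = x then 0 else survival K x t z))"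
proof (cases "m y = 0")
  case True
  then have "c y z = 0" for z using m_pos[of y z] by auto
  with True show ?thesis by simp
next
  case False
  then have m: "m y > 0" using m_nonneg[of y] by simp
  have "survival K x (Suc t) y = (\<Sum>z | c y z \<noteq> 0. (if z = x then 0 else survival K x t z) * pmf (K y) z)"
    by (intro survival_Suc_sum locally_finite) (auto simp: pmf_K[OF m])
  then show ?thesis
    using m by (auto simp: pmf_K[OF m] sum_distrib_left intro!: sum.cong)
qed

lemma escape_recursion:
  "m y * escape K x y = (\<Sum>z | c y z \<noteq> 0. c y z * (if z = x then 0 else escape K x z))"
proof (rule LIMSEQ_unique)
  show "(\<lambda>t. m y * survival K x (Suc t) y) \<longlonglongrightarrow> m y * escape K x y"
    by (intro tendsto_intros LIMSEQ_Suc survival_tendsto_escape)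
  have "(\<lambda>t. if z = x then 0 else survival K x t z) \<longlonglongrightarrow> (if z = x then 0 else escape K x z)" for z
    by (simp add: survival_tendsto_escape)
  then show "(\<lambda>t. m y * survival K x (Suc t) y) \<longlonglongrightarrow>
      (\<Sum>z | c y z \<noteq> 0. c y z * (if z = x then 0 else escape K x z))"
    unfolding survival_recursion by (intro tendsto_intros)
qed

lemma escape_bounds: "0 \<le> escape K x y" "escape K x y \<le> 1"
proof -
  show "0 \<le> escape K x y"
    by (rule LIMSEQ_le_const[OF survival_tendsto_escape]) (simp add: survival_nonneg)
  show "escape K x y \<le> 1"
    by (rule LIMSEQ_le_const2[OF survival_tendsto_escape]) (simp add: survival_le_1)
qed

subsection \<open>The mean return time\<close>

lemma nn_integral_neighbours:
  assumes "\<And>z. g z \<ge> 0"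
  shows "(\<integral>\<^sup>+z. ennreal (c y z * g z) \<partial>count_space UNIV) = ennreal (\<Sum>z | c y z \<noteq> 0. c y z * g z)"
  using assms c_nonneg
  by (subst nn_integral_count_space'[OF locally_finite]) (auto simp: sum_ennreal)

text \<open>
  The probability that the first visit to \<open>x\<close> after time 0 happens at time \<open>t + 1\<close>.
\<close>

definition first_return :: "'a \<Rightarrow> nat \<Rightarrow> 'a \<Rightarrow> real" where
  "first_return x t y = survival K x t y - survival K x (Suc t) y"

lemma first_return_nonneg: "first_return x t y \<ge> 0"
  by (simp add: first_return_def survival_Suc_le)

lemma first_return_0: "m y * first_return x 0 y = c y x"
proof -
  have "m y * survival K x (Suc 0) y = (\<Sum>z | c y z \<noteq> 0. c y z - (if z = x then c y x else 0))"
    unfolding survival_recursion by (intro sum.cong) auto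
  also have "\<dots> = m y - c y x"
    by (simp add: sum_subtractf m_def locally_finite)
  finally show ?thesis by (simp add: first_return_def algebra_simps)
qed

lemma first_return_Suc:
  "m y * first_return x (Suc t) y =
     (\<Sum>z | c y z \<noteq> 0. c y z * (if z = x then 0 else first_return x t z))"
  unfolding first_return_def right_diff_distrib survival_recursion sum_subtractf[symmetric]
  by (intro sum.cong) (auto simp: algebra_simps)

text \<open>
  One step of the walk preserves the total mass of a function with respect to \<open>m\<close>. Since the walk
  is killed at \<open>x\<close>, what is lost between the times \<open>t\<close> and \<open>t + 1\<close> is the contribution of the point \<open>x\<close>
  itself, which is \<open>m x\<close> times the probability of a first return to \<open>x\<close> at that time. Both sides
  therefore decrease by the same amount.
\<close>

lemma first_return_mass:
  "(\<integral>\<^sup>+y. ennreal (if y = x then 0 else m y * first_return x t y) \<partial>count_space UNIV) =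
     ennreal (m x * survival K x (Suc t) x)" (is "?H t = _")
proof (induction t)
  case 0
  have "(\<integral>\<^sup>+y. ennreal (c x y * 1) \<partial>count_space UNIV) =
      (\<integral>\<^sup>+y. (if y = x then 0 else ennreal (c x y * 1)) \<partial>count_space UNIV) + ennreal (c x x * 1)"
    by (rule nn_integral_split_point)
  also have "(\<integral>\<^sup>+y. (if y = x then 0 else ennreal (c x y * 1)) \<partial>count_space UNIV) = ?H 0"
    unfolding first_return_0 by (intro nn_integral_cong) (simp add: c_sym[of x])
  finally have "?H 0 + ennreal (c x x) = (\<integral>\<^sup>+y. ennreal (c x y * 1) \<partial>count_space UNIV)"
    by simp
  also have "\<dots> = ennreal (m x)"
    by (subst nn_integral_neighbours) (auto simp: m_def)
  also have "\<dots> = ennreal (m x * survival K x (Suc 0) x) + ennreal (c x x)"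
    using first_return_0[of x x] survival_nonneg[of K x "Suc 0" x] m_nonneg[of x]
    by (subst ennreal_plus[symmetric]) (auto simp: c_nonneg first_return_def algebra_simps)
  finally show ?case by simp
next
  case (Suc t)
  let ?h = "\<lambda>z. if z = x then 0 else first_return x t z"
  have h: "?h z \<ge> 0" for z by (simp add: first_return_nonneg)
  have "(\<integral>\<^sup>+y. ennreal (m y * first_return x (Suc t) y) \<partial>count_space UNIV) =
      (\<integral>\<^sup>+y. (if y = x then 0 else ennreal (m y * first_return x (Suc t) y)) \<partial>count_space UNIV)
      + ennreal (m x * first_return x (Suc t) x)"
    by (rule nn_integral_split_point)
  also have "(\<integral>\<^sup>+y. (if y = x then 0 else ennreal (m y * first_return x (Suc t) y)) \<partial>count_space UNIV) = ?H (Suc t)"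
    by (intro nn_integral_cong) simp
  finally have "?H (Suc t) + ennreal (m x * first_return x (Suc t) x) =
      (\<integral>\<^sup>+y. ennreal (m y * first_return x (Suc t) y) \<partial>count_space UNIV)" by (rule sym)
  also have "\<dots> = (\<integral>\<^sup>+y. \<integral>\<^sup>+z. ennreal (c y z * ?h z) \<partial>count_space UNIV \<partial>count_space UNIV)"
    by (simp only: first_return_Suc nn_integral_neighbours[of ?h, OF h])
  also have "\<dots> = (\<integral>\<^sup>+z. \<integral>\<^sup>+y. ennreal (c y z * ?h z) \<partial>count_space UNIV \<partial>count_space UNIV)"
    using nn_integral_fst_count_space[of "\<lambda>(y, z). ennreal (c y z * ?h z)"]
      nn_integral_snd_count_space[of "\<lambda>(y, z). ennreal (c y z * ?h z)"] by simp
  also have "\<dots> = (\<integral>\<^sup>+z. ennreal (m z * ?h z) \<partial>count_space UNIV)"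
  proof (intro nn_integral_cong)
    fix z
    have "(\<integral>\<^sup>+y. ennreal (c y z * ?h z) \<partial>count_space UNIV) = (\<integral>\<^sup>+y. ennreal (c z y * ?h z) \<partial>count_space UNIV)"
      by (simp add: c_sym)
    also have "\<dots> = ennreal (m z * ?h z)"
      by (subst nn_integral_neighbours[of "\<lambda>_. ?h z", OF h]) (simp add: m_def sum_distrib_right)
    finally show "(\<integral>\<^sup>+y. ennreal (c y z * ?h z) \<partial>count_space UNIV) = ennreal (m z * ?h z)" .
  qed
  also have "\<dots> = ?H t"
    by (intro nn_integral_cong) auto
  also have "\<dots> = ennreal (m x * survival K x (Suc (Suc t)) x) + ennreal (m x * first_return x (Suc t) x)"
    unfolding Suc using m_nonneg[of x] survival_nonneg[of K x "Suc (Suc t)" x] first_return_nonneg[of x "Suc t" x]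
    by (subst ennreal_plus[symmetric]) (auto simp: first_return_def algebra_simps intro: mult_left_mono)
  finally show ?case by simp
qed

lemma mean_return_identity:
  "(\<Sum>t. ennreal (m x * survival K x (Suc t) x)) =
     (\<integral>\<^sup>+y. ennreal (if y = x then 0 else m y * (1 - escape K x y)) \<partial>count_space UNIV)"
proof -
  have "(\<Sum>t. ennreal (m x * survival K x (Suc t) x)) =
      (\<integral>\<^sup>+y. (\<Sum>t. ennreal (if y = x then 0 else m y * first_return x t y)) \<partial>count_space UNIV)"
    unfolding first_return_mass[symmetric] by (subst nn_integral_suminf) auto
  also have "\<dots> = (\<integral>\<^sup>+y. ennreal (if y = x then 0 else m y * (1 - escape K x y)) \<partial>count_space UNIV)"
  proof (intro nn_integral_cong)
    fix y
    have "first_return x t y \<ge> 0" for t by (rule first_return_nonneg)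
    moreover have "(\<lambda>t. first_return x t y) sums (1 - escape K x y)"
      using telescope_sums'[OF survival_tendsto_escape[of K x y]] by (simp add: first_return_def)
    ultimately show "(\<Sum>t. ennreal (if y = x then 0 else m y * first_return x t y)) =
        ennreal (if y = x then 0 else m y * (1 - escape K x y))"
      using m_nonneg[of y] by (intro suminf_ennreal_eq) (auto intro: sums_mult)
  qed
  finally show ?thesis .
qed

text \<open>
  Kac's formula: for a recurrent chain the right-hand side is the total mass of \<open>m\<close>. The correction by
  the escape probabilities makes it hold for transient chains as well, so that recurrence may be
  deduced from a finite mass.
\<close>

lemma mean_return_time:
  "ennreal (m x) * (\<integral>\<^sup>+\<omega>. return_time x \<omega> \<partial>chain_law K x) =
     ennreal (m x) + (\<integral>\<^sup>+y. ennreal (if y = x then 0 else m y * (1 - escape K x y)) \<partial>count_space UNIV)"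
proof -
  have "(\<lambda>t. ennreal (survival K x (Suc t) x)) sums (\<Sum>t. ennreal (survival K x (Suc t) x))"
    by (rule summable_sums[OF summableI])
  then have "(\<lambda>t. ennreal (survival K x t x)) sums
      ((\<Sum>t. ennreal (survival K x (Suc t) x)) + ennreal (survival K x 0 x))"
    by (rule sums_Suc)
  then have "(\<integral>\<^sup>+\<omega>. return_time x \<omega> \<partial>chain_law K x) = 1 + (\<Sum>t. ennreal (survival K x (Suc t) x))"
    unfolding nn_integral_return_time by (simp add: sums_iff add.commute)
  moreover have "ennreal (m x) * (\<Sum>t. ennreal (survival K x (Suc t) x)) = (\<Sum>t. ennreal (m x * survival K x (Suc t) x))"
    by (simp add: ennreal_suminf_cmult ennreal_mult m_nonneg survival_nonneg)
  ultimately show ?thesis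
    by (simp add: distrib_left mean_return_identity)
qed

lemma recurrent_state_iff: "recurrent_state K x \<longleftrightarrow> escape K x x = 0"
  unfolding recurrent_state_def prob_return by simp

lemma transient_state_iff: "transient_state K x \<longleftrightarrow> escape K x x > 0"
  unfolding transient_state_def prob_return by simp

lemma positive_recurrent_if_finite_mass:
  assumes "m x > 0" "(\<integral>\<^sup>+y. ennreal (m y) \<partial>count_space UNIV) < \<infinity>"
  shows "positive_recurrent_state K x"
proof -
  have "(\<integral>\<^sup>+y. ennreal (if y = x then 0 else m y * (1 - escape K x y)) \<partial>count_space UNIV)
      \<le> (\<integral>\<^sup>+y. ennreal (m y) \<partial>count_space UNIV)"
    using m_nonneg escape_bounds
    by (intro nn_integral_mono ennreal_leI) (auto intro!: mult_left_le)
  with assms(2) have "ennreal (m x) * (\<integral>\<^sup>+\<omega>. return_time x \<omega> \<partial>chain_law K x) < \<infinity>"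
    unfolding mean_return_time by (simp add: ennreal_add_less_top le_less_trans)
  then have fin: "(\<integral>\<^sup>+\<omega>. return_time x \<omega> \<partial>chain_law K x) < \<infinity>"
    using assms(1) by (auto simp: ennreal_mult_less_top)
  then have "(\<Sum>t. ennreal (survival K x t x)) \<noteq> \<infinity>"
    unfolding nn_integral_return_time by simp
  then have "summable (\<lambda>t. survival K x t x)"
    by (intro summable_suminf_not_top) (auto simp: survival_nonneg)
  then have "escape K x x = 0"
    by (rule LIMSEQ_unique[OF survival_tendsto_escape summable_LIMSEQ_zero])
  with fin show ?thesis unfolding positive_recurrent_state_def recurrent_state_iff by blast
qed

lemma null_recurrent_if_infinite_mass:
  assumes "m x > 0" "(\<integral>\<^sup>+y. ennreal (m y) \<partial>count_space UNIV) = \<infinity>"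
    and esc: "\<And>y. m y > 0 \<Longrightarrow> escape K x y = 0"
  shows "null_recurrent_state K x"
proof -
  have "(\<integral>\<^sup>+y. ennreal (if y = x then 0 else m y * (1 - escape K x y)) \<partial>count_space UNIV) =
      (\<integral>\<^sup>+y. (if y = x then 0 else ennreal (m y)) \<partial>count_space UNIV)"
  proof (intro nn_integral_cong)
    fix y
    show "ennreal (if y = x then 0 else m y * (1 - escape K x y)) = (if y = x then 0 else ennreal (m y))"
    proof (cases "m y = 0")
      case False
      then have "escape K x y = 0" using esc[of y] m_nonneg[of y] by simp
      then show ?thesis by simp
    qed simp
  qed
  also have "\<dots> = \<infinity>"
    using assms(2)[unfolded nn_integral_split_point[of "\<lambda>y. ennreal (m y)" x]]
    by (simp add: ennreal_add_eq_top)
  finally have "ennreal (m x) * (\<integral>\<^sup>+\<omega>. return_time x \<omega> \<partial>chain_law K x) = \<infinity>"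
    unfolding mean_return_time by simp
  then have "(\<integral>\<^sup>+\<omega>. return_time x \<omega> \<partial>chain_law K x) = \<infinity>"
    by (simp add: ennreal_mult_eq_top_iff)
  with esc[OF assms(1)] show ?thesis
    unfolding null_recurrent_state_def recurrent_state_iff by blast
qed

subsection \<open>Transience by positive capacity\<close>

text \<open>
  The probability \<open>f t y\<close> to hit \<open>x\<close> from \<open>y\<close> within \<open>t\<close> steps has finite support and equals 1 at \<open>x\<close>.
  Away from \<open>x\<close>, averaging it over the neighbours gives the larger \<open>f (t + 1) y\<close>, so by summation by
  parts only the point \<open>x\<close> contributes positively to its energy, and it contributes \<open>m x\<close> times the
  probability of no return up to time \<open>t + 1\<close>. Positive capacity bounds the energy from below, and
  so this probability stays away from 0.
\<close>

lemma transient_if_nonzero_capacity: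
  assumes "m x > 0" "nonzero_capacity x"
  shows "transient_state K x"
proof -
  obtain C where C: "\<And>\<phi>. finite {y. \<phi> y \<noteq> 0} \<Longrightarrow> \<exists>F. finite F \<and> (\<phi> x)\<^sup>2 \<le> C * energy F \<phi>"
    using assms(2) unfolding nonzero_capacity_def by blast
  define f where "f t y = (if m y = 0 then 0 else if y = x then 1 else 1 - survival K x t y)" for t y
  have fx: "f t x = 1" for t using assms(1) by (simp add: f_def)
  have f0: "f t y \<ge> 0" for t y by (simp add: f_def survival_le_1)
  have average: "(\<Sum>z | c y z \<noteq> 0. c y z * f t z) = m y - m y * survival K x (Suc t) y" for t y
  proof -
    have "c y z * f t z = c y z - c y z * (if z = x then 0 else survival K x t z)" if "c y z \<noteq> 0" for z
      using m_pos2[OF that] by (simp add: f_def algebra_simps)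
    then have "(\<Sum>z | c y z \<noteq> 0. c y z * f t z) =
        (\<Sum>z | c y z \<noteq> 0. c y z - c y z * (if z = x then 0 else survival K x t z))"
      by (intro sum.cong) auto
    then show ?thesis unfolding survival_recursion unfolding sum_subtractf m_def .
  qed
  have supp: "finite {y. f t y \<noteq> 0}" for t
  proof (induction t)
    case 0
    have "{y. f 0 y \<noteq> 0} \<subseteq> {x}" by (auto simp: f_def)
    then show ?case by (rule finite_subset) simp
  next
    case (Suc t)
    have "y \<in> insert x (nbhd {y. f t y \<noteq> 0})" if "f (Suc t) y \<noteq> 0" for y
    proof (rule ccontr)
      assume y: "y \<notin> insert x (nbhd {y. f t y \<noteq> 0})"
      then have "c y z * f t z = 0" for z
        by (cases "f t z = 0") (auto simp: nbhd_def c_sym[of y])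
      then have "m y - m y * survival K x (Suc t) y = 0"
        unfolding average[of y t, symmetric] by (intro sum.neutral) blast
      with that y show False by (auto simp: f_def split: if_splits)
    qed
    then have "{y. f (Suc t) y \<noteq> 0} \<subseteq> insert x (nbhd {y. f t y \<noteq> 0})" by blast
    then show ?case by (rule finite_subset) (simp add: Suc finite_nbhd)
  qed
  have energy: "energy F (f t) \<le> m x * survival K x (Suc t) x" if "finite F" for F t
  proof -
    let ?S = "{y. f t y \<noteq> 0}"
    define F' where "F' = F \<union> nbhd ?S"
    have F': "finite F'" "nbhd ?S \<subseteq> F'" "F \<subseteq> F'" "x \<in> F'"
      using that supp[of t] subsetD[OF subset_nbhd[of ?S], of x] fx[of t] by (auto simp: F'_def finite_nbhd)
    have inner: "(\<Sum>z\<in>F'. c y z * (f t y - f t z)) = m y * (f t y - 1 + survival K x (Suc t) y)"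
      if "f t y \<noteq> 0" for y
    proof -
      have "(\<Sum>z\<in>F'. c y z * (f t y - f t z)) = (\<Sum>z | c y z \<noteq> 0. c y z * (f t y - f t z))"
        using that F' supp[of t] by (intro sum_nbhd[of ?S]) auto
      also have "\<dots> = m y * f t y - (\<Sum>z | c y z \<noteq> 0. c y z * f t z)"
        by (simp add: right_diff_distrib sum_subtractf m_def sum_distrib_right)
      finally show ?thesis unfolding average by (simp add: algebra_simps)
    qed
    have "energy F (f t) \<le> energy F' (f t)" using F' by (intro energy_mono)
    also have "\<dots> = (\<Sum>y\<in>F'. f t y * (\<Sum>z\<in>F'. c y z * (f t y - f t z)))"
      unfolding energy_def using green[where F = F' and u = "f t" and w = "f t"] by (simp add: power2_eq_square)
    also have "\<dots> \<le> (\<Sum>y\<in>F'. if y = x then m x * survival K x (Suc t) x else 0)"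
    proof (intro sum_mono)
      fix y
      show "f t y * (\<Sum>z\<in>F'. c y z * (f t y - f t z)) \<le> (if y = x then m x * survival K x (Suc t) x else 0)"
      proof (cases "f t y = 0 \<or> y = x")
        case True
        then show ?thesis using inner[of x] fx[of t] by auto
      next
        case False
        then have "f t y = 1 - survival K x t y" by (auto simp: f_def split: if_splits)
        then have "(\<Sum>z\<in>F'. c y z * (f t y - f t z)) \<le> 0"
          using inner[of y] False survival_Suc_le[of K x t y] m_nonneg[of y]
          by (simp add: mult_nonneg_nonpos)
        then show ?thesis using f0[of t y] False by (simp add: mult_nonneg_nonpos)
      qed
    qed
    also have "\<dots> = m x * survival K x (Suc t) x" using F' by simp
    finally show ?thesis .
  qed
  have bound: "1 \<le> \<bar>C\<bar> * (m x * survival K x (Suc t) x)" for t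
  proof -
    obtain F where F: "finite F" "(f t x)\<^sup>2 \<le> C * energy F (f t)" using C[OF supp] by blast
    have "1 \<le> C * energy F (f t)" using F(2) fx by simp
    also have "\<dots> \<le> \<bar>C\<bar> * energy F (f t)" by (intro mult_right_mono energy_nonneg) simp
    also have "\<dots> \<le> \<bar>C\<bar> * (m x * survival K x (Suc t) x)"
      by (intro mult_left_mono energy F) simp
    finally show ?thesis .
  qed
  have "(\<lambda>t. \<bar>C\<bar> * (m x * survival K x (Suc t) x)) \<longlonglongrightarrow> \<bar>C\<bar> * (m x * escape K x x)"
    by (intro tendsto_intros LIMSEQ_Suc survival_tendsto_escape)
  from LIMSEQ_le_const[OF this, of 1] have "1 \<le> \<bar>C\<bar> * (m x * escape K x x)" using bound by blast
  then have "escape K x x \<noteq> 0" by auto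
  then show ?thesis using escape_bounds(1)[of x x] by (simp add: transient_state_iff)
qed

subsection \<open>Recurrence by cutoffs of small energy\<close>

text \<open>
  The escape probability, set to 0 at \<open>x\<close>, is a bounded function \<open>u\<close> that is harmonic away from \<open>x\<close>.
  Testing its harmonicity against \<open>\<phi>\<^sup>2 u\<close> yields the Caccioppoli inequality
  \<open>energy (\<phi> u) \<le> energy \<phi>\<close>. As the cutoffs \<open>\<phi>\<close> tend to 1 with vanishing energy, \<open>u\<close> has energy 0,
  so it is constant on the connected network, with the value 0 that it has at \<open>x\<close>.
\<close>

lemma escape_eq_0_if_cutoffs:
  assumes x: "m x > 0"
    and connected: "\<And>y. m y > 0 \<Longrightarrow> (x, y) \<in> {(y, z). c y z \<noteq> 0}\<^sup>*"
    and supp: "\<And>k::nat. finite {y. \<phi> k y \<noteq> 0}"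
    and lim: "\<And>y. (\<lambda>k. \<phi> k y) \<longlonglongrightarrow> 1"
    and energy: "\<And>k F. finite F \<Longrightarrow> energy F (\<phi> k) \<le> \<epsilon> k"
    and \<epsilon>: "\<epsilon> \<longlonglongrightarrow> 0"
    and y: "m y > 0"
  shows "escape K x y = 0"
proof -
  define u where "u y = (if y = x then 0 else escape K x y)" for y
  have u01: "0 \<le> u y" "u y \<le> 1" for y by (auto simp: u_def escape_bounds)
  have harmonic: "(\<Sum>z | c y z \<noteq> 0. c y z * (u y - u z)) = 0" if "y \<noteq> x" for y
  proof -
    have "(\<Sum>z | c y z \<noteq> 0. c y z * (u y - u z)) = m y * u y - (\<Sum>z | c y z \<noteq> 0. c y z * u z)"
      by (simp add: right_diff_distrib sum_subtractf m_def sum_distrib_right)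
    then show ?thesis using escape_recursion[of y x] that by (simp add: u_def)
  qed
  have edge_eq: "u y = u z" if "c y z \<noteq> 0" for y z
  proof -
    have "c y z * (\<phi> k y * u y - \<phi> k z * u z)\<^sup>2 \<le> 2 * \<epsilon> k" for k
    proof -
      let ?p = "\<phi> k" and ?S = "{y. \<phi> k y \<noteq> 0}"
      define F where "F = {y, z} \<union> nbhd ?S"
      have F: "finite F" "nbhd ?S \<subseteq> F" "y \<in> F" "z \<in> F"
        using supp by (auto simp: F_def finite_nbhd)
      have "?p y * (?p y * u y) * (\<Sum>z\<in>F. c y z * (u y - u z)) = 0" for y
      proof (cases "?p y = 0 \<or> y = x")
        case True
        then show ?thesis by (auto simp: u_def)
      next
        case False
        then show ?thesis
          using F supp[of k] harmonic[of y] by (subst sum_nbhd[of ?S]) auto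
      qed
      \<comment> \<open>The point \<open>x\<close> does no harm because \<open>u x = 0\<close>.\<close>
      then have zero: "(\<Sum>y\<in>F. \<Sum>z\<in>F. c y z * ((u y - u z) * (?p y * (?p y * u y) - ?p z * (?p z * u z)))) = 0"
        using green[where F = F and u = u and w = "\<lambda>y. ?p y * (?p y * u y)"] by (simp add: sum.neutral)
      have "2 * energy F (\<lambda>y. ?p y * u y) = 2 * energy F (\<lambda>y. ?p y * u y) -
          (\<Sum>y\<in>F. \<Sum>z\<in>F. c y z * ((u y - u z) * (?p y * (?p y * u y) - ?p z * (?p z * u z))))"
        using zero by simp
      \<comment> \<open>Pointwise, \<open>(p u - p' u')\<^sup>2 - (u - u') (p\<^sup>2 u - p'\<^sup>2 u') = u u' (p - p')\<^sup>2\<close>.\<close>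
      also have "\<dots> = (\<Sum>y\<in>F. \<Sum>z\<in>F. c y z * (u y * u z * (?p y - ?p z)\<^sup>2))"
        unfolding energy_def by (simp flip: sum_subtractf) (intro sum.cong refl; algebra)
      also have "\<dots> \<le> (\<Sum>y\<in>F. \<Sum>z\<in>F. c y z * (1 * (?p y - ?p z)\<^sup>2))"
        using u01 by (intro sum_mono mult_left_mono mult_right_mono mult_le_one c_nonneg) auto
      also have "\<dots> = 2 * energy F ?p" by (simp add: energy_def)
      also have "\<dots> \<le> 2 * \<epsilon> k" using energy[OF F(1)] by simp
      finally have "2 * energy F (\<lambda>y. ?p y * u y) \<le> 2 * \<epsilon> k" .
      then show ?thesis using edge_le_energy[OF F(1,3,4), of "\<lambda>y. ?p y * u y"] by simp
    qed
    moreover have "(\<lambda>k. c y z * (\<phi> k y * u y - \<phi> k z * u z)\<^sup>2) \<longlonglongrightarrow> c y z * (1 * u y - 1 * u z)\<^sup>2"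
      by (intro tendsto_intros lim)
    moreover have "(\<lambda>k. 2 * \<epsilon> k) \<longlonglongrightarrow> 2 * 0" by (intro tendsto_intros \<epsilon>)
    ultimately have "c y z * (u y - u z)\<^sup>2 \<le> 0"
      by (intro LIMSEQ_le[where X = "\<lambda>k. c y z * (\<phi> k y * u y - \<phi> k z * u z)\<^sup>2" and Y = "\<lambda>k. 2 * \<epsilon> k"]) auto
    moreover have "c y z > 0" using that c_nonneg[of y z] by simp
    ultimately have "(u y - u z)\<^sup>2 \<le> 0" by (simp add: mult_le_0_iff)
    then show ?thesis by simp
  qed
  have u0: "u y = 0" if "m y > 0" for y
  proof -
    from connected[OF that] have "u y = u x"
      by (induction rule: rtrancl_induct) (use edge_eq in auto)
    then show ?thesis by (simp add: u_def)
  qed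
  show ?thesis
  proof (cases "y = x")
    case True
    have "m x * escape K x x = (\<Sum>z | c x z \<noteq> 0. c x z * u z)"
      unfolding u_def by (rule escape_recursion)
    also have "\<dots> = 0" using u0 m_pos2 by (intro sum.neutral) auto
    finally show ?thesis using x True by simp
  next
    case False
    then show ?thesis using u0[OF y] by (simp add: u_def)
  qed
qed


text \<open>
  Spheres of linearly growing measure are the borderline for recurrence, as in the plane. A cutoff
  that decreases linearly in the radius would keep its energy bounded below; the cutoff that
  decreases logarithmically, with slope \<open>1 / (r H)\<close> at radius \<open>r\<close> where \<open>H\<close> is a harmonic number, has
  energy of order \<open>H / H\<^sup>2\<close>.
\<close>

lemma escape_eq_0_if_linear_spheres:
  fixes \<rho> :: "'a \<Rightarrow> nat"
  assumes x: "m x > 0"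
    and connected: "\<And>y. m y > 0 \<Longrightarrow> (x, y) \<in> {(y, z). c y z \<noteq> 0}\<^sup>*"
    and step: "\<And>y z. c y z \<noteq> 0 \<Longrightarrow> \<rho> z \<le> Suc (\<rho> y)"
    and spheres: "\<And>r. finite {y. \<rho> y = r}"
    and growth: "\<And>r. (\<Sum>y | \<rho> y = r. m y) \<le> C * (real r + 1)"
    and y: "m y > 0"
  shows "escape K x y = 0"
proof -
  define \<phi> :: "nat \<Rightarrow> 'a \<Rightarrow> real" where "\<phi> N y = max 0 (1 - harm (\<rho> y) / harm (Suc N))" for N y
  have harm_pos: "harm (Suc N) > (0::real)" for N
    using harm_pos[of "Suc N", where ?'a = real] by simp
  have harm_mono: "harm a \<le> (harm b :: real)" if "a \<le> b" for a b
    using that by (rule harm_mono)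
  have supp_sub: "\<phi> N y = 0" if "Suc N \<le> \<rho> y" for N y
  proof -
    have "1 \<le> harm (\<rho> y) / (harm (Suc N) :: real)"
      unfolding le_divide_eq using harm_mono[OF that] harm_pos[of N] by simp
    then have "1 - harm (\<rho> y) / (harm (Suc N) :: real) \<le> 0" by linarith
    then show ?thesis unfolding \<phi>_def by (rule max_absorb1)
  qed
  have balls: "finite {y. \<rho> y \<le> r}" for r
  proof -
    have "{y. \<rho> y \<le> r} = (\<Union>k\<in>{..r}. {y. \<rho> y = k})" by auto
    then show ?thesis using spheres by simp
  qed
  have "C \<ge> 0"
    using growth[of 0] m_nonneg by (smt (verit) sum_nonneg of_nat_0 mult_cancel_left1)
  show ?thesis
  proof (rule escape_eq_0_if_cutoffs[OF x connected, where \<phi> = \<phi> and \<epsilon> = "\<lambda>N. 4 * C / harm (Suc N)"])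
    show "finite {y. \<phi> N y \<noteq> 0}" for N
    proof (rule finite_subset[OF _ balls])
      show "{y. \<phi> N y \<noteq> 0} \<subseteq> {y. \<rho> y \<le> N}" using supp_sub by (force simp: not_le[symmetric])
    qed
    have harm_top: "filterlim (\<lambda>N. harm (Suc N) :: real) at_top sequentially"
      using filterlim_compose[OF harm_at_top filterlim_Suc] .
    show "(\<lambda>N. \<phi> N y) \<longlonglongrightarrow> 1" for y
    proof -
      have "(\<lambda>N. max 0 (1 - harm (\<rho> y) / harm (Suc N))) \<longlonglongrightarrow> max 0 (1 - 0 :: real)"
        by (intro tendsto_intros tendsto_divide_0[OF tendsto_const] filterlim_at_top_imp_at_infinity harm_top)
      then show ?thesis by (simp add: \<phi>_def)
    qed
    show "(\<lambda>N. 4 * C / harm (Suc N)) \<longlonglongrightarrow> 0"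
      by (intro tendsto_divide_0[OF tendsto_const] filterlim_at_top_imp_at_infinity harm_top)
    show "energy F (\<phi> N) \<le> 4 * C / harm (Suc N)" if F: "finite F" for F N
    proof -
      let ?H = "harm (Suc N) :: real"
      \<comment> \<open>The factor 2 covers the step inward, which changes the cutoff by \<open>1 / (r H)\<close> instead of \<open>1 / ((r + 1) H)\<close>.\<close>
      have lip: "\<bar>\<phi> N y - \<phi> N z\<bar> \<le> 2 / ((real (\<rho> y) + 1) * ?H)" if "c y z \<noteq> 0" for y z
      proof -
        have "\<rho> z \<le> Suc (\<rho> y)" "\<rho> y \<le> Suc (\<rho> z)"
          using step[of y z] step[of z y] that by (auto simp: c_sym)
        then consider "\<rho> z = \<rho> y" | "\<rho> z = Suc (\<rho> y)" | "\<rho> y = Suc (\<rho> z)" by linarith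
        then have "\<bar>harm (\<rho> y) - harm (\<rho> z) :: real\<bar> \<le> 2 / (real (\<rho> y) + 1)"
          by cases (auto simp: harm_Suc field_simps)
        then have "\<bar>harm (\<rho> y) - harm (\<rho> z)\<bar> / ?H \<le> 2 / (real (\<rho> y) + 1) / ?H"
          by (intro divide_right_mono less_imp_le[OF harm_pos[of N]])
        then have "\<bar>harm (\<rho> y) / ?H - harm (\<rho> z) / ?H\<bar> \<le> 2 / ((real (\<rho> y) + 1) * ?H)"
          by (simp add: abs_divide abs_of_pos[OF harm_pos] divide_divide_eq_left flip: diff_divide_distrib)
        moreover have "\<bar>max 0 (1 - a) - max 0 (1 - b)\<bar> \<le> \<bar>a - b\<bar>" for a b :: real
          by linarith
        ultimately show ?thesis unfolding \<phi>_def by (rule order_trans[rotated])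
      qed
      \<comment> \<open>At radius \<open>N + 1\<close> the cutoff vanishes but may still have a neighbour where it does not.\<close>
      have point: "(\<Sum>z\<in>F. c y z * (\<phi> N y - \<phi> N z)\<^sup>2) \<le>
          (if \<rho> y \<le> Suc N then m y * (2 / ((real (\<rho> y) + 1) * ?H))\<^sup>2 else 0)" for y
      proof (cases "\<rho> y \<le> Suc N")
        case True
        have "(\<Sum>z\<in>F. c y z * (\<phi> N y - \<phi> N z)\<^sup>2) \<le> (\<Sum>z\<in>F. c y z * (2 / ((real (\<rho> y) + 1) * ?H))\<^sup>2)"
        proof (intro sum_mono)
          fix z
          show "c y z * (\<phi> N y - \<phi> N z)\<^sup>2 \<le> c y z * (2 / ((real (\<rho> y) + 1) * ?H))\<^sup>2"
          proof (cases "c y z = 0")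
            case False
            have "(\<phi> N y - \<phi> N z)\<^sup>2 \<le> (2 / ((real (\<rho> y) + 1) * ?H))\<^sup>2"
              using power_mono[OF lip[OF False], of 2] by simp
            then show ?thesis by (intro mult_left_mono c_nonneg)
          qed simp
        qed
        also have "\<dots> = (\<Sum>z\<in>{z\<in>F. c y z \<noteq> 0}. c y z) * (2 / ((real (\<rho> y) + 1) * ?H))\<^sup>2"
          using F by (subst sum_distrib_right[symmetric]) (auto intro!: arg_cong2[where f = "(*)"] sum.mono_neutral_right)
        also have "\<dots> \<le> m y * (2 / ((real (\<rho> y) + 1) * ?H))\<^sup>2"
          unfolding m_def by (intro mult_right_mono sum_mono2 locally_finite) (auto simp: c_nonneg)
        finally show ?thesis using True by simp
      next
        case False
        have "c y z * (\<phi> N y - \<phi> N z)\<^sup>2 = 0" for z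
        proof (cases "c y z = 0")
          case False
          then have "\<rho> y \<le> Suc (\<rho> z)" using step[of z y] by (simp add: c_sym)
          then show ?thesis using supp_sub[of N y] supp_sub[of N z] \<open>\<not> \<rho> y \<le> Suc N\<close> by simp
        qed simp
        then have "(\<Sum>z\<in>F. c y z * (\<phi> N y - \<phi> N z)\<^sup>2) = 0" by (intro sum.neutral) blast
        then show ?thesis using False by simp
      qed
      have "2 * energy F (\<phi> N) \<le> (\<Sum>y\<in>F. if \<rho> y \<le> Suc N then m y * (2 / ((real (\<rho> y) + 1) * ?H))\<^sup>2 else 0)"
        unfolding energy_def using sum_mono[OF point] by simp
      also have "\<dots> = (\<Sum>y\<in>{y\<in>F. \<rho> y \<le> Suc N}. m y * (2 / ((real (\<rho> y) + 1) * ?H))\<^sup>2)"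
        using F by (simp add: sum.inter_filter)
      also have "\<dots> \<le> (\<Sum>y | \<rho> y \<le> Suc N. m y * (2 / ((real (\<rho> y) + 1) * ?H))\<^sup>2)"
        using m_nonneg by (intro sum_mono2 balls) auto
      also have "{y. \<rho> y \<le> Suc N} = (\<Union>r\<in>{..Suc N}. {y. \<rho> y = r})" by auto
      also have "(\<Sum>y\<in>\<dots>. m y * (2 / ((real (\<rho> y) + 1) * ?H))\<^sup>2) =
          (\<Sum>r\<le>Suc N. \<Sum>y | \<rho> y = r. m y * (2 / ((real (\<rho> y) + 1) * ?H))\<^sup>2)"
        using spheres by (intro sum.UNION_disjoint) auto
      also have "\<dots> = (\<Sum>r\<le>Suc N. (\<Sum>y | \<rho> y = r. m y) * (2 / ((real r + 1) * ?H))\<^sup>2)"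
        by (intro sum.cong refl) (simp add: sum_distrib_right)
      also have "\<dots> \<le> (\<Sum>r\<le>Suc N. C * (real r + 1) * (2 / ((real r + 1) * ?H))\<^sup>2)"
        by (intro sum_mono mult_right_mono growth) simp
      also have "\<dots> = (\<Sum>r\<le>Suc N. 4 * C / ?H\<^sup>2 * inverse (real (Suc r)))"
      proof (intro sum.cong refl)
        fix r
        have "C * a * (2 / (a * h))\<^sup>2 = 4 * C / h\<^sup>2 * inverse a" if "a > 0" "h > 0" for a h :: real
          using that by (simp add: field_simps power2_eq_square)
        from this[OF _ harm_pos[of N], of "real r + 1"]
        show "C * (real r + 1) * (2 / ((real r + 1) * ?H))\<^sup>2 = 4 * C / ?H\<^sup>2 * inverse (real (Suc r))"
          by (simp add: add.commute)
      qed
      also have "\<dots> = 4 * C / ?H\<^sup>2 * harm (Suc (Suc N))"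
        by (simp only: sum_distrib_left[symmetric] harm_def sum.atLeast_Suc_atMost_Suc_shift o_def
            atLeast0AtMost[symmetric] One_nat_def)
      also have "\<dots> \<le> 4 * C / ?H\<^sup>2 * (2 * ?H)"
      proof (intro mult_left_mono)
        have "inverse (real (Suc (Suc N))) \<le> 1" by (simp add: field_simps)
        also have "1 \<le> ?H" using harm_mono[of 1 "Suc N"] by (simp add: harm_def)
        finally show "harm (Suc (Suc N)) \<le> 2 * ?H" by (subst harm_Suc) simp
      qed (use \<open>C \<ge> 0\<close> in simp)
      also have "\<dots> = 2 * (4 * C / ?H)" using harm_pos[of N] by (simp add: power2_eq_square)
      finally show ?thesis by simp
    qed
  qed (use y in simp_all)
qed

end

section \<open>The reversible weight\<close>

definition mass :: "nat ^ 'v::finite \<Rightarrow> nat" where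
  "mass \<xi> = (\<Sum>i\<in>UNIV. \<xi> $ i)"

lemma mass_add: "mass (\<xi> + \<eta>) = mass \<xi> + mass \<eta>"
  by (simp add: mass_def sum.distrib)

lemma mass_axis [simp]: "mass (axis i k) = k"
  by (simp add: mass_def axis_def if_distrib cong: if_cong)

lemma mass_0_iff: "mass \<xi> = 0 \<longleftrightarrow> \<xi> = 0"
  by (simp add: mass_def vec_eq_iff)

lemma component_le_mass: "\<xi> $ i \<le> mass \<xi>"
  unfolding mass_def by (intro member_le_sum) auto

lemma axis_Suc: "axis i (Suc k) = axis i k + (axis i 1 :: nat ^ 'v)"
  by (auto simp: vec_eq_iff axis_def)

lemma unit_step_down:
  fixes \<xi> :: "nat ^ 'v"
  assumes "\<xi> $ i > 0"
  shows "\<xi> = (\<xi> - axis i 1) + axis i 1"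
  using assms by (auto simp: vec_eq_iff axis_def)

lemma sum_prod_box:
  fixes f :: "'v::finite \<Rightarrow> nat \<Rightarrow> real"
  assumes "\<And>k. finite (B k)"
  shows "(\<Sum>\<xi> | \<forall>k. \<xi> $ k \<in> B k. \<Prod>k\<in>UNIV. f k (\<xi> $ k)) = (\<Prod>k\<in>UNIV. \<Sum>x\<in>B k. f k x)"
proof -
  have "(\<Prod>k\<in>UNIV. \<Sum>x\<in>B k. f k x) = (\<Sum>g\<in>Pi\<^sub>E UNIV B. \<Prod>k\<in>UNIV. f k (g k))"
    using assms by (intro prod_sum_PiE) auto
  also have "\<dots> = (\<Sum>\<xi> | \<forall>k. \<xi> $ k \<in> B k. \<Prod>k\<in>UNIV. f k (\<xi> $ k))"
    by (rule sum.reindex_bij_witness[of _ "\<lambda>\<xi> k. \<xi> $ k" vec_lambda]) (auto simp: vec_eq_iff)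
  finally show ?thesis ..
qed

lemma finite_box:
  fixes B :: "'v::finite \<Rightarrow> nat set"
  assumes "\<And>k. finite (B k)"
  shows "finite {\<xi>. \<forall>k. \<xi> $ k \<in> B k}"
proof -
  have "{\<xi>. \<forall>k. \<xi> $ k \<in> B k} \<subseteq> vec_lambda ` Pi\<^sub>E UNIV B"
  proof
    fix \<xi> :: "nat ^ 'v" assume "\<xi> \<in> {\<xi>. \<forall>k. \<xi> $ k \<in> B k}"
    then have "(\<lambda>k. \<xi> $ k) \<in> Pi\<^sub>E UNIV B" by auto
    then show "\<xi> \<in> vec_lambda ` Pi\<^sub>E UNIV B" by (metis image_eqI vec_lambda_eta)
  qed
  then show ?thesis
    by (rule finite_subset) (auto intro!: finite_imageI finite_PiE assms)
qed

lemma finite_sphere: "finite {\<xi> :: nat ^ 'v::finite. mass \<xi> = r}"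
  by (rule finite_subset[OF _ finite_box[of "\<lambda>_. {..r}"]]) (auto intro: component_le_mass)

text \<open>
  Clearing the coordinate \<open>j\<close> is injective on a sphere and maps it into a box. There the sum factors:
  the coordinate \<open>i\<close> contributes \<open>R + 1\<close>, every other one at most a geometric series.
\<close>

lemma sum_sphere_le:
  fixes r :: real and i j :: "'v::finite"
  assumes r: "0 < r" "r < 1"
  shows "(\<Sum>\<xi> | mass \<xi> = R. \<Prod>k\<in>UNIV. if k = i \<or> k = j then 1 else r ^ (\<xi> $ k))
    \<le> (real R + 1) * (1 / (1 - r)) ^ CARD('v)"
proof -
  let ?f = "\<lambda>k x. if k = i \<or> k = j then 1 else r ^ x"
  let ?w = "\<lambda>\<xi> :: nat ^ 'v. \<Prod>k\<in>UNIV. ?f k (\<xi> $ k)"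
  let ?B = "\<lambda>k. if k = j then {0} else {..R}"
  define clear where "clear \<xi> = (\<chi> k. if k = j then 0 else \<xi> $ k)" for \<xi> :: "nat ^ 'v"
  have mass_clear: "mass \<xi> = \<xi> $ j + mass (clear \<xi>)" for \<xi>
  proof -
    have "mass \<xi> = (\<Sum>k\<in>UNIV. (if k = j then \<xi> $ j else 0) + clear \<xi> $ k)"
      unfolding mass_def by (intro sum.cong) (auto simp: clear_def)
    then show ?thesis by (simp add: sum.distrib mass_def)
  qed
  have inj: "inj_on clear {\<xi>. mass \<xi> = R}"
  proof (rule inj_onI)
    fix \<xi> \<eta> assume "\<xi> \<in> {\<xi>. mass \<xi> = R}" "\<eta> \<in> {\<xi>. mass \<xi> = R}" and eq: "clear \<xi> = clear \<eta>"
    then have j: "\<xi> $ j = \<eta> $ j" using mass_clear[of \<xi>] mass_clear[of \<eta>] by simp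
    have "\<xi> $ k = \<eta> $ k" for k
      using arg_cong[OF eq, of "\<lambda>v. v $ k"] j by (cases "k = j") (auto simp: clear_def)
    then show "\<xi> = \<eta>" by (simp add: vec_eq_iff)
  qed
  have "(\<Sum>\<xi> | mass \<xi> = R. ?w \<xi>) = (\<Sum>\<xi> | mass \<xi> = R. ?w (clear \<xi>))"
    by (intro sum.cong prod.cong) (auto simp: clear_def)
  also have "\<dots> = sum ?w (clear ` {\<xi>. mass \<xi> = R})"
    using sum.reindex[OF inj, of ?w] by (simp add: o_def)
  also have "\<dots> \<le> sum ?w {\<xi>. \<forall>k. \<xi> $ k \<in> ?B k}"
  proof (rule sum_mono2)
    show "finite {\<xi> :: nat ^ 'v. \<forall>k. \<xi> $ k \<in> ?B k}" by (intro finite_box) simp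
    show "clear ` {\<xi>. mass \<xi> = R} \<subseteq> {\<xi>. \<forall>k. \<xi> $ k \<in> ?B k}"
      using component_le_mass by (auto simp: clear_def)
    show "0 \<le> ?w \<xi>" for \<xi> using r by (intro prod_nonneg) auto
  qed
  also have "\<dots> = (\<Prod>k\<in>UNIV. \<Sum>x\<in>?B k. ?f k x)"
    by (rule sum_prod_box) simp
  also have "\<dots> \<le> (\<Prod>k\<in>UNIV. (if k = i then real R + 1 else 1) * (1 / (1 - r)))"
  proof (intro prod_mono conjI)
    fix k
    have one: "1 \<le> 1 / (1 - r)" using r by simp
    have geo: "(\<Sum>x\<in>{..R}. r ^ x) \<le> 1 / (1 - r)"
      using r by (simp add: sum_gp0 divide_right_mono)
    have "real R + 1 \<le> (real R + 1) * (1 / (1 - r))"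
      using mult_left_mono[OF one, of "real R + 1"] by simp
    with one geo show "(\<Sum>x\<in>?B k. ?f k x) \<le> (if k = i then real R + 1 else 1) * (1 / (1 - r))"
      using mult_mono[of 1 "real R + 1" 1 "1 / (1 - r)"] r by (auto simp: add.commute)
    show "0 \<le> (\<Sum>x\<in>?B k. ?f k x)" using r by (intro sum_nonneg) auto
  qed
  also have "\<dots> = (real R + 1) * (1 / (1 - r)) ^ CARD('v)"
    by (subst prod.distrib) simp
  finally show ?thesis .
qed

locale interaction =
  fixes \<alpha> :: real and \<beta> :: ereal and E :: "'v::finite \<Rightarrow> 'v \<Rightarrow> bool"
  assumes symp_E: "symp E" and irreflp_E: "irreflp E" and \<beta>_finite: "\<beta> < \<infinity>"
begin

text \<open>
  The bilinear form of the adjacency matrix. On the diagonal it counts every edge twice; therefore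
  the weight is built from the square root \<open>s\<close> of \<open>e\<^bsup>\<beta>\<^esup>\<close>. The power with a natural exponent gives
  \<open>0 ^ 0 = 1\<close>, which is the convention for \<open>\<beta> = - \<infinity>\<close>.
\<close>

definition pair_count :: "nat ^ 'v \<Rightarrow> nat ^ 'v \<Rightarrow> nat" where
  "pair_count \<xi> \<eta> = (\<Sum>i\<in>UNIV. \<Sum>j\<in>UNIV. if E i j then \<xi> $ i * \<eta> $ j else 0)"

definition s :: real where
  "s = sqrt (exp_ereal \<beta>)"

definition weight :: "nat ^ 'v \<Rightarrow> real" where
  "weight \<xi> = exp (\<alpha> / 2 * (\<Sum>i\<in>UNIV. real (\<xi> $ i) * (real (\<xi> $ i) - 1))) * s ^ pair_count \<xi> \<xi>"

definition cond :: "nat ^ 'v \<Rightarrow> nat ^ 'v \<Rightarrow> real" where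
  "cond \<xi> \<eta> = weight \<xi> * rate \<alpha> \<beta> E \<xi> \<eta>"

lemma E_sym: "E i j \<longleftrightarrow> E j i"
  using symp_E by (auto dest: sympD)

lemma not_E_self [simp]: "\<not> E i i"
  using irreflp_E by (simp add: irreflp_def reflp_on_def irreflp_on_def)

lemma pair_count_add:
  "pair_count (\<xi> + \<eta>) \<zeta> = pair_count \<xi> \<zeta> + pair_count \<eta> \<zeta>"
  "pair_count \<zeta> (\<xi> + \<eta>) = pair_count \<zeta> \<xi> + pair_count \<zeta> \<eta>"
  by (auto simp: pair_count_def sum.distrib[symmetric] algebra_simps intro!: sum.cong)

lemma pair_count_sym: "pair_count \<xi> \<eta> = pair_count \<eta> \<xi>"
  unfolding pair_count_def
  by (subst sum.swap, intro sum.cong refl) (simp add: E_sym mult.commute)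

lemma pair_count_axis: "pair_count (axis i k) \<eta> = k * (\<Sum>j\<in>UNIV. if E i j then \<eta> $ j else 0)"
proof -
  have "pair_count (axis i k) \<eta> = (\<Sum>i'\<in>UNIV. if i' = i then (\<Sum>j\<in>UNIV. if E i j then k * \<eta> $ j else 0) else 0)"
    unfolding pair_count_def by (intro sum.cong refl) (auto simp: axis_def intro!: sum.cong)
  then show ?thesis by (simp add: sum_distrib_left if_distrib cong: if_cong)
qed

lemma pair_count_axis_axis: "pair_count (axis i k) (axis j l) = (if E i j then k * l else 0)"
proof -
  have "(\<Sum>j'\<in>UNIV. if E i j' then axis j l $ j' else 0) = (\<Sum>j'\<in>UNIV. if j' = j then (if E i j then l else 0) else 0)"
    by (intro sum.cong refl) (auto simp: axis_def)
  then show ?thesis by (simp add: pair_count_axis)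
qed

lemma adj_matrix_mult: "(adj_matrix E *v \<xi>) $ i = pair_count (axis i 1) \<xi>"
proof -
  have "(adj_matrix E *v \<xi>) $ i = (\<Sum>j\<in>UNIV. if E i j then \<xi> $ j else 0)"
    unfolding matrix_vector_mult_def adj_matrix_def
    by (simp add: if_distrib[of "\<lambda>x. x * _"] cong: if_cong)
  then show ?thesis by (simp add: pair_count_axis)
qed

lemma pair_count_up:
  "pair_count (\<xi> + axis i 1) (\<xi> + axis i 1) = pair_count \<xi> \<xi> + 2 * pair_count (axis i 1) \<xi>"
  by (simp add: pair_count_add pair_count_sym[of \<xi> "axis i _"] pair_count_axis_axis)

lemma pair_count_ge: "E i j \<Longrightarrow> \<xi> $ i * \<xi> $ j \<le> pair_count \<xi> \<xi>"
proof -
  assume "E i j"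
  then have "\<xi> $ i * \<xi> $ j \<le> (\<Sum>j\<in>UNIV. if E i j then \<xi> $ i * \<xi> $ j else 0)"
    using member_le_sum[of j UNIV "\<lambda>j. if E i j then \<xi> $ i * \<xi> $ j else 0"] by simp
  also have "\<dots> \<le> pair_count \<xi> \<xi>"
    unfolding pair_count_def
    using member_le_sum[of i UNIV "\<lambda>i. \<Sum>j\<in>UNIV. if E i j then \<xi> $ i * \<xi> $ j else 0"] by simp
  finally show ?thesis .
qed

lemma pair_count_0_iff: "pair_count \<xi> \<xi> = 0 \<longleftrightarrow> (\<forall>i j. E i j \<longrightarrow> \<xi> $ i * \<xi> $ j = 0)"
  by (auto simp: pair_count_def)

lemma s_nonneg: "s \<ge> 0"
  by (simp add: s_def exp_ereal_nonneg)

lemma s_ereal: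
  assumes "\<beta> = ereal b"
  shows "s = exp (b / 2)"
proof -
  have "exp_ereal \<beta> = exp b" using assms by (simp add: exp_ereal_def)
  then show ?thesis
    unfolding s_def by (intro real_sqrt_unique) (simp_all flip: exp_double)
qed

lemma s_MInfty:
  assumes "\<beta> = - \<infinity>"
  shows "s = 0"
proof -
  have "exp_ereal \<beta> = 0" using assms by (simp add: exp_ereal_def)
  then show ?thesis by (simp add: s_def)
qed

lemma s_pos: "\<beta> \<noteq> - \<infinity> \<Longrightarrow> s > 0"
  using \<beta>_finite s_ereal by (cases \<beta>) auto

lemma weight_nonneg: "weight \<xi> \<ge> 0"
  by (simp add: weight_def s_nonneg)

lemma weight_pos_iff: "weight \<xi> > 0 \<longleftrightarrow> \<xi> \<in> state_space \<beta> E"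
proof (cases "\<beta> = - \<infinity>")
  case True
  have "weight \<xi> > 0 \<longleftrightarrow> pair_count \<xi> \<xi> = 0"
    by (simp add: weight_def s_MInfty[OF True] zero_less_mult_iff power_0_left)
  then show ?thesis
    unfolding pair_count_0_iff state_space_def if_P[OF True] by simp
next
  case False
  then show ?thesis by (simp add: weight_def s_pos state_space_def)
qed

lemma weight_0 [simp]: "weight 0 = 1"
  by (simp add: weight_def pair_count_def cong: if_cong)

lemma exp_ereal_rate:
  "exp_ereal (ereal (\<alpha> * real k) + \<beta> * ereal (real a)) = exp (\<alpha> * real k) * (s\<^sup>2) ^ a"
proof (cases \<beta>)
  case (real b)
  have "s\<^sup>2 = exp b" unfolding s_ereal[OF real] by (simp flip: exp_double)
  then show ?thesis
    unfolding real by (simp add: exp_ereal_def exp_add exp_of_nat2_mult)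
next
  case MInf
  from s_MInfty[OF this] show ?thesis
    unfolding MInf by (cases "a = 0") (simp_all add: exp_ereal_def power_0_left)
qed (use \<beta>_finite in simp)

text \<open>
  Detailed balance: the exponent of the weight grows by \<open>\<alpha> \<xi>\<^sub>i + \<beta> (A \<xi>)\<^sub>i\<close> when \<open>\<xi>\<^sub>i\<close> grows by 1, which is
  the logarithm of the rate upwards, and the rate downwards is 1. So both directions of the edge
  between \<open>\<xi>\<close> and \<open>\<xi> + e\<^sub>i\<close> carry the weight of its upper end.
\<close>

lemma cond_up: "cond \<xi> (\<xi> + axis i 1) = weight (\<xi> + axis i 1)"
proof -
  have "(\<Sum>k\<in>UNIV. real ((\<xi> + axis i 1) $ k) * (real ((\<xi> + axis i 1) $ k) - 1)) =
      (\<Sum>k\<in>UNIV. real (\<xi> $ k) * (real (\<xi> $ k) - 1) + (if k = i then 2 * real (\<xi> $ i) else 0))"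
    by (intro sum.cong refl) (auto simp: axis_def algebra_simps)
  then have "weight (\<xi> + axis i 1) = weight \<xi> * (exp (\<alpha> * real (\<xi> $ i)) * (s\<^sup>2) ^ pair_count (axis i 1) \<xi>)"
    unfolding weight_def pair_count_up
    by (simp add: sum.distrib exp_add distrib_left power_add power_mult mult_ac)
  then show ?thesis
    unfolding cond_def rate_up adj_matrix_mult exp_ereal_rate by simp
qed

lemma cond_down: "cond (\<xi> + axis i 1) \<xi> = weight (\<xi> + axis i 1)"
  using rate_down[of "\<xi> + axis i 1" i \<alpha> \<beta> E] by (simp add: cond_def axis_def)

lemma cond_neighbour: "cond \<xi> \<eta> \<noteq> 0 \<Longrightarrow> (\<exists>i. \<eta> = \<xi> + axis i 1) \<or> (\<exists>i. \<xi> = \<eta> + axis i 1)"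
  using rate_other[of \<eta> \<xi> \<alpha> \<beta> E] unit_step_down[of \<xi>] by (auto simp: cond_def)

lemma cond_sym: "cond \<xi> \<eta> = cond \<eta> \<xi>"
proof (cases "cond \<xi> \<eta> = 0 \<and> cond \<eta> \<xi> = 0")
  case False
  then have "(\<exists>i. \<eta> = \<xi> + axis i 1) \<or> (\<exists>i. \<xi> = \<eta> + axis i 1)"
    using cond_neighbour[of \<xi> \<eta>] cond_neighbour[of \<eta> \<xi>] by blast
  then show ?thesis using cond_up cond_down by auto
qed simp

lemma finite_cond: "finite {\<eta>. cond \<xi> \<eta> \<noteq> 0}"
  by (rule finite_subset[OF _ finite_rate_support[of \<alpha> \<beta> E \<xi>]]) (auto simp: cond_def)

sublocale network cond
  by unfold_locales (simp_all add: cond_sym finite_cond, simp add: cond_def weight_nonneg rate_nonneg)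

lemma m_eq: "m \<xi> = weight \<xi> * total_rate \<alpha> \<beta> E \<xi>"
proof (cases "weight \<xi> = 0")
  case False
  then have "m \<xi> = (\<Sum>\<eta> | rate \<alpha> \<beta> E \<xi> \<eta> \<noteq> 0. weight \<xi> * rate \<alpha> \<beta> E \<xi> \<eta>)"
    unfolding m_def cond_def by (intro sum.cong) auto
  then show ?thesis by (simp add: total_rate_eq_sum sum_distrib_left)
qed (simp add: m_def cond_def)

lemma m_pos_iff: "m \<xi> > 0 \<longleftrightarrow> \<xi> \<in> state_space \<beta> E"
  unfolding m_eq weight_pos_iff[symmetric] using total_rate_pos[of \<alpha> \<beta> E \<xi>]
  by (simp add: zero_less_mult_iff)

sublocale reversible_chain cond "jump_chain \<alpha> \<beta> E"
proof
  fix \<xi> \<eta> assume "m \<xi> > 0"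
  then show "pmf (jump_chain \<alpha> \<beta> E \<xi>) \<eta> = cond \<xi> \<eta> / m \<xi>"
    unfolding pmf_jump_chain m_eq cond_def by auto
qed

text \<open>
  The conductances at \<open>\<xi>\<close> are the weights of its upper neighbours, and its own weight once for every
  lower neighbour.
\<close>

lemma m_le: "m \<xi> \<le> (\<Sum>i\<in>UNIV. weight (\<xi> + axis i 1)) + real CARD('v) * weight \<xi>"
proof -
  let ?U = "range (\<lambda>i. \<xi> + axis i 1)" and ?D = "(\<lambda>i. \<xi> - axis i 1) ` {i. \<xi> $ i > 0}"
  have "{\<eta>. cond \<xi> \<eta> \<noteq> 0} \<subseteq> ?U \<union> ?D"
  proof (intro subsetI, rule ccontr)
    fix \<eta> assume "\<eta> \<in> {\<eta>. cond \<xi> \<eta> \<noteq> 0}" "\<eta> \<notin> ?U \<union> ?D"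
    then show False using rate_other[of \<eta> \<xi> \<alpha> \<beta> E] by (auto simp: cond_def)
  qed
  then have "m \<xi> \<le> sum (cond \<xi>) (?U \<union> ?D)"
    unfolding m_def by (intro sum_mono2) (auto simp: c_nonneg)
  also have "\<dots> \<le> sum (cond \<xi>) ?U + sum (cond \<xi>) ?D"
    by (simp add: sum_Un sum_nonneg c_nonneg)
  also have "sum (cond \<xi>) ?U = (\<Sum>i\<in>UNIV. weight (\<xi> + axis i 1))"
  proof -
    have "inj (\<lambda>i. \<xi> + axis i (1::nat))" using unit_steps(1)[of \<xi>] by (auto simp: inj_def)
    then show ?thesis by (simp only: sum.reindex o_def cond_up)
  qed
  also have "sum (cond \<xi>) ?D \<le> real CARD('v) * weight \<xi>"
  proof -
    have "sum (cond \<xi>) ?D \<le> (\<Sum>\<eta>\<in>?D. weight \<xi>)"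
      using rate_down[of \<xi> _ \<alpha> \<beta> E] by (intro sum_mono) (auto simp: cond_def)
    also have "\<dots> \<le> real CARD('v) * weight \<xi>"
      using card_image_le[of "{i. \<xi> $ i > 0}" "\<lambda>i. \<xi> - axis i 1"] card_mono[of UNIV "{i. \<xi> $ i > 0}"]
      by (auto intro!: mult_right_mono weight_nonneg)
    finally show ?thesis .
  qed
  finally show ?thesis by simp
qed

lemma cond_mass: "cond \<xi> \<eta> \<noteq> 0 \<Longrightarrow> mass \<eta> \<le> Suc (mass \<xi>)"
  using cond_neighbour[of \<xi> \<eta>] by (auto simp: mass_add)

lemma weight_mono_pos: "weight (\<xi> + axis i 1) > 0 \<Longrightarrow> weight \<xi> > 0"
  using cond_up[of \<xi> i] weight_nonneg[of \<xi>] unfolding cond_def by (cases "weight \<xi> = 0") auto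

text \<open>
  Removing particles one at a time stays in the state space and leads to the empty configuration.
\<close>

lemma connected_to_0: "weight \<xi> > 0 \<Longrightarrow> (0, \<xi>) \<in> {(y, z). cond y z \<noteq> 0}\<^sup>*"
proof (induction "mass \<xi>" arbitrary: \<xi>)
  case 0
  then show ?case using mass_0_iff[of \<xi>] by simp
next
  case (Suc k)
  then obtain i where "\<xi> $ i > 0" using mass_0_iff[of \<xi>] by (auto simp: vec_eq_iff)
  then obtain \<eta> where \<eta>: "\<xi> = \<eta> + axis i 1" using unit_step_down by blast
  have "(0, \<eta>) \<in> {(y, z). cond y z \<noteq> 0}\<^sup>*"
    using Suc \<eta> weight_mono_pos by (intro Suc.hyps(1)) (auto simp: mass_add)
  moreover have "cond \<eta> \<xi> \<noteq> 0" using Suc.prems unfolding \<eta> cond_up by simp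
  ultimately show ?case by (simp add: rtrancl.rtrancl_into_rtrancl)
qed

lemma connected:
  assumes "m \<xi> > 0" "m \<eta> > 0"
  shows "(\<xi>, \<eta>) \<in> {(y, z). cond y z \<noteq> 0}\<^sup>*"
proof -
  have "sym {(y, z). cond y z \<noteq> 0}" by (auto simp: sym_def cond_sym)
  moreover have "(0, \<xi>) \<in> {(y, z). cond y z \<noteq> 0}\<^sup>*" "(0, \<eta>) \<in> {(y, z). cond y z \<noteq> 0}\<^sup>*"
    using assms by (auto intro!: connected_to_0 simp: weight_pos_iff m_pos_iff)
  ultimately show ?thesis by (meson rtrancl_trans sym_rtrancl symD)
qed

end

section \<open>Criteria in terms of the weight\<close>

context interaction
begin

lemma zeta_positive_recurrentI:
  assumes r: "0 < r" "r < 1" and C: "C \<ge> 0" and bound: "\<And>\<xi>. weight \<xi> \<le> C * r ^ mass \<xi>"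
  shows "zeta_positive_recurrent \<alpha> \<beta> E"
proof -
  let ?n = "real CARD('v)"
  have m_bound: "m \<xi> \<le> 2 * ?n * C * r ^ mass \<xi>" for \<xi>
  proof -
    have "weight (\<xi> + axis i 1) \<le> C * r ^ mass \<xi>" for i
    proof -
      have "weight (\<xi> + axis i 1) \<le> C * r ^ mass (\<xi> + axis i 1)" by (rule bound)
      also have "\<dots> \<le> C * r ^ mass \<xi>"
        using r C by (intro mult_left_mono power_decreasing) (auto simp: mass_add)
      finally show ?thesis .
    qed
    then have "(\<Sum>i\<in>UNIV. weight (\<xi> + axis i 1)) \<le> ?n * (C * r ^ mass \<xi>)"
      using sum_mono[of UNIV "\<lambda>i. weight (\<xi> + axis i 1)" "\<lambda>_. C * r ^ mass \<xi>"] by simp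
    moreover have "?n * weight \<xi> \<le> ?n * (C * r ^ mass \<xi>)"
      by (intro mult_left_mono bound) simp
    moreover have "2 * ?n * C * r ^ mass \<xi> = ?n * (C * r ^ mass \<xi>) + ?n * (C * r ^ mass \<xi>)"
      by simp
    ultimately show ?thesis using m_le[of \<xi>] by linarith
  qed
  define box where "box N = {\<xi> :: nat ^ 'v. \<forall>k. \<xi> $ k \<in> {..<N}}" for N
  let ?f = "\<lambda>\<xi>. ennreal (m \<xi>)"
  have box_le: "(\<integral>\<^sup>+\<xi>. ?f \<xi> * indicator (box N) \<xi> \<partial>count_space UNIV) \<le> ennreal (2 * ?n * C * (1 / (1 - r)) ^ CARD('v))" for N
  proof -
    have fin: "finite (box N)" unfolding box_def by (intro finite_box) simp
    have "(\<Sum>\<xi>\<in>box N. m \<xi>) \<le> (\<Sum>\<xi>\<in>box N. 2 * ?n * C * r ^ mass \<xi>)"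
      by (intro sum_mono m_bound)
    also have "\<dots> = 2 * ?n * C * (\<Sum>\<xi>\<in>box N. \<Prod>k\<in>UNIV. r ^ (\<xi> $ k))"
      by (simp add: sum_distrib_left mass_def power_sum)
    also have "(\<Sum>\<xi>\<in>box N. \<Prod>k\<in>UNIV. r ^ (\<xi> $ k)) = (\<Prod>k\<in>(UNIV :: 'v set). \<Sum>x<N. r ^ x)"
      unfolding box_def by (rule sum_prod_box) simp
    also have "2 * ?n * C * \<dots> \<le> 2 * ?n * C * (\<Prod>k\<in>(UNIV :: 'v set). 1 / (1 - r))"
    proof (intro mult_left_mono prod_mono conjI)
      show "(\<Sum>x<N. r ^ x) \<le> 1 / (1 - r)"
        using r by (simp add: sum_gp_strict divide_right_mono)
    qed (use r C in \<open>auto intro: sum_nonneg\<close>)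
    finally have "(\<Sum>\<xi>\<in>box N. m \<xi>) \<le> 2 * ?n * C * (1 / (1 - r)) ^ CARD('v)" by simp
    moreover have "(\<integral>\<^sup>+\<xi>. ?f \<xi> * indicator (box N) \<xi> \<partial>count_space UNIV) = ennreal (\<Sum>\<xi>\<in>box N. m \<xi>)"
      using fin by (subst nn_integral_count_space'[of "box N"]) (auto simp: sum_ennreal m_nonneg)
    ultimately show ?thesis by (simp add: ennreal_leI)
  qed
  have "?f \<xi> = (SUP N. ?f \<xi> * indicator (box N) \<xi>)" for \<xi>
  proof (intro antisym SUP_least)
    have "\<xi> \<in> box (Suc (mass \<xi>))"
      using component_le_mass[of \<xi>] by (auto simp: box_def less_Suc_eq_le)
    then have "?f \<xi> = ?f \<xi> * indicator (box (Suc (mass \<xi>))) \<xi>" by simp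
    also have "\<dots> \<le> (SUP N. ?f \<xi> * indicator (box N) \<xi>)" by (rule SUP_upper) simp
    finally show "?f \<xi> \<le> (SUP N. ?f \<xi> * indicator (box N) \<xi>)" .
  qed (auto simp: indicator_def)
  then have "(\<integral>\<^sup>+\<xi>. ?f \<xi> \<partial>count_space UNIV) = (\<integral>\<^sup>+\<xi>. (SUP N. ?f \<xi> * indicator (box N) \<xi>) \<partial>count_space UNIV)"
    by simp
  also have "\<dots> = (SUP N. \<integral>\<^sup>+\<xi>. ?f \<xi> * indicator (box N) \<xi> \<partial>count_space UNIV)"
  proof (intro nn_integral_monotone_convergence_SUP)
    show "incseq (\<lambda>N \<xi>. ?f \<xi> * indicator (box N) \<xi>)"
    proof (intro incseq_SucI le_funI)
      fix N \<xi>
      have "box N \<subseteq> box (Suc N)" by (auto simp: box_def less_Suc_eq)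
      then show "?f \<xi> * indicator (box N) \<xi> \<le> ?f \<xi> * indicator (box (Suc N)) \<xi>"
        by (auto simp: indicator_def)
    qed
  qed simp
  also have "\<dots> \<le> ennreal (2 * ?n * C * (1 / (1 - r)) ^ CARD('v))"
    by (intro SUP_least box_le)
  also have "\<dots> < \<infinity>" by simp
  finally have "(\<integral>\<^sup>+\<xi>. ?f \<xi> \<partial>count_space UNIV) < \<infinity>" .
  then show ?thesis
    unfolding zeta_positive_recurrent_def
    by (intro ballI positive_recurrent_if_finite_mass) (simp_all add: m_pos_iff)
qed

lemma zeta_transientI:
  assumes "nonzero_capacity \<xi>" "weight \<xi> > 0"
  shows "zeta_transient \<alpha> \<beta> E"
  unfolding zeta_transient_def
proof
  fix \<eta> assume "\<eta> \<in> state_space \<beta> E"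
  then have "m \<eta> > 0" "m \<xi> > 0" using assms by (simp_all add: m_pos_iff weight_pos_iff)
  then show "transient_state (jump_chain \<alpha> \<beta> E) \<eta>"
    using nonzero_capacity_connected[OF connected assms(1)] by (intro transient_if_nonzero_capacity)
qed

text \<open>
  Monotone paths are injective, and exponential growth makes the sum of their resistances finite.
\<close>

lemma zeta_transient_if_path:
  assumes step: "\<And>k. \<exists>i. p (Suc k) = p k + axis i 1"
    and growth: "\<And>k. weight (p k) \<ge> exp (a + b * real k)" and b: "b > 0"
  shows "zeta_transient \<alpha> \<beta> E"
proof (rule zeta_transientI)
  have mass_p: "mass (p k) = mass (p 0) + k" for k
  proof (induction k)
    case (Suc k)
    then show ?case using step[of k] by (auto simp: mass_add)
  qed simp
  have pos: "weight (p k) > 0" for k using growth[of k] by (rule less_le_trans[OF exp_gt_zero])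
  have cond: "cond (p k) (p (Suc k)) = weight (p (Suc k))" for k
    using step[of k] cond_up by auto
  show "nonzero_capacity (p 0)"
  proof (rule nonzero_capacity_path)
    show "inj p" by (rule injI) (metis mass_p add_left_cancel)
    show "cond (p k) (p (Suc k)) > 0" for k using cond pos by simp
    show "summable (\<lambda>k. 1 / cond (p k) (p (Suc k)))"
    proof (rule summable_comparison_test')
      show "summable (\<lambda>k. exp (- a - b) * exp (- b) ^ k)"
        using b by (intro summable_mult summable_geometric) simp
      fix k :: nat
      have "1 / weight (p (Suc k)) \<le> 1 / exp (a + b * real (Suc k))"
        using growth[of "Suc k"] by (intro divide_left_mono mult_pos_pos pos) auto
      also have "\<dots> = exp (- a - b) * exp (- b) ^ k"
        by (simp add: exp_of_nat2_mult[symmetric] algebra_simps flip: exp_minus exp_add inverse_eq_divide)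
      finally show "norm (1 / cond (p k) (p (Suc k))) \<le> exp (- a - b) * exp (- b) ^ k"
        using pos[of "Suc k"] by (simp add: cond)
    qed
  qed
  show "weight (p 0) > 0" by (rule pos)
qed

text \<open>
  A single vertex does not interact with itself when \<open>\<alpha> = 0\<close>, so the weight is 1 along each axis.
\<close>

lemma infinite_mass:
  assumes "\<alpha> = 0"
  shows "(\<integral>\<^sup>+\<xi>. ennreal (m \<xi>) \<partial>count_space UNIV) = \<infinity>"
proof -
  obtain i :: 'v where True by simp
  have w: "weight (axis i k) = 1" for k
    unfolding weight_def by (simp add: assms pair_count_axis_axis)
  have m1: "m (axis i k) \<ge> 1" for k
  proof -
    have "1 = cond (axis i k) (axis i (Suc k))"
      unfolding axis_Suc[of i k] cond_up by (simp only: w flip: axis_Suc)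
    also have "\<dots> \<le> m (axis i k)"
    proof (cases "cond (axis i k) (axis i (Suc k)) = 0")
      case False
      then show ?thesis
        unfolding m_def by (intro member_le_sum) (auto simp: c_nonneg locally_finite)
    qed (simp add: m_nonneg)
    finally show ?thesis .
  qed
  let ?S = "range (\<lambda>k. axis i k :: nat ^ 'v)"
  have "inj (\<lambda>k. axis i k :: nat ^ 'v)" by (auto simp: inj_def axis_eq_axis)
  then have "infinite ?S" by (simp add: range_inj_infinite)
  then have "\<infinity> = (\<integral>\<^sup>+\<xi>. indicator ?S \<xi> \<partial>count_space UNIV)" by simp
  also have "\<dots> \<le> (\<integral>\<^sup>+\<xi>. ennreal (m \<xi>) \<partial>count_space UNIV)"
    using m1 by (intro nn_integral_mono) (auto simp: indicator_def simp flip: ennreal_1 intro!: ennreal_leI)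
  finally show ?thesis by (simp add: top_unique)
qed

text \<open>
  If the weight decays in all but two coordinates, the spheres have at most linearly growing mass, as
  in a quadrant of the plane. The two exceptional coordinates may depend on the configuration, at the
  cost of a factor bounded by the number of pairs of vertices.
\<close>

lemma zeta_null_recurrentI:
  assumes \<alpha>: "\<alpha> = 0" and r: "0 < r" "r < 1"
    and bound: "\<And>\<xi>. \<exists>i j. weight \<xi> \<le> (\<Prod>k\<in>UNIV. if k = i \<or> k = j then 1 else r ^ (\<xi> $ k))"
  shows "zeta_null_recurrent \<alpha> \<beta> E"
proof -
  let ?n = "real CARD('v)"
  define G where "G = ?n * ?n * (1 / (1 - r)) ^ CARD('v)"
  have G: "G \<ge> 0" using r by (simp add: G_def)
  let ?w = "\<lambda>(i :: 'v) j (\<xi> :: nat ^ 'v). \<Prod>k\<in>UNIV. if k = i \<or> k = j then 1 else r ^ (\<xi> $ k)"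
  have w0: "?w i j \<xi> \<ge> 0" for i j and \<xi> :: "nat ^ 'v" using r by (intro prod_nonneg) auto
  have weight_le: "weight \<xi> \<le> (\<Sum>i\<in>UNIV. \<Sum>j\<in>UNIV. ?w i j \<xi>)" for \<xi>
  proof -
    obtain i j where "weight \<xi> \<le> ?w i j \<xi>" using bound by blast
    also have "\<dots> \<le> (\<Sum>j\<in>UNIV. ?w i j \<xi>)"
      by (rule member_le_sum[of j UNIV "\<lambda>j. ?w i j \<xi>"]) (auto simp only: w0 finite UNIV_I)
    also have "\<dots> \<le> (\<Sum>i\<in>UNIV. \<Sum>j\<in>UNIV. ?w i j \<xi>)"
      by (rule member_le_sum[of i UNIV "\<lambda>i. \<Sum>j\<in>UNIV. ?w i j \<xi>"]) (auto simp only: finite UNIV_I intro!: sum_nonneg w0)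
    finally show ?thesis .
  qed
  have sphere: "(\<Sum>\<xi> | mass \<xi> = R. weight \<xi>) \<le> G * (real R + 1)" for R
  proof -
    have "(\<Sum>\<xi> | mass \<xi> = R. weight \<xi>) \<le> (\<Sum>\<xi> | mass \<xi> = R. \<Sum>i\<in>UNIV. \<Sum>j\<in>UNIV. ?w i j \<xi>)"
      by (rule sum_mono) (rule weight_le)
    also have "\<dots> = (\<Sum>i\<in>UNIV. \<Sum>\<xi> | mass \<xi> = R. \<Sum>j\<in>UNIV. ?w i j \<xi>)"
      by (rule sum.swap)
    also have "\<dots> = (\<Sum>i\<in>UNIV. \<Sum>j\<in>UNIV. \<Sum>\<xi> | mass \<xi> = R. ?w i j \<xi>)"
      by (intro sum.cong refl sum.swap)
    also have "\<dots> \<le> (\<Sum>i\<in>(UNIV :: 'v set). \<Sum>j\<in>(UNIV :: 'v set). (real R + 1) * (1 / (1 - r)) ^ CARD('v))"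
      by (intro sum_mono sum_sphere_le r)
    also have "\<dots> = G * (real R + 1)" by (simp add: G_def)
    finally show ?thesis .
  qed
  have sphere_up: "(\<Sum>\<xi> | mass \<xi> = R. weight (\<xi> + axis i 1)) \<le> G * (real R + 2)" for R i
  proof -
    have inj: "inj_on (\<lambda>\<xi>. \<xi> + axis i 1) {\<xi>. mass \<xi> = R}" by (auto simp: inj_on_def)
    have "(\<Sum>\<xi> | mass \<xi> = R. weight (\<xi> + axis i 1)) = sum weight ((\<lambda>\<xi>. \<xi> + axis i 1) ` {\<xi>. mass \<xi> = R})"
      using sum.reindex[OF inj, of weight] by (simp add: o_def)
    also have "\<dots> \<le> (\<Sum>\<xi> | mass \<xi> = Suc R. weight \<xi>)"
      by (intro sum_mono2 finite_sphere) (auto simp: mass_add weight_nonneg)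
    also have "\<dots> \<le> G * (real R + 2)" using sphere[of "Suc R"] by (simp add: add_ac)
    finally show ?thesis .
  qed
  have growth: "(\<Sum>\<xi> | mass \<xi> = R. m \<xi>) \<le> (3 * ?n * G) * (real R + 1)" for R
  proof -
    have "(\<Sum>\<xi> | mass \<xi> = R. m \<xi>) \<le> (\<Sum>\<xi> | mass \<xi> = R. (\<Sum>i\<in>UNIV. weight (\<xi> + axis i 1)) + ?n * weight \<xi>)"
      by (intro sum_mono m_le)
    also have "\<dots> = (\<Sum>i\<in>UNIV. \<Sum>\<xi> | mass \<xi> = R. weight (\<xi> + axis i 1)) + ?n * (\<Sum>\<xi> | mass \<xi> = R. weight \<xi>)"
      by (simp only: sum.distrib sum_distrib_left sum.swap[of _ UNIV])
    also have "\<dots> \<le> (\<Sum>i\<in>(UNIV :: 'v set). G * (real R + 2)) + ?n * (G * (real R + 1))"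
      by (intro add_mono sum_mono sphere_up mult_left_mono sphere) simp
    also have "\<dots> \<le> (3 * ?n * G) * (real R + 1)"
    proof -
      have "0 \<le> ?n * G * real R" using G by simp
      then show ?thesis by (simp add: algebra_simps)
    qed
    finally show ?thesis .
  qed
  show ?thesis
    unfolding zeta_null_recurrent_def
  proof
    fix \<xi> assume "\<xi> \<in> state_space \<beta> E"
    then have pos: "m \<xi> > 0" by (simp add: m_pos_iff)
    have "escape (jump_chain \<alpha> \<beta> E) \<xi> \<eta> = 0" if "m \<eta> > 0" for \<eta>
      using pos connected[OF pos] cond_mass finite_sphere growth that
      by (rule escape_eq_0_if_linear_spheres)
    then show "null_recurrent_state (jump_chain \<alpha> \<beta> E) \<xi>"
      by (intro null_recurrent_if_infinite_mass pos infinite_mass \<alpha>)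
  qed
qed

text \<open>
  A copy of the octant \<open>\<nat>\<^sup>3\<close> with unit conductances. The flow follows Polya's urn: from \<open>\<xi>\<close> the
  coordinate \<open>i\<close> is increased with probability proportional to \<open>\<xi>\<^sub>i + 1\<close>. The urn is uniformly
  distributed on the sphere \<open>L N\<close>, which has \<open>(N + 1) (N + 2) / 2\<close> points. So the energy of the flow
  through that sphere is at most the reciprocal of this number, and these reciprocals are summable.
\<close>

lemma nonzero_capacity_octant:
  assumes T: "card T = 3" and w: "\<And>\<xi>. (\<And>i. i \<notin> T \<Longrightarrow> \<xi> $ i = 0) \<Longrightarrow> weight \<xi> = 1"
  shows "nonzero_capacity 0"
proof -
  define L where "L N = {\<xi> :: nat ^ 'v. (\<forall>i. i \<notin> T \<longrightarrow> \<xi> $ i = 0) \<and> mass \<xi> = N}" for N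
  define num where "num N = real (card (L N))" for N
  have finL: "finite (L N)" for N unfolding L_def by (rule finite_subset[OF _ finite_sphere[of N]]) auto
  have mass_T: "(\<Sum>i\<in>T. \<xi> $ i) = N" if "\<xi> \<in> L N" for \<xi> N
    using that unfolding L_def mass_def by (auto intro!: sum.mono_neutral_left)
  \<comment> \<open>The edges from \<open>L N\<close> to \<open>L (N + 1)\<close>, counted from above: \<open>\<eta>\<close> is reached with total factor \<open>N + 1\<close>.
    This gives both the size of the spheres and the uniformity of the urn.\<close>
  have transport: "(\<Sum>(\<xi>, i)\<in>L N \<times> T. real (Suc (\<xi> $ i)) * \<phi> (\<xi> + axis i 1)) = real (Suc N) * sum \<phi> (L (Suc N))"
    for N and \<phi> :: "nat ^ 'v \<Rightarrow> real"
  proof -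
    have "real (Suc N) * sum \<phi> (L (Suc N)) = (\<Sum>\<eta>\<in>L (Suc N). \<Sum>i\<in>T. real (\<eta> $ i) * \<phi> \<eta>)"
      unfolding sum_distrib_left sum_distrib_right[symmetric] of_nat_sum[symmetric]
      by (intro sum.cong refl) (simp only: mass_T)
    also have "\<dots> = (\<Sum>(\<eta>, i)\<in>L (Suc N) \<times> T. real (\<eta> $ i) * \<phi> \<eta>)"
      by (rule sum.cartesian_product)
    also have "\<dots> = (\<Sum>(\<eta>, i)\<in>{x \<in> L (Suc N) \<times> T. fst x $ snd x > 0}. real (\<eta> $ i) * \<phi> \<eta>)"
      using finL T by (intro sum.mono_neutral_right) (auto simp: card_ge_0_finite)
    also have "\<dots> = (\<Sum>(\<xi>, i)\<in>L N \<times> T. real (Suc (\<xi> $ i)) * \<phi> (\<xi> + axis i 1))"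
    proof (rule sum.reindex_bij_witness[of _ "\<lambda>(\<xi>, i). (\<xi> + axis i 1, i)" "\<lambda>(\<eta>, i). (\<eta> - axis i 1, i)"], goal_cases)
      case (1 x)
      then show ?case by (auto simp: unit_step_down[symmetric, simplified])
    next
      case (2 x)
      obtain \<eta> i where x: "x = (\<eta>, i)" by (cases x)
      with 2 have \<eta>: "\<eta> \<in> L (Suc N)" "i \<in> T" "\<eta> $ i > 0" by auto
      have "mass \<eta> = mass (\<eta> - axis i 1) + 1"
        using unit_step_down[OF \<eta>(3)] mass_add[of "\<eta> - axis i 1" "axis i 1"] by simp
      then show ?case using \<eta> by (auto simp: x L_def)
    next
      case (3 x)
      then show ?case by (auto simp: vec_eq_iff)
    next
      case (4 x)
      then show ?case by (auto simp: L_def mass_add mass_axis[simplified]) (auto simp: axis_def)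
    next
      case (5 x)
      obtain \<eta> i where x: "x = (\<eta>, i)" by (cases x)
      with 5 have "\<eta> $ i > 0" by auto
      from unit_step_down[OF this, symmetric] this show ?case by (simp add: x axis_def)
    qed
    finally show ?thesis ..
  qed
  have degree: "(\<Sum>i\<in>T. real (Suc (\<xi> $ i))) = real N + 3" if "\<xi> \<in> L N" for \<xi> N
  proof -
    have "(\<Sum>i\<in>T. real (Suc (\<xi> $ i))) = real (\<Sum>i\<in>T. \<xi> $ i) + real (card T)"
      by (simp add: sum.distrib)
    then show ?thesis using mass_T[OF that] T by simp
  qed
  have num_Suc: "(real N + 3) * num N = (real N + 1) * num (Suc N)" for N
  proof -
    have "(\<Sum>(\<xi>, i)\<in>L N \<times> T. real (Suc (\<xi> $ i)) * 1) = (\<Sum>\<xi>\<in>L N. \<Sum>i\<in>T. real (Suc (\<xi> $ i)))"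
      by (simp only: sum.cartesian_product mult_1_right)
    also have "\<dots> = (\<Sum>\<xi>\<in>L N. real N + 3)" by (intro sum.cong refl degree)
    finally show ?thesis
      using transport[where N = N and \<phi> = "\<lambda>_. 1"] by (simp add: num_def mult.commute add.commute)
  qed
  have num: "num N = (real N + 1) * (real N + 2) / 2" for N
  proof (induction N)
    case 0
    have "L 0 = {0}" by (auto simp: L_def mass_0_iff)
    then show ?case by (simp add: num_def)
  next
    case (Suc N)
    have "(real N + 1) * num (Suc N) = (real N + 1) * ((real N + 2) * (real N + 3) / 2)"
      using num_Suc[of N] unfolding Suc by (simp add: mult_ac)
    then have "num (Suc N) = (real N + 2) * (real N + 3) / 2"
      by (subst (asm) mult_cancel_left) linarith
    then show ?case by (simp add: add_ac)
  qed
  have num_pos: "num N > 0" for N unfolding num by (intro divide_pos_pos mult_pos_pos) linarith+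
  \<comment> \<open>The probability \<open>1 / num N\<close> to be at \<open>\<xi>\<close> times the probability to increase the coordinate \<open>i\<close>.\<close>
  define \<theta> where "\<theta> N x = real (Suc (fst x $ snd x)) / ((real N + 3) * num N)" for N and x :: "(nat ^ 'v) \<times> 'v"
  have \<theta>_sum: "(\<Sum>x\<in>L N \<times> T. \<theta> N x * f (fst x)) = sum f (L N) / num N"
    for N and f :: "nat ^ 'v \<Rightarrow> real"
  proof -
    have "(\<Sum>x\<in>L N \<times> T. \<theta> N x * f (fst x)) = (\<Sum>\<xi>\<in>L N. \<Sum>i\<in>T. \<theta> N (\<xi>, i) * f \<xi>)"
      by (subst sum.cartesian_product) (simp add: case_prod_unfold)
    also have "\<dots> = (\<Sum>\<xi>\<in>L N. f \<xi> / num N)"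
    proof (intro sum.cong refl)
      fix \<xi> assume \<xi>: "\<xi> \<in> L N"
      have "(\<Sum>i\<in>T. \<theta> N (\<xi>, i) * f \<xi>) = (\<Sum>i\<in>T. real (Suc (\<xi> $ i))) / ((real N + 3) * num N) * f \<xi>"
        unfolding \<theta>_def fst_conv snd_conv by (simp only: sum_divide_distrib sum_distrib_right)
      also have "\<dots> = f \<xi> / num N" unfolding degree[OF \<xi>] by simp
      finally show "(\<Sum>i\<in>T. \<theta> N (\<xi>, i) * f \<xi>) = f \<xi> / num N" .
    qed
    finally show ?thesis by (simp only: sum_divide_distrib)
  qed
  have \<theta>_transport: "(\<Sum>x\<in>L N \<times> T. \<theta> N x * f (fst x + axis (snd x) 1)) = sum f (L (Suc N)) / num (Suc N)"
    for N and f :: "nat ^ 'v \<Rightarrow> real"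
  proof -
    have "(\<Sum>x\<in>L N \<times> T. \<theta> N x * f (fst x + axis (snd x) 1)) =
        (\<Sum>(\<xi>, i)\<in>L N \<times> T. real (Suc (\<xi> $ i)) * f (\<xi> + axis i 1)) / ((real N + 3) * num N)"
      unfolding \<theta>_def sum_divide_distrib case_prod_unfold by (intro sum.cong refl) simp
    also have "\<dots> = real (Suc N) * sum f (L (Suc N)) / ((real N + 1) * num (Suc N))"
      unfolding transport num_Suc ..
    also have "\<dots> = sum f (L (Suc N)) / num (Suc N)"
      using num_pos[of "Suc N"] by (simp add: add.commute divide_simps)
    finally show ?thesis .
  qed
  have \<theta>_square: "(\<Sum>x\<in>L N \<times> T. (\<theta> N x)\<^sup>2) \<le> 1 / num N" for N
  proof -
    have "(\<Sum>x\<in>L N \<times> T. (\<theta> N x)\<^sup>2) \<le> (\<Sum>x\<in>L N \<times> T. \<theta> N x * (1 / num N))"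
    proof (intro sum_mono)
      fix x assume "x \<in> L N \<times> T"
      then have "fst x $ snd x \<le> N" using component_le_mass[of "fst x" "snd x"] by (auto simp: L_def)
      then have "real (Suc (fst x $ snd x)) / (real N + 3) \<le> 1" by simp
      then have "real (Suc (fst x $ snd x)) / (real N + 3) / num N \<le> 1 / num N"
        using num_pos[of N] by (intro divide_right_mono) auto
      then have "\<theta> N x \<le> 1 / num N" by (simp add: \<theta>_def)
      moreover have "\<theta> N x \<ge> 0" using num_pos[of N] by (simp add: \<theta>_def)
      ultimately show "(\<theta> N x)\<^sup>2 \<le> \<theta> N x * (1 / num N)"
        unfolding power2_eq_square by (rule mult_left_mono)
    qed
    also have "\<dots> = sum (\<lambda>_. 1 / num N) (L N) / num N"
      using \<theta>_sum[where N = N and f = "\<lambda>_. 1 / num N"] by simp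
    also have "\<dots> = 1 / num N" using num_pos[of N] by (simp add: num_def)
    finally show ?thesis .
  qed
  have "\<exists>F. finite F \<and> (\<phi> 0)\<^sup>2 \<le> 4 * energy F \<phi>" if fin: "finite {y. \<phi> y \<noteq> 0}" for \<phi>
  proof -
    obtain M where M: "M \<notin> mass ` {y. \<phi> y \<noteq> 0}"
      using ex_new_if_finite[OF infinite_UNIV_nat finite_imageI[OF fin]] by blast
    define avg where "avg N = sum \<phi> (L N) / num N" for N
    define I where "I = Sigma {..<M} (\<lambda>N. L N \<times> T)"
    define e where "e z = (fst (snd z), fst (snd z) + axis (snd (snd z)) (1::nat))"
      for z :: "nat \<times> (nat ^ 'v) \<times> 'v"
    define F where "F = fst ` e ` I \<union> snd ` e ` I"
    have finT: "finite T" by simp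
    have finI: "finite I" unfolding I_def using finL by auto
    have F: "finite F" "e ` I \<subseteq> F \<times> F"
      unfolding F_def image_subset_iff mem_Times_iff using finI by blast+
    have inj: "inj_on e I"
      by (auto simp: inj_on_def e_def I_def L_def axis_eq_axis)
    have cond_e: "cond (fst (e z)) (snd (e z)) = 1" if "z \<in> I" for z
    proof -
      have "weight (fst (snd z) + axis (snd (snd z)) 1) = 1"
        using that by (intro w) (auto simp: I_def L_def axis_def)
      then show ?thesis by (simp add: e_def cond_up[simplified])
    qed
    have level: "(\<Sum>x\<in>L N \<times> T. \<theta> N x * (\<phi> (fst x) - \<phi> (fst x + axis (snd x) 1))) = avg N - avg (Suc N)" for N
      unfolding right_diff_distrib sum_subtractf \<theta>_sum \<theta>_transport avg_def ..
    have "\<phi> 0 = avg 0"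
    proof -
      have "L 0 = {0}" by (auto simp: L_def mass_0_iff)
      then show ?thesis by (simp add: avg_def num_def)
    qed
    moreover have "avg M = 0"
      unfolding avg_def using M by (subst sum.neutral) (auto simp: L_def)
    ultimately have "\<phi> 0 = (\<Sum>N<M. avg N - avg (Suc N))"
      by (simp add: sum_lessThan_telescope')
    also have "\<dots> = (\<Sum>z\<in>I. \<theta> (fst z) (snd z) * (\<phi> (fst (e z)) - \<phi> (snd (e z))))"
      unfolding level[symmetric] I_def e_def using finL
      by (subst sum.Sigma) (auto simp: case_prod_unfold)
    finally have "(\<phi> 0)\<^sup>2 \<le> (\<Sum>z\<in>I. (\<theta> (fst z) (snd z))\<^sup>2 / cond (fst (e z)) (snd (e z))) * (2 * energy F \<phi>)"
      using flow_estimate[OF F(1) inj F(2), of "\<lambda>z. \<theta> (fst z) (snd z)" \<phi>] cond_e by simp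
    also have "\<dots> \<le> 2 * (2 * energy F \<phi>)"
    proof (intro mult_right_mono)
      have "(\<Sum>z\<in>I. (\<theta> (fst z) (snd z))\<^sup>2 / cond (fst (e z)) (snd (e z))) = (\<Sum>z\<in>I. (\<theta> (fst z) (snd z))\<^sup>2)"
        by (intro sum.cong) (auto simp: cond_e)
      also have "\<dots> = (\<Sum>N<M. \<Sum>x\<in>L N \<times> T. (\<theta> N x)\<^sup>2)"
        unfolding I_def using finL by (subst sum.Sigma) (auto simp: case_prod_unfold)
      also have "\<dots> \<le> (\<Sum>N<M. 1 / num N)" by (intro sum_mono \<theta>_square)
      \<comment> \<open>A telescoping sum, bounded by 2.\<close>
      also have "\<dots> = (\<Sum>N<M. 2 / (real N + 1) - 2 / (real (Suc N) + 1))"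
      proof (intro sum.cong refl)
        fix N
        have "1 / ((a + 1) * (a + 2) / 2) = 2 / (a + 1) - 2 / (a + 2)" if "a \<ge> 0" for a :: real
          using that by (simp add: divide_simps)
        from this[of "real N"] show "1 / num N = 2 / (real N + 1) - 2 / (real (Suc N) + 1)"
          unfolding num by (simp add: add_ac)
      qed
      also have "\<dots> = 2 - 2 / (real M + 1)" by (subst sum_lessThan_telescope') simp
      also have "\<dots> \<le> 2" by simp
      finally show "(\<Sum>z\<in>I. (\<theta> (fst z) (snd z))\<^sup>2 / cond (fst (e z)) (snd (e z))) \<le> 2" .
    qed (simp add: energy_nonneg)
    finally show ?thesis using F(1) by (intro exI[of _ F]) simp
  qed
  then show ?thesis unfolding nonzero_capacity_def by blast
qed

end

section \<open>The largest eigenvalue of a nonnegative symmetric matrix\<close>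

lemma symmetric_matrix_inner:
  fixes A :: "real ^ 'n ^ 'n::finite"
  assumes "transpose A = A"
  shows "x \<bullet> (A *v y) = (A *v x) \<bullet> y"
  using assms by (metis dot_lmul_matrix transpose_matrix_vector)

lemma finite_eigenvalues:
  fixes A :: "real ^ 'n ^ 'n::finite"
  assumes sym: "transpose A = A"
  shows "finite (eigenvalues A)"
proof -
  have "\<forall>\<mu>\<in>eigenvalues A. \<exists>v. v \<noteq> 0 \<and> A *v v = \<mu> *\<^sub>R v" by (auto simp: eigenvalues_def)
  then obtain f where f: "\<And>\<mu>. \<mu> \<in> eigenvalues A \<Longrightarrow> f \<mu> \<noteq> 0 \<and> A *v f \<mu> = \<mu> *\<^sub>R f \<mu>"
    by metis
  have orth: "f \<mu> \<bullet> f \<nu> = 0" if "\<mu> \<in> eigenvalues A" "\<nu> \<in> eigenvalues A" "\<mu> \<noteq> \<nu>" for \<mu> \<nu>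
  proof -
    have "\<nu> * (f \<mu> \<bullet> f \<nu>) = \<mu> * (f \<mu> \<bullet> f \<nu>)"
      using symmetric_matrix_inner[OF sym, of "f \<mu>" "f \<nu>"] f that by simp
    then show ?thesis using that(3) by simp
  qed
  have inj: "inj_on f (eigenvalues A)"
  proof (rule inj_onI, rule ccontr)
    fix \<mu> \<nu> assume *: "\<mu> \<in> eigenvalues A" "\<nu> \<in> eigenvalues A" "f \<mu> = f \<nu>" "\<mu> \<noteq> \<nu>"
    then have "f \<mu> \<bullet> f \<mu> = 0" using orth[of \<mu> \<nu>] by simp
    then show False using f[OF *(1)] by simp
  qed
  have "pairwise orthogonal (f ` eigenvalues A)"
    using orth by (auto simp: pairwise_def orthogonal_def)
  moreover have "0 \<notin> f ` eigenvalues A" using f by force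
  ultimately have "independent (f ` eigenvalues A)" by (rule pairwise_orthogonal_independent)
  then have "finite (f ` eigenvalues A)" by (rule independent_imp_finite)
  then show ?thesis using inj by (rule finite_imageD)
qed

text \<open>
  The Rayleigh quotient attains its maximum \<open>R\<close> on the unit sphere. Replacing the maximizer by its
  componentwise absolute value does not decrease the quadratic form, because the entries of \<open>A\<close> are
  nonnegative. A maximizer is an eigenvector, since the nonnegative quadratic form
  \<open>R (x \<bullet> x) - x \<bullet> A x\<close> vanishes to second order at it.
\<close>

lemma perron_vector:
  fixes A :: "real ^ 'n ^ 'n::finite"
  assumes sym: "transpose A = A" and nonneg: "\<And>i j. A $ i $ j \<ge> 0"
  obtains v where "v \<noteq> 0" "\<And>i. v $ i \<ge> 0" "A *v v = Max (eigenvalues A) *\<^sub>R v"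
    "\<And>x. x \<bullet> (A *v x) \<le> Max (eigenvalues A) * (x \<bullet> x)"
proof -
  let ?q = "\<lambda>x. x \<bullet> (A *v x)"
  have "compact (sphere (0 :: real ^ 'n) 1)" by simp
  moreover have "sphere (0 :: real ^ 'n) 1 \<noteq> {}" by simp
  moreover have "continuous_on (sphere 0 1) ?q"
    by (intro continuous_intros linear_continuous_on) (simp add: linear_linear)
  ultimately obtain u where u: "u \<in> sphere 0 1" "\<And>x. x \<in> sphere 0 1 \<Longrightarrow> ?q x \<le> ?q u"
    using continuous_attains_sup[of "sphere 0 1" ?q] by blast
  define R where "R = ?q u"
  have rayleigh: "?q x \<le> R * (x \<bullet> x)" for x
  proof (cases "x = 0")
    case False
    have "?q ((1 / norm x) *\<^sub>R x) \<le> R"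
      unfolding R_def using False by (intro u(2)) simp
    then have "?q x / (norm x)\<^sup>2 \<le> R"
      by (simp add: matrix_vector_mult_scaleR power2_eq_square)
    then show ?thesis using False by (simp add: divide_le_eq power2_norm_eq_inner)
  qed simp
  define v where "v = (\<chi> i. \<bar>u $ i\<bar>)"
  have q_sum: "?q x = (\<Sum>i\<in>UNIV. \<Sum>j\<in>UNIV. x $ i * (A $ i $ j * x $ j))" for x
    by (simp add: inner_vec_def matrix_vector_mult_def sum_distrib_left)
  have norm_u: "u \<bullet> u = 1" using u(1) by (simp add: norm_eq_1)
  have norm_v: "v \<bullet> v = 1"
    using norm_u by (simp add: inner_vec_def v_def flip: power2_eq_square)
  have v_pos: "v $ i \<ge> 0" for i by (simp add: v_def)
  have "R \<le> ?q v"
    unfolding R_def q_sum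
  proof (intro sum_mono)
    fix i j
    have "u $ i * (A $ i $ j * u $ j) \<le> \<bar>u $ i * (A $ i $ j * u $ j)\<bar>" by simp
    also have "\<dots> = v $ i * (A $ i $ j * v $ j)"
      by (simp add: v_def abs_mult nonneg)
    finally show "u $ i * (A $ i $ j * u $ j) \<le> v $ i * (A $ i $ j * v $ j)" .
  qed
  then have q_v: "?q v = R" using rayleigh[of v] norm_v by simp
  have eigen: "A *v v = R *\<^sub>R v"
  proof -
    define w where "w = A *v v - R *\<^sub>R v"
    define d where "d = w \<bullet> w"
    define g where "g = R * (w \<bullet> w) - ?q w"
    have d0: "d \<ge> 0" by (simp add: d_def)
    have quadratic: "2 * t * d \<le> t\<^sup>2 * g" for t
    proof -
      have "?q (v + t *\<^sub>R w) = ?q v + 2 * t * (w \<bullet> (A *v v)) + t\<^sup>2 * ?q w"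
        using symmetric_matrix_inner[OF sym, of v w]
        by (simp add: matrix_vector_right_distrib matrix_vector_mult_scaleR inner_left_distrib
            inner_right_distrib inner_commute[of _ w] power2_eq_square algebra_simps)
      moreover have "(v + t *\<^sub>R w) \<bullet> (v + t *\<^sub>R w) = v \<bullet> v + 2 * t * (w \<bullet> v) + t\<^sup>2 * (w \<bullet> w)"
        by (simp add: inner_left_distrib inner_right_distrib inner_commute[of v w] power2_eq_square algebra_simps)
      ultimately have "R + 2 * t * (w \<bullet> (A *v v)) + t\<^sup>2 * ?q w \<le> R * (1 + 2 * t * (w \<bullet> v) + t\<^sup>2 * (w \<bullet> w))"
        using rayleigh[of "v + t *\<^sub>R w"] unfolding q_v norm_v by simp
      moreover have d: "d = w \<bullet> (A *v v) - R * (w \<bullet> v)"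
        unfolding d_def by (subst (2) w_def) (simp add: inner_diff_right)
      have "2 * t * d = 2 * t * (w \<bullet> (A *v v)) - R * (2 * t * (w \<bullet> v))"
        unfolding d by (simp add: algebra_simps)
      moreover have "t\<^sup>2 * g = R * (t\<^sup>2 * (w \<bullet> w)) - t\<^sup>2 * ?q w"
        unfolding g_def by (simp add: algebra_simps)
      ultimately show ?thesis by (simp add: distrib_left)
    qed
    have "d = 0"
    proof -
      let ?N = "\<bar>g\<bar> + 1"
      \<comment> \<open>For small \<open>t\<close> the linear term would win; \<open>t = d / (\<bar>g\<bar> + 1)\<close> is small enough.\<close>
      have "2 * (d / ?N) * d \<le> (d / ?N)\<^sup>2 * g" by (rule quadratic)
      also have "\<dots> \<le> (d / ?N)\<^sup>2 * ?N" by (intro mult_left_mono) auto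
      also have "\<dots> = d\<^sup>2 / ?N" by (simp add: power2_eq_square)
      finally have "d\<^sup>2 / ?N \<le> 0" by (simp add: power2_eq_square)
      then show ?thesis using abs_ge_zero[of g] by (auto simp: divide_le_0_iff)
    qed
    then have "w = 0" by (simp add: d_def)
    then show ?thesis by (simp add: w_def)
  qed
  have "v \<noteq> 0" using norm_v by auto
  have "Max (eigenvalues A) = R"
  proof (rule Max_eqI[OF finite_eigenvalues[OF sym]])
    show "R \<in> eigenvalues A" using eigen \<open>v \<noteq> 0\<close> by (auto simp: eigenvalues_def)
    fix \<mu> assume "\<mu> \<in> eigenvalues A"
    then obtain x where x: "x \<noteq> 0" "A *v x = \<mu> *\<^sub>R x" by (auto simp: eigenvalues_def)
    then have "\<mu> * (x \<bullet> x) \<le> R * (x \<bullet> x)" using rayleigh[of x] by simp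
    moreover have "x \<bullet> x > 0" using x(1) by simp
    ultimately show "\<mu> \<le> R" by (simp add: mult_le_cancel_right)
  qed
  then show thesis using that[of v] \<open>v \<noteq> 0\<close> v_pos eigen rayleigh by blast
qed

text \<open>
  At each step a coordinate is increased that lags behind its target at the next time; one exists
  because the targets add up to the time. No coordinate is ever more than 1 ahead, and as the total is
  exact, none lags behind by more than the number of the other coordinates.
\<close>

lemma greedy_path:
  fixes v :: "real ^ 'v::finite"
  assumes nonneg: "\<And>i. v $ i \<ge> 0" and sum: "(\<Sum>i\<in>UNIV. v $ i) = 1"
  obtains p :: "nat \<Rightarrow> nat ^ 'v" where "\<And>k. \<exists>i. p (Suc k) = p k + axis i 1" "\<And>k. mass (p k) = k"
    "\<And>k i. \<bar>real (p k $ i) - real k * v $ i\<bar> \<le> real CARD('v)"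
proof -
  define choice where "choice k \<xi> = (SOME i. real (\<xi> $ i) < real (Suc k) * v $ i)" for k and \<xi> :: "nat ^ 'v"
  define p where "p = rec_nat (0 :: nat ^ 'v) (\<lambda>k \<xi>. \<xi> + axis (choice k \<xi>) 1)"
  have p0: "p 0 = 0" and pSuc: "p (Suc k) = p k + axis (choice k (p k)) 1" for k
    by (simp_all add: p_def)
  have mass_p: "mass (p k) = k" for k
  proof (induction k)
    case 0
    show ?case by (simp add: p0 mass_def)
  next
    case (Suc k)
    then show ?case by (simp add: pSuc mass_add del: One_nat_def)
  qed
  have sum_p: "(\<Sum>i\<in>UNIV. real (p k $ i)) = real k" for k
    using mass_p[of k] unfolding mass_def by (simp flip: of_nat_sum)
  have choice: "real (p k $ choice k (p k)) < real (Suc k) * v $ choice k (p k)" for k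
  proof -
    have "\<exists>i. real (p k $ i) < real (Suc k) * v $ i"
    proof (rule ccontr)
      assume "\<nexists>i. real (p k $ i) < real (Suc k) * v $ i"
      then have "(\<Sum>i\<in>UNIV. real (Suc k) * v $ i) \<le> (\<Sum>i\<in>UNIV. real (p k $ i))"
        by (intro sum_mono) (simp add: not_less)
      then have "real (Suc k) * (\<Sum>i\<in>UNIV. v $ i) \<le> real k"
        by (simp only: sum_distrib_left sum_p)
      then show False by (simp add: sum)
    qed
    then show ?thesis unfolding choice_def by (rule someI_ex)
  qed
  have upper: "real (p k $ i) \<le> real k * v $ i + 1" for k i
  proof (induction k)
    case (Suc k)
    show ?case
    proof (cases "i = choice k (p k)")
      case True
      then show ?thesis using choice[of k] by (simp add: pSuc axis_def)
    next
      case False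
      then have "real (p (Suc k) $ i) = real (p k $ i)" by (simp add: pSuc axis_def)
      then show ?thesis using Suc nonneg[of i] by (simp add: algebra_simps)
    qed
  qed (simp add: p0)
  have lower: "real k * v $ i - real CARD('v) \<le> real (p k $ i)" for k i
  proof -
    have "real k = real (p k $ i) + (\<Sum>j\<in>UNIV - {i}. real (p k $ j))"
      using sum.remove[of UNIV i "\<lambda>j. real (p k $ j)"] sum_p[of k] by simp
    also have "(\<Sum>j\<in>UNIV - {i}. real (p k $ j)) \<le> (\<Sum>j\<in>UNIV - {i}. real k * v $ j + 1)"
      by (intro sum_mono upper)
    also have "\<dots> = real k * (\<Sum>j\<in>UNIV - {i}. v $ j) + real (card (UNIV - {i}))"
      by (simp add: sum.distrib sum_distrib_left)
    also have "(\<Sum>j\<in>UNIV - {i}. v $ j) = 1 - v $ i"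
      using sum.remove[of UNIV i "\<lambda>j. v $ j"] sum by simp
    also have "real (card (UNIV - {i})) \<le> real CARD('v)"
      by (intro of_nat_mono card_mono) auto
    finally show ?thesis by (simp add: algebra_simps)
  qed
  show thesis
  proof (rule that[of p])
    show "\<exists>i. p (Suc k) = p k + axis i 1" for k using pSuc by blast
    show "\<bar>real (p k $ i) - real k * v $ i\<bar> \<le> real CARD('v)" for k i
    proof -
      have "1 \<le> real CARD('v)" using zero_less_card_finite[where 'a = 'v] by linarith
      then show ?thesis using upper[of k i] lower[of k i] by linarith
    qed
  qed (rule mass_p)
qed

section \<open>The phases\<close>

context interaction
begin

definition real_vec :: "nat ^ 'v \<Rightarrow> real ^ 'v" where
  "real_vec \<xi> = (\<chi> i. real (\<xi> $ i))"

abbreviation A :: "real ^ 'v ^ 'v" where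
  "A \<equiv> adj_matrix E"

abbreviation \<rho> :: real where
  "\<rho> \<equiv> largest_eigenvalue E"

lemma inner_A: "x \<bullet> (A *v y) = (\<Sum>i\<in>UNIV. \<Sum>j\<in>UNIV. if E i j then x $ i * y $ j else 0)"
  by (auto simp: inner_vec_def matrix_vector_mult_def adj_matrix_def sum_distrib_left intro!: sum.cong)

lemma real_pair_count: "real (pair_count \<xi> \<xi>) = real_vec \<xi> \<bullet> (A *v real_vec \<xi>)"
  unfolding inner_A by (auto simp: pair_count_def real_vec_def intro!: sum.cong)

lemma real_mass: "(\<Sum>i\<in>UNIV. real_vec \<xi> $ i) = real (mass \<xi>)"
  by (simp add: real_vec_def mass_def)

lemma weight_quadratic:
  "weight \<xi> = exp (\<alpha> / 2 * (real_vec \<xi> \<bullet> real_vec \<xi> - real (mass \<xi>))) * s ^ pair_count \<xi> \<xi>"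
  unfolding weight_def real_mass[symmetric]
  by (simp add: inner_vec_def real_vec_def right_diff_distrib sum_subtractf)

lemma weight_quadratic_ereal:
  assumes "\<beta> = ereal b"
  shows "weight \<xi> = exp ((\<alpha> * (real_vec \<xi> \<bullet> real_vec \<xi>) + b * (real_vec \<xi> \<bullet> (A *v real_vec \<xi>))) / 2
    - \<alpha> / 2 * real (mass \<xi>))"
proof -
  have "s ^ pair_count \<xi> \<xi> = exp (b / 2 * (real_vec \<xi> \<bullet> (A *v real_vec \<xi>)))"
    unfolding s_ereal[OF assms] real_pair_count[symmetric] exp_of_nat2_mult ..
  then show ?thesis
    unfolding weight_quadratic by (simp add: exp_add[symmetric] field_simps)
qed

lemma transpose_A: "transpose A = A"
  by (simp add: transpose_def adj_matrix_def vec_eq_iff E_sym)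

lemma perron_vector_A:
  obtains v where "v \<noteq> 0" "\<And>i. v $ i \<ge> 0" "A *v v = \<rho> *\<^sub>R v" "\<And>x. x \<bullet> (A *v x) \<le> \<rho> * (x \<bullet> x)"
  by (rule perron_vector[OF transpose_A]) (auto simp: adj_matrix_def largest_eigenvalue_def)

lemma rayleigh_A: "x \<bullet> (A *v x) \<le> \<rho> * (x \<bullet> x)"
  by (rule perron_vector_A)

lemma largest_eigenvalue_nonneg: "\<rho> \<ge> 0"
proof -
  obtain i :: 'v where True by simp
  let ?e = "axis i (1::real)"
  have "?e \<bullet> (A *v ?e) = 0"
    unfolding inner_A by (intro sum.neutral ballI) (auto simp: axis_def)
  moreover have "?e \<bullet> ?e = 1" by (simp add: inner_axis_axis)
  ultimately show ?thesis using rayleigh_A[of ?e] by simp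
qed

text \<open>
  The exponent of the weight is a quadratic form plus a linear one. The form is at most
  \<open>\<alpha> / 2\<close> times the squared norm if \<open>\<beta> \<le> 0\<close>, and at most \<open>(\<alpha> + \<beta> \<rho>) / 2\<close> times it otherwise. So
  the weight is summable.
\<close>

lemma positive_recurrent_case:
  assumes \<alpha>: "\<alpha> < 0" and subcritical: "ereal \<alpha> + \<beta> * ereal \<rho> < 0"
  shows "zeta_positive_recurrent \<alpha> \<beta> E"
proof -
  define \<gamma> where "\<gamma> = - \<alpha> / 2"
  have "\<exists>\<delta>>0. \<forall>\<xi>. weight \<xi> \<le> exp (- \<delta> * (real_vec \<xi> \<bullet> real_vec \<xi>) + \<gamma> * real (mass \<xi>))"
  proof (cases "\<beta> \<le> 0")
    case True
    then have "s \<le> 1"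
      using s_MInfty s_ereal \<beta>_finite by (cases \<beta>) auto
    then have "s ^ k \<le> 1" for k by (intro power_le_one s_nonneg)
    then have "weight \<xi> \<le> exp (\<alpha> / 2 * (real_vec \<xi> \<bullet> real_vec \<xi> - real (mass \<xi>)))" for \<xi>
      unfolding weight_quadratic by (simp add: mult_left_le)
    then show ?thesis using \<alpha> by (intro exI[of _ "- \<alpha> / 2"]) (simp add: \<gamma>_def algebra_simps)
  next
    case False
    then obtain b where b: "\<beta> = ereal b" "b > 0" using \<beta>_finite by (cases \<beta>) auto
    have neg: "\<alpha> + b * \<rho> < 0" using subcritical unfolding b(1) by simp
    have "weight \<xi> \<le> exp (- (- (\<alpha> + b * \<rho>) / 2) * (real_vec \<xi> \<bullet> real_vec \<xi>) + \<gamma> * real (mass \<xi>))" for \<xi>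
    proof -
      have "b * (real_vec \<xi> \<bullet> (A *v real_vec \<xi>)) \<le> b * (\<rho> * (real_vec \<xi> \<bullet> real_vec \<xi>))"
        using b(2) by (intro mult_left_mono rayleigh_A) simp
      then show ?thesis
        unfolding weight_quadratic_ereal[OF b(1)] \<gamma>_def exp_le_cancel_iff by (simp add: field_simps)
    qed
    then show ?thesis using neg by (intro exI[of _ "- (\<alpha> + b * \<rho>) / 2"]) auto
  qed
  then obtain \<delta> where \<delta>: "\<delta> > 0"
    and bound: "\<And>\<xi>. weight \<xi> \<le> exp (- \<delta> * (real_vec \<xi> \<bullet> real_vec \<xi>) + \<gamma> * real (mass \<xi>))" by blast
  define D where "D = (\<gamma> + 1)\<^sup>2 / (4 * \<delta>)"
  have coordinate: "- \<delta> * (x * x) + \<gamma> * x \<le> D - x" for x :: real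
  proof -
    \<comment> \<open>Completing the square determines \<open>D\<close>.\<close>
    have "0 \<le> (2 * \<delta> * x - (\<gamma> + 1))\<^sup>2 / (4 * \<delta>)" using \<delta> by simp
    also have "\<dots> = \<delta> * (x * x) - (\<gamma> + 1) * x + D"
      using \<delta> by (simp add: D_def power2_eq_square field_simps)
    finally show ?thesis by (simp add: algebra_simps)
  qed
  show ?thesis
  proof (rule zeta_positive_recurrentI[where r = "exp (- 1)" and C = "exp (real CARD('v) * D)"])
    fix \<xi>
    have "- \<delta> * (real_vec \<xi> \<bullet> real_vec \<xi>) + \<gamma> * real (mass \<xi>) =
        (\<Sum>i\<in>UNIV. - \<delta> * (real_vec \<xi> $ i * real_vec \<xi> $ i) + \<gamma> * real_vec \<xi> $ i)"
      unfolding real_mass[symmetric] by (simp add: inner_vec_def sum_distrib_left sum.distrib sum_negf sum_subtractf)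
    also have "\<dots> \<le> (\<Sum>i\<in>UNIV. D - real_vec \<xi> $ i)" by (intro sum_mono coordinate)
    also have "\<dots> = real CARD('v) * D - real (mass \<xi>)" by (simp add: sum_subtractf real_mass)
    finally have "weight \<xi> \<le> exp (real CARD('v) * D - real (mass \<xi>))"
      using bound[of \<xi>] by (meson exp_le_cancel_iff order_trans)
    also have "\<dots> = exp (real CARD('v) * D) * exp (- 1) ^ mass \<xi>"
      by (simp add: exp_diff exp_minus divide_inverse power_inverse flip: exp_of_nat_mult)
    finally show "weight \<xi> \<le> exp (real CARD('v) * D) * exp (- 1) ^ mass \<xi>" .
  qed simp_all
qed

text \<open>
  Along the ray spanned by the Perron vector \<open>v\<close> the quadratic part of the exponent is nonnegative. A
  lattice path at bounded distance \<open>d\<close> from the ray loses only a constant: as \<open>v\<close> is an eigenvector,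
  the terms that are linear in \<open>d\<close> appear in \<open>x \<bullet> A x\<close> and \<open>\<rho> (x \<bullet> x)\<close> alike. What remains is the
  linear part of the exponent, \<open>- \<alpha> / 2\<close> times the number of particles, which is positive even at
  criticality.
\<close>

lemma supercritical_case:
  assumes \<alpha>: "\<alpha> < 0" and b: "\<beta> = ereal b" "b > 0" and supercritical: "\<alpha> + b * \<rho> \<ge> 0"
  shows "zeta_transient \<alpha> \<beta> E"
proof -
  let ?n = "real CARD('v)"
  obtain u where u: "u \<noteq> 0" "\<And>i. u $ i \<ge> 0" "A *v u = \<rho> *\<^sub>R u"
    by (rule perron_vector_A) (rule that)
  define S where "S = (\<Sum>i\<in>UNIV. u $ i)"
  have "S > 0"
  proof -
    obtain i where "u $ i \<noteq> 0" using u(1) by (auto simp: vec_eq_iff)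
    then show ?thesis
      unfolding S_def using u(2) by (intro sum_pos2[of _ i]) (auto simp: less_le)
  qed
  define v where "v = (1 / S) *\<^sub>R u"
  have v: "\<And>i. v $ i \<ge> 0" "(\<Sum>i\<in>UNIV. v $ i) = 1" "A *v v = \<rho> *\<^sub>R v"
    using u \<open>S > 0\<close> by (simp_all add: v_def matrix_vector_mult_scaleR S_def[symmetric] flip: sum_divide_distrib)
  obtain p where p: "\<And>k. \<exists>i. p (Suc k) = p k + axis i 1" "\<And>k. mass (p k) = k"
      "\<And>k i. \<bar>real (p k $ i) - real k * v $ i\<bar> \<le> ?n"
    using greedy_path[OF v(1,2)] by metis
  define a where "a = - (b * (\<rho> * (?n * (?n * ?n)) + ?n * (?n * (?n * ?n)))) / 2"
  show ?thesis
  proof (rule zeta_transient_if_path)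
    show "\<exists>i. p (Suc k) = p k + axis i 1" for k by (rule p(1))
    show "- \<alpha> / 2 > 0" using \<alpha> by simp
    show "weight (p k) \<ge> exp (a + - \<alpha> / 2 * real k)" for k
    proof -
      define x where "x = real_vec (p k)"
      define d where "d = x - real k *\<^sub>R v"
      have d_le: "\<bar>d $ i\<bar> \<le> ?n" for i using p(3)[of k i] by (simp add: d_def x_def real_vec_def)
      have dd_le: "\<bar>d $ i * d $ j\<bar> \<le> ?n * ?n" for i j
        unfolding abs_mult by (intro mult_mono d_le) auto
      have x: "x = real k *\<^sub>R v + d" by (simp add: d_def)
      have "v \<bullet> (A *v d) = \<rho> * (v \<bullet> d)"
        using symmetric_matrix_inner[OF transpose_A, of v d] v(3) by simp
      then have quad: "x \<bullet> (A *v x) = \<rho> * (x \<bullet> x) - \<rho> * (d \<bullet> d) + d \<bullet> (A *v d)"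
        unfolding x by (simp add: matrix_vector_right_distrib matrix_vector_mult_scaleR inner_left_distrib
            inner_right_distrib v(3) inner_commute[of d v] algebra_simps)
      have dd: "d \<bullet> d \<le> ?n * (?n * ?n)"
      proof -
        have "d \<bullet> d \<le> (\<Sum>i\<in>(UNIV :: 'v set). ?n * ?n)"
          unfolding inner_vec_def inner_real_def using dd_le by (intro sum_mono) (auto intro: order_trans[OF abs_ge_self])
        then show ?thesis by simp
      qed
      have dAd: "d \<bullet> (A *v d) \<ge> - (?n * (?n * (?n * ?n)))"
      proof -
        have "(\<Sum>i\<in>(UNIV :: 'v set). \<Sum>j\<in>(UNIV :: 'v set). - (?n * ?n)) \<le> d \<bullet> (A *v d)"
          unfolding inner_A
        proof (intro sum_mono)
          fix i j
          show "- (?n * ?n) \<le> (if E i j then d $ i * d $ j else 0)"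
            using dd_le[of i j] by auto
        qed
        then show ?thesis by simp
      qed
      have "0 \<le> (\<alpha> + b * \<rho>) * (x \<bullet> x)" using supercritical by simp
      moreover have "b * (\<rho> * (d \<bullet> d)) \<le> b * (\<rho> * (?n * (?n * ?n)))"
        using b(2) dd largest_eigenvalue_nonneg by (intro mult_left_mono) auto
      moreover have "b * (d \<bullet> (A *v d)) \<ge> b * - (?n * (?n * (?n * ?n)))"
        using b(2) dAd by (intro mult_left_mono) auto
      moreover have "2 * a = - (b * (\<rho> * (?n * (?n * ?n)))) + b * - (?n * (?n * (?n * ?n)))"
        by (simp add: a_def distrib_left)
      ultimately have "2 * a \<le> \<alpha> * (x \<bullet> x) + b * (x \<bullet> (A *v x))"
        unfolding quad by (simp add: algebra_simps)
      then show ?thesis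
        unfolding weight_quadratic_ereal[OF b(1)] p(2) x_def[symmetric] exp_le_cancel_iff by simp
    qed
  qed
qed

lemma weight_axis: "weight (axis i k) = exp (\<alpha> / 2 * (real k * (real k - 1)))"
proof -
  have "(\<Sum>j\<in>UNIV. real (axis i k $ j) * (real (axis i k $ j) - 1)) = (\<Sum>j\<in>UNIV. if j = i then real k * (real k - 1) else 0)"
    by (intro sum.cong refl) (auto simp: axis_def)
  then show ?thesis by (simp add: weight_def pair_count_axis_axis)
qed

lemma transient_if_self_reinforcing:
  assumes "\<alpha> > 0"
  shows "zeta_transient \<alpha> \<beta> E"
proof -
  obtain i :: 'v where True by simp
  show ?thesis
  proof (rule zeta_transient_if_path)
    show "\<exists>j. axis i (Suc k) = axis i k + axis j 1" for k using axis_Suc by blast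
    show "\<alpha> / 2 > 0" using assms by simp
    show "weight (axis i k) \<ge> exp (- \<alpha> / 2 + \<alpha> / 2 * real k)" for k
    proof -
      have "0 \<le> \<alpha> / 2 * (real k - 1)\<^sup>2" using assms by simp
      then show ?thesis
        unfolding weight_axis exp_le_cancel_iff by (simp add: power2_eq_square algebra_simps)
    qed
  qed
qed

text \<open>
  With one particle at \<open>j\<close>, each further particle at its neighbour \<open>i\<close> multiplies the weight by \<open>e\<^bsup>\<beta>\<^esup>\<close>.
\<close>

lemma transient_if_edge:
  assumes \<alpha>: "\<alpha> = 0" and "\<beta> > 0" and ij: "E i j"
  shows "zeta_transient \<alpha> \<beta> E"
proof -
  obtain b where b: "\<beta> = ereal b" "b > 0" using \<open>\<beta> > 0\<close> \<beta>_finite by (cases \<beta>) auto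
  show ?thesis
  proof (rule zeta_transient_if_path)
    show "\<exists>l. axis j 1 + axis i (Suc k) = axis j 1 + axis i k + axis l 1" for k
      unfolding axis_Suc[of i k] by (auto simp: add.assoc)
    show "b > 0" by (rule b)
    show "weight (axis j 1 + axis i k) \<ge> exp (0 + b * real k)" for k
    proof -
      have "pair_count (axis j 1 + axis i k) (axis j 1 + axis i k) = 2 * k"
        using ij E_sym[of i j] by (simp add: pair_count_add pair_count_axis_axis)
      then have "weight (axis j 1 + axis i k) = exp (b / 2) ^ (2 * k)"
        unfolding weight_def s_ereal[OF b(1)] by (simp add: \<alpha>)
      also have "\<dots> = exp (0 + b * real k)"
        by (simp add: power_mult mult.commute flip: exp_of_nat_mult exp_double)
      finally show ?thesis by simp
    qed
  qed
qed

lemma transient_if_three: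
  assumes \<alpha>: "\<alpha> = 0" and T: "card T = 3" and free: "\<beta> = 0 \<or> (\<forall>i\<in>T. \<forall>j\<in>T. \<not> E i j)"
  shows "zeta_transient \<alpha> \<beta> E"
proof (rule zeta_transientI)
  show "nonzero_capacity 0"
  proof (rule nonzero_capacity_octant[OF T])
    fix \<xi> :: "nat ^ 'v" assume supp: "\<And>i. i \<notin> T \<Longrightarrow> \<xi> $ i = 0"
    have "s ^ pair_count \<xi> \<xi> = 1"
      using free
    proof
      assume "\<beta> = 0"
      then have "s = 1" using s_ereal[of 0] by (simp add: zero_ereal_def)
      then show ?thesis by simp
    next
      assume "\<forall>i\<in>T. \<forall>j\<in>T. \<not> E i j"
      then have "pair_count \<xi> \<xi> = 0" unfolding pair_count_0_iff using supp by fastforce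
      then show ?thesis by simp
    qed
    then show "weight \<xi> = 1" unfolding weight_def by (simp add: \<alpha>)
  qed
qed simp

lemma independent_card_le:
  assumes "\<And>i j. i \<in> T \<Longrightarrow> j \<in> T \<Longrightarrow> \<not> E i j"
  shows "card T \<le> independence_number E"
proof -
  have "finite {card S |S. \<forall>i\<in>S. \<forall>j\<in>S. \<not> E i j}"
    by (rule finite_subset[of _ "card ` UNIV"]) auto
  then show ?thesis
    unfolding independence_number_def using assms by (intro Max_ge) auto
qed

lemma independent_set_attained:
  obtains S where "card S = independence_number E" "\<forall>i\<in>S. \<forall>j\<in>S. \<not> E i j"
proof -
  let ?C = "{card S |S. \<forall>i\<in>S. \<forall>j\<in>S. \<not> E i j}"
  have "finite ?C" by (rule finite_subset[of _ "card ` UNIV"]) auto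
  moreover have "card {} \<in> ?C" by (intro CollectI exI[of _ "{}"]) simp
  ultimately have "Max ?C \<in> ?C" by (intro Max_in) auto
  then show thesis using that unfolding independence_number_def by auto
qed

lemma subset_pair_if_card_le_2:
  assumes "card (T :: 'v set) \<le> 2"
  obtains i j where "T \<subseteq> {i, j}"
proof -
  consider "card T = 0" | "card T = 1" | "card T = 2" using assms by linarith
  then show thesis
    using that by cases (auto simp: card_1_singleton_iff card_2_iff)
qed

text \<open>
  Two large coordinates at adjacent vertices make the weight tiny. Precisely, the vertices \<open>k\<close> with
  \<open>\<xi>\<^sub>k\<^sup>2\<close> above the exponent of \<open>s\<close> form an independent set, so there are at most two of them, and the
  weight decays exponentially in all other coordinates.
\<close>

lemma null_recurrent_if_repulsive:
  assumes \<alpha>: "\<alpha> = 0" and \<beta>: "\<beta> < 0" and \<kappa>: "independence_number E \<le> 2"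
  shows "zeta_null_recurrent \<alpha> \<beta> E"
proof -
  have s1: "s < 1" using \<beta> s_MInfty s_ereal by (cases \<beta>) auto
  \<comment> \<open>The exponent pays for all vertices at once, hence the root; the maximum keeps \<open>r\<close> positive when \<open>s = 0\<close>.\<close>
  define t where "t = max s (1 / 2)"
  define r where "r = root CARD('v) t"
  have t: "0 < t" "t < 1" "s \<le> t" using s1 by (auto simp: t_def)
  have r: "0 < r" "r < 1" "r ^ CARD('v) = t" using t by (auto simp: r_def)
  show ?thesis
  proof (rule zeta_null_recurrentI[OF \<alpha> r(1,2)])
    fix \<xi>
    let ?Q = "pair_count \<xi> \<xi>"
    define T where "T = {k. (\<xi> $ k)\<^sup>2 > ?Q}"
    have "\<not> E i j" if "i \<in> T" "j \<in> T" for i j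
    proof
      assume "E i j"
      then have "(\<xi> $ i * \<xi> $ j)\<^sup>2 \<le> ?Q\<^sup>2" using pair_count_ge by (simp add: power_mono)
      moreover have "?Q * ?Q < (\<xi> $ i)\<^sup>2 * (\<xi> $ j)\<^sup>2"
        using that by (intro mult_strict_mono') (auto simp: T_def)
      ultimately show False by (simp add: power_mult_distrib power2_eq_square[of ?Q])
    qed
    then have "card T \<le> 2" using independent_card_le[of T] \<kappa> by simp
    then obtain i j where ij: "T \<subseteq> {i, j}" by (rule subset_pair_if_card_le_2)
    have "weight \<xi> = s ^ ?Q" unfolding weight_def by (simp add: \<alpha>)
    also have "\<dots> \<le> t ^ ?Q" by (intro power_mono t s_nonneg)
    also have "\<dots> = (\<Prod>k\<in>(UNIV :: 'v set). r ^ ?Q)"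
      by (simp add: r(3)[symmetric] power_mult[symmetric] mult.commute)
    also have "\<dots> \<le> (\<Prod>k\<in>UNIV. if k = i \<or> k = j then 1 else r ^ (\<xi> $ k))"
    proof (intro prod_mono conjI)
      fix k
      show "r ^ ?Q \<le> (if k = i \<or> k = j then 1 else r ^ (\<xi> $ k))"
      proof (cases "k = i \<or> k = j")
        case True
        then show ?thesis using r by (auto intro: power_le_one)
      next
        case False
        then have "k \<notin> T" using ij by auto
        then have "(\<xi> $ k)\<^sup>2 \<le> ?Q" by (simp add: T_def not_less)
        moreover have "\<xi> $ k \<le> (\<xi> $ k)\<^sup>2" by (simp add: power2_eq_square)
        ultimately show ?thesis using r False by (auto intro!: power_decreasing)
      qed
    qed (use r in simp)
    finally show "\<exists>i j. weight \<xi> \<le> (\<Prod>k\<in>UNIV. if k = i \<or> k = j then 1 else r ^ (\<xi> $ k))" by blast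
  qed
qed

lemma null_recurrent_if_free:
  assumes \<alpha>: "\<alpha> = 0" and free: "\<beta> = 0 \<or> (\<forall>i j. \<not> E i j)" and n: "CARD('v) \<le> 2"
  shows "zeta_null_recurrent \<alpha> \<beta> E"
proof -
  obtain i j :: 'v where ij: "UNIV \<subseteq> {i, j}" using n by (rule subset_pair_if_card_le_2)
  show ?thesis
  proof (rule zeta_null_recurrentI[OF \<alpha>, of "1 / 2"])
    fix \<xi>
    have "s ^ pair_count \<xi> \<xi> = 1"
    proof (cases "\<beta> = 0")
      case True
      then have "s = 1" using s_ereal[of 0] by (simp add: zero_ereal_def)
      then show ?thesis by simp
    next
      case False
      then show ?thesis using free by (simp add: pair_count_def)
    qed
    then have "weight \<xi> = 1" unfolding weight_def by (simp add: \<alpha>)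
    moreover have "(\<Prod>k\<in>UNIV. if k = i \<or> k = j then 1 else (1 / 2 :: real) ^ (\<xi> $ k)) = 1"
      using ij by (intro prod.neutral) auto
    ultimately show "\<exists>i j. weight \<xi> \<le> (\<Prod>k\<in>UNIV. if k = i \<or> k = j then 1 else (1 / 2) ^ (\<xi> $ k))"
      by (metis order_refl)
  qed simp_all
qed

lemma num_edges_0_iff: "num_edges E = 0 \<longleftrightarrow> (\<forall>i j. \<not> E i j)"
proof -
  have "finite {{i, j} |i j. E i j}" by (rule finite_subset[of _ UNIV]) auto
  then show ?thesis unfolding num_edges_def by (subst card_0_eq) auto
qed

lemma transient_if_three_vertices:
  assumes "\<alpha> = 0" and "\<beta> = 0 \<or> (\<forall>i j. \<not> E i j)" and "CARD('v) \<ge> 3"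
  shows "zeta_transient \<alpha> \<beta> E"
proof -
  obtain T :: "'v set" where "card T = 3" using obtain_subset_with_card_n[OF assms(3)] by metis
  then show ?thesis using assms(1,2) by (intro transient_if_three[of T]) auto
qed

lemma transient_if_three_independent:
  assumes "\<alpha> = 0" and "independence_number E \<ge> 3"
  shows "zeta_transient \<alpha> \<beta> E"
proof -
  obtain S where S: "card S = independence_number E" "\<forall>i\<in>S. \<forall>j\<in>S. \<not> E i j"
    by (rule independent_set_attained)
  then obtain T where "T \<subseteq> S" "card T = 3" using obtain_subset_with_card_n[of 3 S] assms(2) by metis
  then show ?thesis using assms(1) S(2) by (intro transient_if_three[of T]) auto
qed

lemma transient_if_supercritical:
  assumes "\<alpha> < 0" and ge: "ereal \<alpha> + \<beta> * ereal \<rho> \<ge> 0"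
  shows "zeta_transient \<alpha> \<beta> E"
proof -
  have "\<beta> \<noteq> - \<infinity>"
  proof
    assume "\<beta> = - \<infinity>"
    then have "ereal \<alpha> + \<beta> * ereal \<rho> < 0"
      using assms(1) largest_eigenvalue_nonneg by (cases "\<rho> = 0") auto
    with ge show False by simp
  qed
  then obtain b where b: "\<beta> = ereal b" using \<beta>_finite by (cases \<beta>) auto
  have "\<alpha> + b * \<rho> \<ge> 0" using ge unfolding b by simp
  moreover have "b > 0"
  proof (rule ccontr)
    assume "\<not> b > 0"
    then have "b * \<rho> \<le> 0" by (intro mult_nonpos_nonneg largest_eigenvalue_nonneg) simp
    with \<open>\<alpha> + b * \<rho> \<ge> 0\<close> assms(1) show False by linarith
  qed
  ultimately show ?thesis using supercritical_case assms(1) b by blast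
qed

end

theorem theorem5p1:
  fixes E :: "'v::finite \<Rightarrow> 'v \<Rightarrow> bool" and \<alpha> :: real and \<beta> :: ereal
  assumes "symp E" and "irreflp E" and "\<beta> < \<infinity>"
  shows
    "let n = CARD('v);
         l1 = ereal (largest_eigenvalue E);
         case_i = (\<alpha> < 0 \<and> ereal \<alpha> + \<beta> * l1 < 0);
         case_ii =
           ((\<alpha> = 0 \<and> \<beta> < 0 \<and> independence_number E \<le> 2) \<or>
            (\<alpha> = 0 \<and> \<beta> = 0 \<and> n \<le> 2) \<or>
            (\<alpha> = 0 \<and> \<beta> > 0 \<and> num_edges E = 0 \<and> n \<le> 2));
         case_iii =
           (\<alpha> > 0 \<or>
            (\<alpha> = 0 \<and> \<beta> > 0 \<and> num_edges E > 0) \<or>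
            (\<alpha> = 0 \<and> \<beta> > 0 \<and> num_edges E = 0 \<and> n \<ge> 3) \<or>
            (\<alpha> = 0 \<and> \<beta> = 0 \<and> n \<ge> 3) \<or>
            (\<alpha> = 0 \<and> \<beta> < 0 \<and> independence_number E \<ge> 3) \<or>
            (\<alpha> < 0 \<and> ereal \<alpha> + \<beta> * l1 \<ge> 0))
     in (case_i \<longrightarrow> zeta_positive_recurrent \<alpha> \<beta> E) \<and>
        (case_ii \<longrightarrow> zeta_null_recurrent \<alpha> \<beta> E) \<and>
        (case_iii \<longrightarrow> zeta_transient \<alpha> \<beta> E) \<and>
        (case_iii \<longleftrightarrow> \<not> case_i \<and> \<not> case_ii)"
proof -
  interpret interaction \<alpha> \<beta> E using assms by unfold_locales
  let ?n = "CARD('v)" and ?crit = "ereal \<alpha> + \<beta> * ereal (largest_eigenvalue E)"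
  let ?i = "\<alpha> < 0 \<and> ?crit < 0"
  let ?ii = "(\<alpha> = 0 \<and> \<beta> < 0 \<and> independence_number E \<le> 2) \<or> (\<alpha> = 0 \<and> \<beta> = 0 \<and> ?n \<le> 2) \<or>
    (\<alpha> = 0 \<and> \<beta> > 0 \<and> num_edges E = 0 \<and> ?n \<le> 2)"
  let ?iii = "\<alpha> > 0 \<or> (\<alpha> = 0 \<and> \<beta> > 0 \<and> num_edges E > 0) \<or> (\<alpha> = 0 \<and> \<beta> > 0 \<and> num_edges E = 0 \<and> ?n \<ge> 3) \<or>
    (\<alpha> = 0 \<and> \<beta> = 0 \<and> ?n \<ge> 3) \<or> (\<alpha> = 0 \<and> \<beta> < 0 \<and> independence_number E \<ge> 3) \<or> (\<alpha> < 0 \<and> ?crit \<ge> 0)"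
  have "?i \<longrightarrow> zeta_positive_recurrent \<alpha> \<beta> E"
    using positive_recurrent_case by blast
  moreover have "?ii \<longrightarrow> zeta_null_recurrent \<alpha> \<beta> E"
    using null_recurrent_if_repulsive null_recurrent_if_free num_edges_0_iff by blast
  moreover have "?iii \<longrightarrow> zeta_transient \<alpha> \<beta> E"
  proof (intro impI, elim disjE conjE)
    assume "\<alpha> = 0" "\<beta> > 0" "num_edges E > 0"
    moreover from this obtain i j where "E i j" using num_edges_0_iff by auto
    ultimately show "zeta_transient \<alpha> \<beta> E" using transient_if_edge by blast
  qed (use transient_if_self_reinforcing transient_if_three_vertices transient_if_three_independent
      transient_if_supercritical num_edges_0_iff in blast)+
  moreover have "?iii \<longleftrightarrow> \<not> ?i \<and> \<not> ?ii"
  proof -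
    consider "\<alpha> > 0" | "\<alpha> < 0" | "\<alpha> = 0" "\<beta> > 0" | "\<alpha> = 0" "\<beta> = 0" | "\<alpha> = 0" "\<beta> < 0"
      by (meson linorder_neqE)
    then show ?thesis by cases (auto simp: not_less not_le)
  qed
  ultimately show ?thesis unfolding Let_def by blast
qed

end
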